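(* Let $\alpha_r,\alpha_s\in\Delta$ be distinct simple roots, $D=\{x\in\mathfrak h:\alpha_r(x)=\alpha_s(x)=0\}$ (times the line with coordinate $x_{l+1}$), and $\widetilde\Delta=\Delta\setminus\{\alpha_r,\alpha_s\}$. The determinant of the Gram matrix of the restricted Saito metric $\eta_D$ in the linear coordinates $\tilde x_i$ ($i\neq r,s$), $x_{l+1}$ on $D$ satisfies $$\det\eta_D\;\equiv\;I_s\,I_r\prod_{\alpha\in\widetilde\Delta}\mathsf e_\alpha^2\;\Big|_D,$$ where $\equiv$ denotes equality up to multiplication by a unit.
   Context: **Root data.** $\mathcal R$ is the irreducible (reduced, crystallographic) root system of rank $l$ of a complex simple Lie algebra with Cartan subalgebra $\mathfrak h$; $(\cdot,\cdot)$ is the complexified Killing form (Bourbaki normalisation), used to identify $\mathfrak h\cong\mathfrak h^*$; $\Delta=\{\alpha_1,\dots,\alpha_l\}$ are the simple roots, $\mathcal R_+$ the positive roots, $\mathcal W$ the Weyl group, $\omega_i$ the fundamental weights, $\omega_i^\vee$ the fundamental coweights ($(\omega_i^\vee,\alpha_j)=\delta_{ij}$), $\Lambda_w$ the weight lattice. The marked index $\bar k$ is: any element of $\{1,\dots,l\}$ for $A_l$; $l-1$ for $B_l$; $l$ for $C_l$; $l-2$ for $D_l$; the trivalent node for $E_6,E_7,E_8$; $2$ (Bourbaki labelling) for $F_4,G_2$. Put $d_i=(\omega_i,\omega_{\bar k})$. On $\mathfrak h\oplus\mathbb C$ use coordinates $\tilde x_i=(\omega_i^\vee,x)$ for $x\in\mathfrak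 h$ (so $\partial/\partial\tilde x_i=\partial_{\alpha_i}$, the directional derivative along $\alpha_i$) and $x_{l+1}$ on $\mathbb C$. **Trigonometric notation.** $\beta(x)=(\beta,x)$, $\mathsf e_\beta=2\sinh(\tfrac12\beta(x))$. A unit is a non-zero constant multiple of $\mathrm e^{(\mu(x)+\nu x_{l+1})/m'}$ with $\mu\in\Lambda_w$, $\nu\in\mathbb Z$, $m'\in\mathbb Z_{>0}$ (or its restriction to $D$); Fourier polynomials are finite linear combinations of such exponentials. **Metric (Dubrovin–Zhang).** Let $Y_i=\sum_{w\in\mathcal W}\mathrm e^{(w\omega_i,x)}$, $y_i=\mathrm e^{d_ix_{l+1}}Y_i$ ($i\le l$), $y_{l+1}=x_{l+1}$. Let $\gamma$ be the constant form equal to $(\cdot,\cdot)$ on $\mathfrak h$ plus $\gamma(\partial_{x_{l+1}},\partial_{x_{l+1}})=-d_{\bar k}$. The Saito metric $\eta$ has contravariant form $\mathcal L_e\gamma^{-1}$, with $e$ a non-zero constant multiple of $\partial/\partial y_{\bar k}$. It is flat, with flat coordinates $t_1,\dots,t_l$ (polynomials in $y_1,\dots,y_l,\mathrm e^{x_{l+1}}$) and $t_{l+1}=x_{l+1}$, ordered and normalised so that $e=\partial_{t_1}$ and $\eta(\partial_{t_\alpha},\partial_{t_\beta})=\delta_{\alpha+\beta,l+2}$ up to an overall non-zero constant. **Reduced minors.** $J_m$ is the minor of $(\partial_{\alpha_j}t_i)_{1\le i,j\le l}$ obtained by deleting the first row (that of $t_1$) and the $m$-th column; $I_m=J_m\prod_{\alpha\in\Delta\setminus\{\alpha_m\}}\mathsf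 e_\alpha^{-1}$, which is a Fourier polynomial. *)

theory Defs
  imports "HOL-Analysis.Analysis" "Jordan_Normal_Form.Determinant"
begin

no_notation vec_index (infixl "$" 100)

text \<open>
  A root system of rank \<open>l\<close> lives in the Euclidean space \<open>real^'n\<close> with \<open>l = CARD('n)\<close>; the Cartan
  subalgebra is the complexification \<open>complex^'n\<close>, with the complex-bilinear extension of the inner
  product.  The extended space (Cartan subalgebra plus one complex line) is \<open>complex^('n option)\<close>:
  the components \<open>Some j\<close> are orthonormal coordinates on the Cartan subalgebra and the component
  \<open>None\<close> is the coordinate on the extra line, written \<open>x\<^bsub>l+1\<^esub>\<close> below.
  Simple roots, weights and coordinate functions are indexed by natural numbers starting from 1.
\<close>

section \<open>Root systems\<close>

definition root_reflection :: "real^'n \<Rightarrow> real^'n \<Rightarrow> real^'n" where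
  "root_reflection a v = v - (2 * (v \<bullet> a) / (a \<bullet> a)) *\<^sub>R a"

text \<open>Reduced crystallographic root systems.\<close>

definition root_system :: "(real^'n) set \<Rightarrow> bool" where
  "root_system R \<longleftrightarrow>
     finite R \<and> 0 \<notin> R \<and> span R = UNIV \<and>
     (\<forall>a\<in>R. \<forall>b\<in>R. root_reflection a b \<in> R) \<and>
     (\<forall>a\<in>R. \<forall>b\<in>R. 2 * (b \<bullet> a) / (a \<bullet> a) \<in> \<int>) \<and>
     (\<forall>a\<in>R. \<forall>q::real. q *\<^sub>R a \<in> R \<longrightarrow> q = 1 \<or> q = - 1)"

definition irreducible_roots :: "(real^'n) set \<Rightarrow> bool" where
  "irreducible_roots R \<longleftrightarrow>
     R \<noteq> {} \<and>
     \<not> (\<exists>A B. A \<noteq> {} \<and> B \<noteq> {} \<and> R = A \<union> B \<and> (\<forall>a\<in>A. \<forall>b\<in>B. a \<bullet> b = 0))"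

definition simple_roots :: "(real^'n) set \<Rightarrow> (nat \<Rightarrow> real^'n) \<Rightarrow> bool" where
  "simple_roots R \<alpha> \<longleftrightarrow>
     \<alpha> ` {1..CARD('n)} \<subseteq> R \<and> inj_on \<alpha> {1..CARD('n)} \<and> independent (\<alpha> ` {1..CARD('n)}) \<and>
     (\<forall>b\<in>R. \<exists>m :: nat \<Rightarrow> nat.
        b = (\<Sum>i=1..CARD('n). real (m i) *\<^sub>R \<alpha> i) \<or>
        b = - (\<Sum>i=1..CARD('n). real (m i) *\<^sub>R \<alpha> i))"

inductive_set weyl_group :: "(real^'n) set \<Rightarrow> (real^'n \<Rightarrow> real^'n) set" for R where
  "id \<in> weyl_group R"
| "a \<in> R \<Longrightarrow> w \<in> weyl_group R \<Longrightarrow> root_reflection a \<circ> w \<in> weyl_group R"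

definition fund_weight :: "(nat \<Rightarrow> real^'n) \<Rightarrow> nat \<Rightarrow> real^'n" where
  "fund_weight \<alpha> i =
     (THE v. \<forall>j\<in>{1..CARD('n)}. 2 * (v \<bullet> \<alpha> j) / (\<alpha> j \<bullet> \<alpha> j) = (if i = j then 1 else 0))"

definition fund_coweight :: "(nat \<Rightarrow> real^'n) \<Rightarrow> nat \<Rightarrow> real^'n" where
  "fund_coweight \<alpha> i = (THE v. \<forall>j\<in>{1..CARD('n)}. v \<bullet> \<alpha> j = (if i = j then 1 else 0))"

definition weight_lattice :: "(real^'n) set \<Rightarrow> (real^'n) set" where
  "weight_lattice R = {v. \<forall>b\<in>R. 2 * (v \<bullet> b) / (b \<bullet> b) \<in> \<int>}"

section \<open>Bourbaki labelling, normalisation and the marked index\<close>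

datatype dynkin_type = Type_A | Type_B | Type_C | Type_D | Type_E | Type_F | Type_G

fun type_rank :: "dynkin_type \<Rightarrow> nat \<Rightarrow> bool" where
  "type_rank Type_A l \<longleftrightarrow> l \<ge> 1"
| "type_rank Type_B l \<longleftrightarrow> l \<ge> 2"
| "type_rank Type_C l \<longleftrightarrow> l \<ge> 2"
| "type_rank Type_D l \<longleftrightarrow> l \<ge> 4"
| "type_rank Type_E l \<longleftrightarrow> l \<in> {6, 7, 8}"
| "type_rank Type_F l \<longleftrightarrow> l = 4"
| "type_rank Type_G l \<longleftrightarrow> l = 2"

text \<open>Edges of the Dynkin diagram in Bourbaki's labelling, listed for \<open>i < j\<close> (without multiplicity).\<close>

fun dynkin_edge :: "dynkin_type \<Rightarrow> nat \<Rightarrow> nat \<Rightarrow> nat \<Rightarrow> bool" where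
  "dynkin_edge Type_D l i j \<longleftrightarrow> (j = i + 1 \<and> j \<le> l - 1) \<or> (i = l - 2 \<and> j = l)"
| "dynkin_edge Type_E l i j \<longleftrightarrow> (i, j) \<in> {(1, 3), (2, 4)} \<or> (3 \<le> i \<and> j = i + 1)"
| "dynkin_edge _ l i j \<longleftrightarrow> j = i + 1"

text \<open>Squared length of the \<open>i\<close>-th simple root in Bourbaki's plates (Lie, Ch. VI).\<close>

fun root_norm2 :: "dynkin_type \<Rightarrow> nat \<Rightarrow> nat \<Rightarrow> real" where
  "root_norm2 Type_B l i = (if i = l then 1 else 2)"
| "root_norm2 Type_C l i = (if i = l then 4 else 2)"
| "root_norm2 Type_F l i = (if i \<le> 2 then 2 else 1)"
| "root_norm2 Type_G l i = (if i = 1 then 2 else 6)"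
| "root_norm2 _ l i = 2"

text \<open>
  For adjacent simple roots one of the two Cartan integers is \<open>-1\<close>, the one with the longer root in
  the denominator; hence their inner product is minus half the larger squared length.
\<close>

definition bourbaki_labelled :: "dynkin_type \<Rightarrow> (nat \<Rightarrow> real^'n) \<Rightarrow> bool" where
  "bourbaki_labelled X \<alpha> \<longleftrightarrow>
     type_rank X CARD('n) \<and>
     (\<forall>i\<in>{1..CARD('n)}. \<forall>j\<in>{1..CARD('n)}.
        \<alpha> i \<bullet> \<alpha> j =
          (if i = j then root_norm2 X CARD('n) i
           else if dynkin_edge X CARD('n) (min i j) (max i j)
             then - max (root_norm2 X CARD('n) i) (root_norm2 X CARD('n) j) / 2
           else 0))"

fun marked_index :: "dynkin_type \<Rightarrow> nat \<Rightarrow> nat \<Rightarrow> bool" where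
  "marked_index Type_A l k \<longleftrightarrow> k \<in> {1..l}"
| "marked_index Type_B l k \<longleftrightarrow> k = l - 1"
| "marked_index Type_C l k \<longleftrightarrow> k = l"
| "marked_index Type_D l k \<longleftrightarrow> k = l - 2"
| "marked_index Type_E l k \<longleftrightarrow> k = 4"
| "marked_index Type_F l k \<longleftrightarrow> k = 2"
| "marked_index Type_G l k \<longleftrightarrow> k = 2"

section \<open>The extended space and Fourier polynomials\<close>

text \<open>\<open>cpair b x\<close> is \<open>b(x) = (b, x)\<close>, which ignores the component \<open>x\<^bsub>l+1\<^esub>\<close>.\<close>

definition cpair :: "real^'n \<Rightarrow> complex^('n option) \<Rightarrow> complex" where
  "cpair b x = (\<Sum>j\<in>UNIV. complex_of_real (b $ j) * x $ Some j)"

definition emb :: "real^'n \<Rightarrow> complex^('n option)" where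
  "emb b = (\<chi> j. case j of None \<Rightarrow> 0 | Some i \<Rightarrow> complex_of_real (b $ i))"

definition e_root :: "real^'n \<Rightarrow> complex^('n option) \<Rightarrow> complex" where
  "e_root b x = 2 * sinh (cpair b x / 2)"

definition fourier_exp :: "real^'n \<Rightarrow> int \<Rightarrow> nat \<Rightarrow> complex^('n option) \<Rightarrow> complex" where
  "fourier_exp \<mu> \<nu> m x = exp ((cpair \<mu> x + of_int \<nu> * x $ None) / of_nat m)"

definition fourier_unit :: "(real^'n) set \<Rightarrow> (complex^('n option) \<Rightarrow> complex) \<Rightarrow> bool" where
  "fourier_unit R u \<longleftrightarrow>
     (\<exists>q \<mu> \<nu> m. q \<noteq> 0 \<and> \<mu> \<in> weight_lattice R \<and> m > 0 \<and> (\<forall>x. u x = q * fourier_exp \<mu> \<nu> m x))"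

definition fourier_poly :: "(real^'n) set \<Rightarrow> (complex^('n option) \<Rightarrow> complex) \<Rightarrow> bool" where
  "fourier_poly R f \<longleftrightarrow>
     (\<exists>(N::nat) q \<mu> \<nu> m. (\<forall>i<N. \<mu> i \<in> weight_lattice R \<and> m i > 0) \<and>
        (\<forall>x. f x = (\<Sum>i<N. q i * fourier_exp (\<mu> i) (\<nu> i) (m i) x)))"

section \<open>Calculus in linear coordinates\<close>

definition dir_deriv :: "complex^'m \<Rightarrow> (complex^'m \<Rightarrow> complex) \<Rightarrow> complex^'m \<Rightarrow> complex" where
  "dir_deriv v f x = deriv (\<lambda>s. f (x + s *s v)) 0"

text \<open>The functions \<open>f 1, \<dots>, f N\<close> have jointly injective differential at \<open>x\<close>.\<close>

definition coords_at :: "(nat \<Rightarrow> complex^'m \<Rightarrow> complex) \<Rightarrow> complex^'m \<Rightarrow> bool" where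
  "coords_at f x \<longleftrightarrow> (\<forall>v. (\<forall>a\<in>{1..CARD('m)}. dir_deriv v (f a) x = 0) \<longrightarrow> v = 0)"

text \<open>The coordinate vector field \<open>\<partial>/\<partial>f\<^sub>a\<close>, meaningful at points where \<open>coords_at f\<close> holds.\<close>

definition coord_field ::
    "(nat \<Rightarrow> complex^'m \<Rightarrow> complex) \<Rightarrow> nat \<Rightarrow> complex^'m \<Rightarrow> complex^'m" where
  "coord_field f a x =
     (THE v. \<forall>b\<in>{1..CARD('m)}. dir_deriv v (f b) x = (if a = b then 1 else 0))"

text \<open>Lie derivative of a contravariant 2-tensor field along a vector field, in linear coordinates.\<close>

definition lie_contra ::
    "(complex^'m \<Rightarrow> complex^'m) \<Rightarrow> (complex^'m \<Rightarrow> complex^'m^'m) \<Rightarrow> complex^'m \<Rightarrow> complex^'m^'m" where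
  "lie_contra E G x =
     (\<chi> a b. dir_deriv (E x) (\<lambda>z. G z $ a $ b) x
        - (\<Sum>c\<in>UNIV. G x $ c $ b * dir_deriv (axis c 1) (\<lambda>z. E z $ a) x)
        - (\<Sum>c\<in>UNIV. G x $ a $ c * dir_deriv (axis c 1) (\<lambda>z. E z $ b) x))"

text \<open>Polynomials with complex coefficients in a given set of functions.\<close>

inductive_set poly_in :: "('x \<Rightarrow> complex) set \<Rightarrow> ('x \<Rightarrow> complex) set" for G where
  "(\<lambda>_. q) \<in> poly_in G"
| "g \<in> G \<Longrightarrow> g \<in> poly_in G"
| "f \<in> poly_in G \<Longrightarrow> g \<in> poly_in G \<Longrightarrow> (\<lambda>x. f x + g x) \<in> poly_in G"
| "f \<in> poly_in G \<Longrightarrow> g \<in> poly_in G \<Longrightarrow> (\<lambda>x. f x * g x) \<in> poly_in G"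

section \<open>The Saito metric\<close>

definition dz_degree :: "(nat \<Rightarrow> real^'n) \<Rightarrow> nat \<Rightarrow> nat \<Rightarrow> real" where
  "dz_degree \<alpha> k i = fund_weight \<alpha> i \<bullet> fund_weight \<alpha> k"

definition orbit_sum ::
    "(real^'n) set \<Rightarrow> (nat \<Rightarrow> real^'n) \<Rightarrow> nat \<Rightarrow> complex^('n option) \<Rightarrow> complex" where
  "orbit_sum R \<alpha> i x = (\<Sum>w\<in>weyl_group R. exp (cpair (w (fund_weight \<alpha> i)) x))"

definition y_coord ::
    "(real^'n) set \<Rightarrow> (nat \<Rightarrow> real^'n) \<Rightarrow> nat \<Rightarrow> nat \<Rightarrow> complex^('n option) \<Rightarrow> complex" where
  "y_coord R \<alpha> k i x =
     (if i \<le> CARD('n) then exp (complex_of_real (dz_degree \<alpha> k i) * x $ None) * orbit_sum R \<alpha> i x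
      else x $ None)"

definition gamma_form :: "(nat \<Rightarrow> real^'n) \<Rightarrow> nat \<Rightarrow> complex^('n option)^('n option)" where
  "gamma_form \<alpha> k =
     (\<chi> i j. if i \<noteq> j then 0
        else case i of None \<Rightarrow> - complex_of_real (dz_degree \<alpha> k k) | Some _ \<Rightarrow> 1)"

text \<open>
  Where \<open>y\<^sub>1, \<dots>, y\<^bsub>l+1\<^esub>\<close> are local coordinates the extended space is locally isomorphic to the orbit
  space, and tensors are pulled back from the latter; \<open>\<kappa>\<close> is the constant in
  \<open>e = \<kappa> \<partial>/\<partial>y\<^sub>k\<close>.
\<close>

definition e_field ::
    "(real^'n) set \<Rightarrow> (nat \<Rightarrow> real^'n) \<Rightarrow> nat \<Rightarrow> complex \<Rightarrow>
     complex^('n option) \<Rightarrow> complex^('n option)" where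
  "e_field R \<alpha> k \<kappa> x = \<kappa> *s coord_field (y_coord R \<alpha> k) k x"

definition saito_contra ::
    "(real^'n) set \<Rightarrow> (nat \<Rightarrow> real^'n) \<Rightarrow> nat \<Rightarrow> complex \<Rightarrow>
     complex^('n option) \<Rightarrow> complex^('n option)^('n option)" where
  "saito_contra R \<alpha> k \<kappa> = lie_contra (e_field R \<alpha> k \<kappa>) (\<lambda>_. matrix_inv (gamma_form \<alpha> k))"

text \<open>
  The covariant Saito metric is regular on the whole orbit space, so its pullback to the extended
  space extends continuously to the mirrors, where \<open>y\<close> fails to be a local coordinate system and
  \<open>saito_contra\<close> is not given by the formula above.
\<close>

definition saito_metric ::
    "(real^'n) set \<Rightarrow> (nat \<Rightarrow> real^'n) \<Rightarrow> nat \<Rightarrow> complex \<Rightarrow>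
     complex^('n option) \<Rightarrow> complex^('n option) \<Rightarrow> complex^('n option) \<Rightarrow> complex" where
  "saito_metric R \<alpha> k \<kappa> x u v =
     (let H = Lim (at x within {z. coords_at (y_coord R \<alpha> k) z})
                (\<lambda>z. matrix_inv (saito_contra R \<alpha> k \<kappa> z))
      in \<Sum>i\<in>UNIV. \<Sum>j\<in>UNIV. u $ i * H $ i $ j * v $ j)"

text \<open>Flat coordinates of the Saito metric, as functions on the extended space.\<close>

definition saito_flat_coords ::
    "(real^'n) set \<Rightarrow> (nat \<Rightarrow> real^'n) \<Rightarrow> nat \<Rightarrow> complex \<Rightarrow>
     (nat \<Rightarrow> complex^('n option) \<Rightarrow> complex) \<Rightarrow> bool" where
  "saito_flat_coords R \<alpha> k \<kappa> t \<longleftrightarrow>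
     (\<forall>i\<in>{1..CARD('n)}.
        t i \<in> poly_in (y_coord R \<alpha> k ` {1..CARD('n)} \<union> {\<lambda>x. exp (x $ None)})) \<and>
     t (CARD('n) + 1) = (\<lambda>x. x $ None) \<and>
     (\<exists>c. c \<noteq> 0 \<and>
       (\<forall>x. coords_at (y_coord R \<alpha> k) x \<longrightarrow>
          coords_at t x \<and>
          e_field R \<alpha> k \<kappa> x = coord_field t 1 x \<and>
          (\<forall>a\<in>{1..CARD('n) + 1}. \<forall>b\<in>{1..CARD('n) + 1}.
             saito_metric R \<alpha> k \<kappa> x (coord_field t a x) (coord_field t b x) =
               (if a + b = CARD('n) + 2 then c else 0))))"

section \<open>Reduced minors and the restriction to a stratum\<close>

text \<open>Matrix indices start from 0, all other indices from 1.\<close>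

definition minor_J ::
    "(nat \<Rightarrow> real^'n) \<Rightarrow> (nat \<Rightarrow> complex^('n option) \<Rightarrow> complex) \<Rightarrow> nat \<Rightarrow>
     complex^('n option) \<Rightarrow> complex" where
  "minor_J \<alpha> t m x =
     Determinant.det (mat_delete
       (mat CARD('n) CARD('n) (\<lambda>(i, j). dir_deriv (emb (\<alpha> (j + 1))) (t (i + 1)) x)) 0 (m - 1))"

text \<open>
  The quotient of \<open>J\<^sub>m\<close> by the product is taken as a Fourier polynomial, so that it also has values
  where the product vanishes.
\<close>

definition reduced_minor_I ::
    "(real^'n) set \<Rightarrow> (nat \<Rightarrow> real^'n) \<Rightarrow> (nat \<Rightarrow> complex^('n option) \<Rightarrow> complex) \<Rightarrow> nat \<Rightarrow>
     complex^('n option) \<Rightarrow> complex" where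
  "reduced_minor_I R \<alpha> t m =
     (THE f. fourier_poly R f \<and>
        (\<forall>x. f x * (\<Prod>i\<in>{1..CARD('n)} - {m}. e_root (\<alpha> i) x) = minor_J \<alpha> t m x))"

definition stratum :: "(nat \<Rightarrow> real^'n) \<Rightarrow> nat \<Rightarrow> nat \<Rightarrow> (complex^('n option)) set" where
  "stratum \<alpha> r s = {x. cpair (\<alpha> r) x = 0 \<and> cpair (\<alpha> s) x = 0}"

definition lin_coord :: "(nat \<Rightarrow> real^'n) \<Rightarrow> nat \<Rightarrow> complex^('n option) \<Rightarrow> complex" where
  "lin_coord \<alpha> i x = (if i \<le> CARD('n) then cpair (fund_coweight \<alpha> i) x else x $ None)"

text \<open>
  Coordinate vector on the stratum for the coordinates \<open>lin_coord \<alpha> j\<close>, \<open>j \<noteq> r, s\<close>, restricted to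
  it.  It is tangent to the stratum, hence differs in general from \<open>emb (\<alpha> i)\<close>, the coordinate vector
  for the full coordinate system.
\<close>

definition stratum_vec :: "(nat \<Rightarrow> real^'n) \<Rightarrow> nat \<Rightarrow> nat \<Rightarrow> nat \<Rightarrow> complex^('n option)" where
  "stratum_vec \<alpha> r s i =
     (THE v. v \<in> stratum \<alpha> r s \<and>
        (\<forall>j\<in>{1..CARD('n) + 1} - {r, s}. lin_coord \<alpha> j v = (if i = j then 1 else 0)))"

definition restricted_gram ::
    "(real^'n) set \<Rightarrow> (nat \<Rightarrow> real^'n) \<Rightarrow> nat \<Rightarrow> complex \<Rightarrow> nat \<Rightarrow> nat \<Rightarrow>
     complex^('n option) \<Rightarrow> complex mat" where
  "restricted_gram R \<alpha> k \<kappa> r s x =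
     (let vs = map (stratum_vec \<alpha> r s) (filter (\<lambda>i. i \<noteq> r \<and> i \<noteq> s) [1..<CARD('n) + 2])
      in mat (length vs) (length vs) (\<lambda>(i, j). saito_metric R \<alpha> k \<kappa> x (vs ! i) (vs ! j)))"

end

theory Submission
  imports Defs
begin

text \<open>
  Write \<open>l\<close> for the rank and \<open>e\<^sub>j\<close> for the mirror factor \<open>e_root (\<alpha> j)\<close>. If \<open>f\<^sub>1, \<dots>, f\<^sub>l\<close> are invariant Fourier
  polynomials and \<open>f\<^bsub>l+1\<^esub> = x\<^bsub>l+1\<^esub>\<close>, then the derivative of \<open>f\<^sub>i\<close> along \<open>\<alpha>\<^sub>j\<close> equals \<open>e\<^sub>j B\<^sub>i\<^sub>j\<close> with a Fourier
  polynomial \<open>B\<^sub>i\<^sub>j\<close>: every weight of an orbit is paired with its mirror image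
  (\<open>orbit_derivative_divisible\<close>), and the Leibniz rule passes this on to polynomials in such functions.
  This applies to \<open>y\<close> and to the flat coordinates \<open>t\<close>. Let \<open>\<delta>\<close> be the determinant of \<open>B\<close> and \<open>C\<^sub>m\<close> its
  cofactors along the row of \<open>t\<^sub>1\<close>; up to sign \<open>C\<^sub>m\<close> is the reduced minor \<open>I\<^sub>m\<close>. In the frame
  \<open>\<partial>\<^bsub>\<alpha>\<^sub>j\<^esub> / e\<^sub>j\<close>, \<open>\<partial>/\<partial>x\<^bsub>l+1\<^esub>\<close> the Saito metric has a Gram matrix \<open>g\<close> whose entries are exponential sums, and
  \<open>det g\<close> is a constant times \<open>\<delta>\<^sup>2\<close>. On the stratum the restricted Gram determinant is the product of the
  remaining \<open>e\<^sub>j\<^sup>2\<close> times the minor \<open>M\<close> of \<open>g\<close> without the rows and columns \<open>r\<close> and \<open>s\<close>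
  (\<open>det_restricted_gram\<close>). It remains to see that \<open>M\<close> is a non-zero constant times \<open>C\<^sub>r C\<^sub>s\<close> there, so
  the unit is in fact a constant.

  By Jacobi's identity (\<open>complementary_minor\<close>) \<open>M\<close> is \<open>det g\<close> times a minor of size two of the inverse of
  \<open>g\<close>. The inverse is known: the contravariant metric is the Lie derivative of a constant form along
  \<open>e = \<partial>/\<partial>t\<^sub>1\<close>, and \<open>e\<close> has the coefficients \<open>C\<^sub>j / (e\<^sub>j \<delta>)\<close>. So \<open>H = \<delta>\<^sup>2 g\<^sup>-\<^sup>1\<close> is an explicit
  expression in \<open>C\<close>, \<open>\<delta>\<close> and their first derivatives (\<open>frame_inverse_gram\<close>), and
  \<open>\<delta>\<^sup>2 M = K (H\<^sub>r\<^sub>r H\<^sub>s\<^sub>s - H\<^sub>r\<^sub>s\<^sup>2)\<close> with a non-zero constant \<open>K\<close>. Since \<open>\<delta>\<close> may vanish on the stratum \<open>D\<close>, this is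
  evaluated as a limit along lines transversal to \<open>D\<close> (\<open>gram_minor_stratum\<close>). If \<open>\<delta>\<close> vanishes to order
  \<open>q\<close> along \<open>D\<close>, then only the leading homogeneous part of \<open>\<delta>\<close> in the two normal directions matters, and
  Euler's relation for it gives \<open>M = K (q + 2)\<^sup>2 C\<^sub>r C\<^sub>s\<close> on \<open>D\<close>, provided that \<open>C\<^sub>r + C\<^sub>s = 0\<close> on \<open>D\<close> or
  \<open>q = 0\<close>.

  If \<open>\<alpha>\<^sub>r\<close> and \<open>\<alpha>\<^sub>s\<close> are not orthogonal, the first alternative holds: by the symmetry of second
  derivatives the columns \<open>r\<close> and \<open>s\<close> of \<open>B\<close> agree on \<open>D\<close> (\<open>columns_agree\<close>). If they are orthogonal, the
  second one holds: \<open>\<delta>\<close> is not identically zero on \<open>D\<close>. Indeed \<open>e\<close> is also a multiple of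
  \<open>\<partial>/\<partial>y\<^sub>k\<close>, so the inverse of \<open>g\<close> can equally be expressed through the corresponding determinant
  \<open>\<delta>\<^sub>y\<close> of \<open>y\<close>, and this shows \<open>\<delta> \<noteq> 0\<close> wherever \<open>\<delta>\<^sub>y \<noteq> 0\<close> (\<open>frame_det_transfer\<close>). That \<open>\<delta>\<^sub>y\<close> does not vanish
  identically on \<open>D\<close> is read off from the leading exponentials of the orbit sums along a ray in \<open>D\<close>
  (\<open>frame_det_y_nonzero\<close>); the input from root systems is that all weights of the orbit of a fundamental
  weight lie below it (\<open>word_lowers_weight\<close>).

  The Saito metric is defined as a limit of inverses of the contravariant form, which could a priori be
  degenerate. That it is the constant antidiagonal form in flat coordinates, everywhere, is
  \<open>saito_metric_flat\<close>.
\<close>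

no_notation scalar_prod (infix "\<bullet>" 70)
notation vec_index (infixl "$v" 100)

section \<open>Exponential sums\<close>

definition bil :: "complex^'m \<Rightarrow> complex^'m \<Rightarrow> complex" where
  "bil p x = (\<Sum>c\<in>UNIV. p $ c * x $ c)"

lemma bil_add: "bil p (x + y) = bil p x + bil p y" "bil (p + q) x = bil p x + bil q x"
  by (simp_all add: bil_def algebra_simps sum.distrib)

lemma bil_smult: "bil p (s *s x) = s * bil p x" "bil (s *s p) x = s * bil p x"
  by (simp_all add: bil_def sum_distrib_left algebra_simps)

lemma bil_zero [simp]: "bil 0 x = 0" "bil p 0 = 0"
  by (simp_all add: bil_def)

lemma bil_sum: "bil p (\<Sum>i\<in>I. g i) = (\<Sum>i\<in>I. bil p (g i))"
  by (induction I rule: infinite_finite_induct) (simp_all add: bil_add)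

text \<open>
  Finite sums of exponentials of arbitrary complex linear forms. Fourier polynomials are of this kind, and
  so are all determinants and derivatives formed from them; unlike Fourier polynomials they may be
  restricted to any line, where they become entire functions of one variable. The inductive form makes the
  closure properties short.
\<close>

inductive exp_sum :: "(complex^'m \<Rightarrow> complex) \<Rightarrow> bool" where
  zero: "exp_sum (\<lambda>_. 0)"
| step: "exp_sum f \<Longrightarrow> exp_sum (\<lambda>x. q * exp (bil p x) + f x)"

lemma exp_sum_repr:
  assumes "exp_sum f"
  obtains K :: nat and q p where "f = (\<lambda>x. \<Sum>i<K. q i * exp (bil (p i) x))"
proof -
  have "\<exists>(K::nat) q p. f = (\<lambda>x. \<Sum>i<K. q i * exp (bil (p i) x))"
    using assms
  proof induction
    case zero
    then show ?case by (intro exI[of _ 0]) auto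
  next
    case (step f q p)
    then obtain K :: nat and q' p' where "f = (\<lambda>x. \<Sum>i<K. q' i * exp (bil (p' i) x))" by blast
    then have "(\<lambda>x. q * exp (bil p x) + f x) =
        (\<lambda>x. \<Sum>i<Suc K. (case i of 0 \<Rightarrow> q | Suc j \<Rightarrow> q' j) * exp (bil (case i of 0 \<Rightarrow> p | Suc j \<Rightarrow> p' j) x))"
      by (simp add: sum.lessThan_Suc_shift del: sum.lessThan_Suc)
    then show ?case by blast
  qed
  then show ?thesis by (elim exE) (rule that)
qed

lemma exp_sum_add:
  assumes "exp_sum f" "exp_sum g" shows "exp_sum (\<lambda>x. f x + g x)"
  using assms(1)
proof induction
  case (step f q p)
  then show ?case using exp_sum.step[of "\<lambda>x. f x + g x" q p] by (simp add: add.assoc)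
qed (use assms(2) in simp)

lemma exp_sum_cmult:
  assumes "exp_sum f" shows "exp_sum (\<lambda>x. c * f x)"
  using assms
proof induction
  case (step f q p)
  then show ?case using exp_sum.step[of "\<lambda>x. c * f x" "c * q" p] by (simp add: algebra_simps)
qed (simp_all add: exp_sum.zero)

lemma exp_sum_exp: "exp_sum (\<lambda>x. exp (bil p x))"
  using exp_sum.step[OF exp_sum.zero, of 1 p] by simp

lemma exp_sum_const: "exp_sum (\<lambda>_. c)"
  using exp_sum.step[OF exp_sum.zero, of c 0] by simp

lemma exp_sum_mult:
  assumes "exp_sum f" "exp_sum g" shows "exp_sum (\<lambda>x. f x * g x)"
  using assms(1)
proof induction
  case (step f q p)
  have "exp_sum (\<lambda>x. exp (bil p x) * g x)" using assms(2)
  proof induction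
    case (step g q' p')
    then show ?case using exp_sum.step[of "\<lambda>x. exp (bil p x) * g x" q' "p + p'"]
      by (simp add: algebra_simps bil_add exp_add)
  qed (simp_all add: exp_sum.zero)
  then have "exp_sum (\<lambda>x. q * (exp (bil p x) * g x) + f x * g x)"
    by (intro exp_sum_add exp_sum_cmult step)
  then show ?case by (simp add: algebra_simps)
qed (simp_all add: exp_sum.zero)

lemma exp_sum_uminus: "exp_sum f \<Longrightarrow> exp_sum (\<lambda>x. - f x)"
  using exp_sum_cmult[of f "-1"] by simp

lemma exp_sum_diff: "exp_sum f \<Longrightarrow> exp_sum g \<Longrightarrow> exp_sum (\<lambda>x. f x - g x)"
  using exp_sum_add[OF _ exp_sum_uminus, of f g] by simp

lemma exp_sum_sum: "(\<And>i. i \<in> I \<Longrightarrow> exp_sum (f i)) \<Longrightarrow> exp_sum (\<lambda>x. \<Sum>i\<in>I. f i x)"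
  by (induction I rule: infinite_finite_induct) (simp_all add: exp_sum_const exp_sum_add)

lemma exp_sum_prod: "(\<And>i. i \<in> I \<Longrightarrow> exp_sum (f i)) \<Longrightarrow> exp_sum (\<lambda>x. \<Prod>i\<in>I. f i x)"
  by (induction I rule: infinite_finite_induct) (simp_all add: exp_sum_const exp_sum_mult)

lemma exp_sum_power: "exp_sum f \<Longrightarrow> exp_sum (\<lambda>x. f x ^ k)"
  by (induction k) (simp_all add: exp_sum_const exp_sum_mult)

lemma exp_sum_det:
  assumes "\<And>i j. i < m \<Longrightarrow> j < m \<Longrightarrow> exp_sum (\<lambda>x. A x $$ (i, j))"
    and "\<And>x. A x \<in> carrier_mat m m"
  shows "exp_sum (\<lambda>x. Determinant.det (A x))"
proof -
  have "(\<lambda>x. Determinant.det (A x)) =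
      (\<lambda>x. \<Sum>p | p permutes {0..<m}. signof p * (\<Prod>i\<in>{0..<m}. A x $$ (i, p i)))"
    using det_def'[OF assms(2)] by auto
  moreover have "exp_sum (\<lambda>x. \<Sum>p | p permutes {0..<m}. signof p * (\<Prod>i\<in>{0..<m}. A x $$ (i, p i)))"
    by (intro exp_sum_sum exp_sum_mult exp_sum_const exp_sum_prod assms(1))
       (auto dest: permutes_in_image)
  ultimately show ?thesis by simp
qed

lemma tendsto_det:
  assumes "\<And>i j. i < m \<Longrightarrow> j < m \<Longrightarrow> ((\<lambda>z. A z $$ (i, j)) \<longlongrightarrow> L $$ (i, j)) F"
    and "\<And>z. A z \<in> carrier_mat m m" "L \<in> carrier_mat m m"
  shows "((\<lambda>z. Determinant.det (A z)) \<longlongrightarrow> Determinant.det (L :: complex mat)) F"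
  unfolding det_def'[OF assms(2)] det_def'[OF assms(3)]
  by (intro tendsto_sum tendsto_mult tendsto_const tendsto_prod assms(1))
     (auto dest: permutes_in_image)

section \<open>Directional derivatives of exponential sums\<close>

lemma exp_sum_deriv_repr:
  "((\<lambda>s. \<Sum>i<K. q i * exp (bil (p i) (x + s *s v))) has_field_derivative
      (\<Sum>i<(K::nat). q i * bil (p i) v * exp (bil (p i) (x + s *s v)))) (at s)"
  by (auto intro!: derivative_eq_intros sum.cong simp: bil_add bil_smult)

lemma dir_deriv_repr:
  "dir_deriv v (\<lambda>x. \<Sum>i<K. q i * exp (bil (p i) x)) =
     (\<lambda>x. \<Sum>i<(K::nat). (q i * bil (p i) v) * exp (bil (p i) x))"
  unfolding dir_deriv_def by (rule ext, rule DERIV_imp_deriv) (use exp_sum_deriv_repr[where s = 0] in simp)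

lemma exp_sum_has_deriv:
  assumes "exp_sum f"
  shows "((\<lambda>s. f (x + s *s v)) has_field_derivative dir_deriv v f (x + s *s v)) (at s)"
proof -
  obtain K :: nat and q p where f: "f = (\<lambda>x. \<Sum>i<K. q i * exp (bil (p i) x))"
    using exp_sum_repr[OF assms] .
  show ?thesis unfolding f dir_deriv_repr using exp_sum_deriv_repr[of q p x v K s] by (simp add: mult.assoc)
qed

lemma exp_sum_dir_deriv:
  assumes "exp_sum f" shows "exp_sum (dir_deriv v f)"
proof -
  obtain K :: nat and q p where f: "f = (\<lambda>x. \<Sum>i<K. q i * exp (bil (p i) x))"
    using exp_sum_repr[OF assms] .
  show ?thesis unfolding f dir_deriv_repr by (intro exp_sum_sum exp_sum_cmult exp_sum_exp)
qed

lemma dir_deriv_commute: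
  assumes "exp_sum f"
  shows "dir_deriv v (dir_deriv w f) = dir_deriv w (dir_deriv v f)"
proof -
  obtain K :: nat and q p where f: "f = (\<lambda>x. \<Sum>i<K. q i * exp (bil (p i) x))"
    using exp_sum_repr[OF assms] .
  show ?thesis unfolding f dir_deriv_repr by (simp add: mult_ac)
qed

lemma exp_sum_dir_deriv_linear:
  assumes "exp_sum f"
  shows "dir_deriv (\<Sum>i\<in>I. c i *s w i) f x = (\<Sum>i\<in>I. c i * dir_deriv (w i) f x)"
proof -
  obtain K :: nat and q p where f: "f = (\<lambda>x. \<Sum>i<K. q i * exp (bil (p i) x))"
    using exp_sum_repr[OF assms] .
  have "dir_deriv (\<Sum>i\<in>I. c i *s w i) f x = (\<Sum>j<K. \<Sum>i\<in>I. c i * (q j * bil (p j) (w i) * exp (bil (p j) x)))"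
    unfolding f dir_deriv_repr
    by (simp add: bil_sum bil_smult sum_distrib_left sum_distrib_right mult_ac)
  also have "\<dots> = (\<Sum>i\<in>I. \<Sum>j<K. c i * (q j * bil (p j) (w i) * exp (bil (p j) x)))"
    by (rule sum.swap)
  finally show ?thesis unfolding f dir_deriv_repr by (simp add: sum_distrib_left)
qed

lemma exp_sum_continuous:
  assumes "exp_sum f" shows "continuous_on S f"
proof -
  obtain K :: nat and q p where f: "f = (\<lambda>x. \<Sum>i<K. q i * exp (bil (p i) x))"
    using exp_sum_repr[OF assms] .
  show ?thesis unfolding f bil_def by (intro continuous_intros)
qed

lemma exp_sum_tendsto_line:
  assumes "exp_sum f" shows "((\<lambda>s. f (x + s *s v)) \<longlongrightarrow> f x) (at 0)"
  using DERIV_isCont[OF exp_sum_has_deriv[OF assms, of x v 0]] by (simp add: isCont_def)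

lemma has_deriv_imp_dir_deriv:
  "((\<lambda>s. f (x + s *s v)) has_field_derivative d) (at 0) \<Longrightarrow> dir_deriv v f x = d"
  unfolding dir_deriv_def by (rule DERIV_imp_deriv)

lemma dir_deriv_mult:
  assumes "exp_sum f" "exp_sum g"
  shows "dir_deriv v (\<lambda>x. f x * g x) x = dir_deriv v f x * g x + f x * dir_deriv v g x"
  by (rule has_deriv_imp_dir_deriv)
     (use exp_sum_has_deriv[OF assms(1), of x v 0] exp_sum_has_deriv[OF assms(2), of x v 0] in
      \<open>auto intro!: derivative_eq_intros\<close>)

lemma dir_deriv_add:
  assumes "exp_sum f" "exp_sum g"
  shows "dir_deriv v (\<lambda>x. f x + g x) x = dir_deriv v f x + dir_deriv v g x"
  by (rule has_deriv_imp_dir_deriv)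
     (use exp_sum_has_deriv[OF assms(1), of x v 0] exp_sum_has_deriv[OF assms(2), of x v 0] in
      \<open>auto intro!: derivative_eq_intros\<close>)

lemma dir_deriv_const: "dir_deriv v (\<lambda>_. c) x = 0"
  by (simp add: dir_deriv_def)

section \<open>Order of vanishing\<close>

lemma exp_taylor_limit:
  fixes z :: complex
  shows "((\<lambda>s. (exp (s * z) - (\<Sum>n<N. (s * z) ^ n / fact n)) / s ^ N) \<longlongrightarrow> z ^ N / fact N) (at 0)"
proof (rule LIM_zero_cancel)
  let ?g = "\<lambda>s. (exp (s * z) - (\<Sum>n<N. (s * z) ^ n / fact n)) / s ^ N - z ^ N / fact N"
  have eq: "?g s = (exp (s * z) - (\<Sum>n\<le>N. (s * z) ^ n / fact n)) / s ^ N" if "s \<noteq> 0" for s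
    using that by (simp add: lessThan_Suc_atMost[symmetric] field_simps)
  have bound: "norm (?g s) \<le> exp (norm z) * norm z ^ Suc N / fact N * norm s"
    if "s \<noteq> 0" "norm s < 1" for s
  proof -
    have "norm (exp (s * z) - (\<Sum>n\<le>N. (s * z) ^ n / fact n))
        \<le> exp \<bar>Re (s * z)\<bar> * norm (s * z) ^ Suc N / fact N"
      by (rule Taylor_exp)
    also have "\<dots> \<le> exp (norm z) * norm (s * z) ^ Suc N / fact N"
    proof -
      have "\<bar>Re (s * z)\<bar> \<le> norm (s * z)" by (rule abs_Re_le_cmod)
      also have "\<dots> \<le> norm z" using that(2) by (simp add: norm_mult mult_left_le_one_le)
      finally show ?thesis by (intro divide_right_mono mult_right_mono) auto
    qed
    finally have "norm (exp (s * z) - (\<Sum>n\<le>N. (s * z) ^ n / fact n)) / norm s ^ N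
       \<le> exp (norm z) * norm (s * z) ^ Suc N / fact N / norm s ^ N"
      by (rule divide_right_mono) simp
    also have "\<dots> = exp (norm z) * norm z ^ Suc N / fact N * norm s"
      using that(1) by (simp add: norm_mult power_mult_distrib)
    finally show ?thesis unfolding eq[OF that(1)] norm_divide norm_power .
  qed
  show "(?g \<longlongrightarrow> 0) (at 0)"
  proof (rule Lim_null_comparison)
    show "\<forall>\<^sub>F s in at 0. norm (?g s) \<le> exp (norm z) * norm z ^ Suc N / fact N * norm s"
      unfolding eventually_at using bound by (intro exI[of _ 1]) (auto simp: dist_norm)
    show "((\<lambda>s. exp (norm z) * norm z ^ Suc N / fact N * norm s) \<longlongrightarrow> 0) (at 0)"
      by (auto intro!: tendsto_eq_intros)
  qed
qed

text \<open>
  The power moments of the frequencies are, up to factorials, the Taylor coefficients at \<open>0\<close> of the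
  exponential sum in one variable.
\<close>

lemma exp_sum_taylor_limit:
  fixes a z :: "nat \<Rightarrow> complex"
  assumes "\<And>n. n < N \<Longrightarrow> (\<Sum>i<K. a i * z i ^ n) = 0"
  shows "((\<lambda>s. (\<Sum>i<K. a i * exp (s * z i)) / s ^ N) \<longlongrightarrow> (\<Sum>i<K. a i * z i ^ N) / fact N) (at 0)"
proof -
  have "(\<Sum>i<K. a i * exp (s * z i)) / s ^ N =
        (\<Sum>i<K. a i * ((exp (s * z i) - (\<Sum>n<N. (s * z i) ^ n / fact n)) / s ^ N))" for s
  proof -
    have "(\<Sum>i<K. a i * (\<Sum>n<N. (s * z i) ^ n / fact n)) = (\<Sum>n<N. \<Sum>i<K. a i * ((s * z i) ^ n / fact n))"
      unfolding sum_distrib_left by (rule sum.swap)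
    also have "\<dots> = (\<Sum>n<N. s ^ n / fact n * (\<Sum>i<K. a i * z i ^ n))"
      by (simp add: sum_distrib_left power_mult_distrib mult_ac)
    also have "\<dots> = 0" using assms by simp
    finally have z: "(\<Sum>i<K. a i * (\<Sum>n<N. (s * z i) ^ n / fact n)) = 0" .
    have "(\<Sum>i<K. a i * exp (s * z i)) = (\<Sum>i<K. a i * (exp (s * z i) - (\<Sum>n<N. (s * z i) ^ n / fact n)))"
      using z by (simp add: right_diff_distrib sum_subtractf)
    then show ?thesis by (simp add: sum_divide_distrib)
  qed
  moreover have "((\<lambda>s. \<Sum>i<K. a i * ((exp (s * z i) - (\<Sum>n<N. (s * z i) ^ n / fact n)) / s ^ N))
      \<longlongrightarrow> (\<Sum>i<K. a i * (z i ^ N / fact N))) (at 0)"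
    by (intro tendsto_sum tendsto_mult tendsto_const exp_taylor_limit)
  ultimately show ?thesis by (simp add: sum_divide_distrib)
qed

lemma exp_moments_zero:
  fixes a z :: "nat \<Rightarrow> complex"
  assumes "\<And>n. (\<Sum>i<K. a i * z i ^ n) = 0"
  shows "(\<Sum>i<K. a i * exp (s * z i)) = 0"
proof -
  have "(\<lambda>n. a i * ((s * z i) ^ n /\<^sub>R fact n)) sums (a i * exp (s * z i))" for i
    by (intro sums_mult exp_converges)
  then have "(\<lambda>n. \<Sum>i<K. a i * ((s * z i) ^ n /\<^sub>R fact n)) sums (\<Sum>i<K. a i * exp (s * z i))"
    by (intro sums_sum)
  moreover have "(\<Sum>i<K. a i * ((s * z i) ^ n /\<^sub>R fact n)) = 0" for n
  proof -
    have "(\<Sum>i<K. a i * ((s * z i) ^ n /\<^sub>R fact n)) = (s ^ n /\<^sub>R fact n) * (\<Sum>i<K. a i * z i ^ n)"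
      by (simp add: sum_distrib_left power_mult_distrib mult_ac scaleR_conv_of_real)
    then show ?thesis using assms by simp
  qed
  ultimately have "(\<lambda>_. 0) sums (\<Sum>i<K. a i * exp (s * z i))" by simp
  then show ?thesis using sums_unique2[OF _ sums_zero] by blast
qed

text \<open>
  On the line from \<open>x\<close> to \<open>x1\<close> the sum is governed by its first non-zero moment; such a moment exists, as
  otherwise the sum would vanish at \<open>x1\<close>.
\<close>

lemma exp_sum_eventually_nonzero:
  assumes "exp_sum f" "f x1 \<noteq> 0"
  shows "\<forall>\<^sub>F s in at 0. f (x + s *s (x1 - x)) \<noteq> 0"
proof -
  obtain K :: nat and q p where f: "f = (\<lambda>x. \<Sum>i<K. q i * exp (bil (p i) x))"
    using exp_sum_repr[OF assms(1)] .
  define a where "a i = q i * exp (bil (p i) x)" for i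
  define z where "z i = bil (p i) (x1 - x)" for i
  have line: "f (x + s *s (x1 - x)) = (\<Sum>i<K. a i * exp (s * z i))" for s
    unfolding f a_def z_def bil_add bil_smult exp_add by (simp only: mult_ac)
  have "\<exists>n. (\<Sum>i<K. a i * z i ^ n) \<noteq> 0"
  proof (rule ccontr)
    assume "\<not> ?thesis"
    then have "f (x + 1 *s (x1 - x)) = 0" unfolding line by (intro exp_moments_zero) auto
    then show False using assms(2) by simp
  qed
  then obtain N where N: "(\<Sum>i<K. a i * z i ^ N) \<noteq> 0" "\<And>n. n < N \<Longrightarrow> (\<Sum>i<K. a i * z i ^ n) = 0"
    using exists_least_iff[of "\<lambda>n. (\<Sum>i<K. a i * z i ^ n) \<noteq> 0"] by auto
  have "\<forall>\<^sub>F s in at 0. (\<Sum>i<K. a i * exp (s * z i)) / s ^ N \<noteq> 0"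
    by (rule tendsto_imp_eventually_ne[OF exp_sum_taylor_limit[OF N(2)]]) (use N(1) in auto)
  then show ?thesis by eventually_elim (auto simp: line simp del: vector_sub_rdistrib vector_ssub_ldistrib)
qed

text \<open>
  Affine subspaces, in the form in which a point is joined with a point where a given function is non-zero.
\<close>

definition line_closed :: "(complex^'m) set \<Rightarrow> bool" where
  "line_closed D \<longleftrightarrow> (\<forall>x\<in>D. \<forall>y\<in>D. \<forall>s. x + s *s (y - x) \<in> D)"

text \<open>
  Exponential sums on a subspace form an integral domain: where \<open>f\<close> is non-zero \<open>g\<close> vanishes, and such
  points accumulate at every point. This is how identities proved at regular points are extended to all
  points.
\<close>

lemma exp_sum_zero_on:
  assumes "exp_sum f" "exp_sum g" "line_closed D" "x1 \<in> D" "f x1 \<noteq> 0"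
    and "\<And>x. x \<in> D \<Longrightarrow> f x \<noteq> 0 \<Longrightarrow> g x = 0" and "x \<in> D"
  shows "g x = 0"
proof -
  have in_D: "x + s *s (x1 - x) \<in> D" for s
    using assms(3,4,7) unfolding line_closed_def by blast
  have "\<forall>\<^sub>F s in at 0. f (x + s *s (x1 - x)) \<noteq> 0"
    by (rule exp_sum_eventually_nonzero[OF assms(1,5)])
  then have ev: "\<forall>\<^sub>F s in at 0. g (x + s *s (x1 - x)) = 0"
    by eventually_elim (rule assms(6)[OF in_D])
  have "((\<lambda>s. g (x + s *s (x1 - x))) \<longlongrightarrow> 0) (at 0)"
    by (rule Lim_transform_eventually[OF tendsto_const]) (use ev in eventually_elim, simp)
  then show ?thesis by (rule LIM_unique[OF exp_sum_tendsto_line[OF assms(2)]])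
qed

lemma line_closed_UNIV: "line_closed UNIV" by (simp add: line_closed_def)

lemma exp_sum_mult_nonzero:
  assumes "exp_sum f" "exp_sum g" "f x1 \<noteq> 0" "g x2 \<noteq> 0"
  shows "\<exists>x. f x * g x \<noteq> 0"
proof (rule ccontr)
  assume "\<not> ?thesis"
  then have "\<And>x. f x \<noteq> 0 \<Longrightarrow> g x = 0" by auto
  then have "g x2 = 0"
    by (rule exp_sum_zero_on[OF assms(1,2) line_closed_UNIV UNIV_I assms(3) _ UNIV_I])
  then show False using assms(4) by simp
qed

lemma smult_tendsto:
  "((\<lambda>s. x + s *s v) \<longlongrightarrow> (x :: complex^'m)) (at 0)"
proof (rule vec_tendstoI)
  fix i
  have "((\<lambda>s. x $ i + s * v $ i) \<longlongrightarrow> x $ i + 0 * v $ i) (at 0)"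
    by (intro tendsto_intros)
  then show "((\<lambda>s. (x + s *s v) $ i) \<longlongrightarrow> x $ i) (at 0)" by simp
qed

lemma exp_sum_dense:
  assumes "exp_sum f" "f x1 \<noteq> 0" "open W" "x \<in> W"
  shows "\<exists>z\<in>W. f z \<noteq> 0 \<and> z \<noteq> x"
proof (cases "x1 = x")
  case False
  have "\<forall>\<^sub>F s in at 0. x + s *s (x1 - x) \<in> W"
    using topological_tendstoD[OF smult_tendsto assms(3,4)] .
  moreover have "\<forall>\<^sub>F s in at 0. f (x + s *s (x1 - x)) \<noteq> 0"
    by (rule exp_sum_eventually_nonzero[OF assms(1,2)])
  moreover have "\<forall>\<^sub>F s::complex in at 0. s \<noteq> 0"
    by (simp add: eventually_at_filter)
  ultimately have "\<forall>\<^sub>F s in at 0. x + s *s (x1 - x) \<in> W \<and> f (x + s *s (x1 - x)) \<noteq> 0 \<and> s \<noteq> 0"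
    by eventually_elim auto
  then obtain s where "x + s *s (x1 - x) \<in> W" "f (x + s *s (x1 - x)) \<noteq> 0" "s \<noteq> 0"
    using eventually_happens trivial_limit_at by fastforce
  then show ?thesis using False by (intro bexI[of _ "x + s *s (x1 - x)"]) auto
next
  case True
  \<comment> \<open>a nonzero value at the point itself persists in a neighbourhood\<close>
  have "open (f -` (- {0}) \<inter> W)"
    using exp_sum_continuous[OF assms(1), of UNIV] assms(3)
    by (intro open_Int continuous_open_vimage) (auto simp: continuous_on_eq_continuous_at)
  moreover have "x \<in> f -` (- {0}) \<inter> W" using assms True by auto
  ultimately obtain z where "z \<in> f -` (- {0}) \<inter> W" "z \<noteq> x"
    using not_open_singleton[of x] by (metis subsetI subset_singletonD empty_iff singleton_iff)
  then show ?thesis by auto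
qed

text \<open>
  The leading homogeneous part of \<open>f\<close> in the directions \<open>w1\<close> and \<open>w2\<close> normal to \<open>D\<close>. The order \<open>N\<close> is the least
  one for which the \<open>N\<close>-th Taylor coefficient in some direction \<open>u w1 + v w2\<close> is not identically zero on \<open>D\<close>.
  Taylor coefficients of the derivatives of \<open>f\<close> along \<open>w1\<close> and \<open>w2\<close> arise by differentiating those of \<open>f\<close>, which
  are polynomials in \<open>u\<close> and \<open>v\<close>; so these derivatives vanish to order \<open>N - 1\<close> along \<open>D\<close>, and the relation
  between \<open>d1\<close>, \<open>d2\<close> and \<open>d\<close> is Euler's relation for a homogeneous polynomial of degree \<open>N\<close>.
\<close>

lemma exp_sum_leading_term:
  fixes f :: "complex^'m \<Rightarrow> complex"
  assumes f: "exp_sum f" "f y \<noteq> 0" and dec: "y = x1 + a *s w1 + b *s w2" "x1 \<in> D"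
  obtains N :: nat and u v and d d1 d2 where "\<exists>x\<in>D. d x \<noteq> 0" "exp_sum d"
    "\<And>x. u * d1 x + v * d2 x = of_nat N * d x"
    "\<And>x. x \<in> D \<Longrightarrow> ((\<lambda>s. f (x + s *s (u *s w1 + v *s w2)) / s ^ N) \<longlongrightarrow> d x) (at 0)"
    "\<And>x. x \<in> D \<Longrightarrow> ((\<lambda>s. s * dir_deriv w1 f (x + s *s (u *s w1 + v *s w2)) / s ^ N) \<longlongrightarrow> d1 x) (at 0)"
    "\<And>x. x \<in> D \<Longrightarrow> ((\<lambda>s. s * dir_deriv w2 f (x + s *s (u *s w1 + v *s w2)) / s ^ N) \<longlongrightarrow> d2 x) (at 0)"
    "\<And>x. x \<in> D \<Longrightarrow> f x \<noteq> 0 \<Longrightarrow> N = 0" "N = 0 \<Longrightarrow> d1 = (\<lambda>_. 0) \<and> d2 = (\<lambda>_. 0)"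
proof -
  obtain K :: nat and q p where rf: "f = (\<lambda>x. \<Sum>i<K. q i * exp (bil (p i) x))"
    using exp_sum_repr[OF f(1)] .
  define m where "m n u v x = (\<Sum>i<K. q i * exp (bil (p i) x) * (u * bil (p i) w1 + v * bil (p i) w2) ^ n)" for n u v x
  have "\<exists>n. \<exists>u v. \<exists>x\<in>D. m n u v x \<noteq> 0"
  proof (rule ccontr)
    assume "\<not> ?thesis"
    then have 0: "(\<Sum>i<K. (q i * exp (bil (p i) x1)) * (a * bil (p i) w1 + b * bil (p i) w2) ^ n) = 0" for n
      using dec(2) unfolding m_def by auto
    have "f y = (\<Sum>i<K. (q i * exp (bil (p i) x1)) * exp (1 * (a * bil (p i) w1 + b * bil (p i) w2)))"
      unfolding rf dec by (simp add: bil_add bil_smult exp_add mult_ac)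
    also have "\<dots> = 0" by (rule exp_moments_zero[OF 0])
    finally show False using f(2) by simp
  qed
  then obtain N where N: "\<exists>u v. \<exists>x\<in>D. m N u v x \<noteq> 0" "\<And>n u v x. n < N \<Longrightarrow> x \<in> D \<Longrightarrow> m n u v x = 0"
    using exists_least_iff[of "\<lambda>n. \<exists>u v. \<exists>x\<in>D. m n u v x \<noteq> 0"] by metis
  then obtain u v where uv: "\<exists>x\<in>D. m N u v x \<noteq> 0" by blast
  define w where "w = u *s w1 + v *s w2"
  define z where "z i = u * bil (p i) w1 + v * bil (p i) w2" for i
  \<comment> \<open>moments of the first derivatives arise by differentiating \<open>m (Suc n)\<close> with respect to the direction\<close>
  have mom: "(\<Sum>i<K. (q i * exp (bil (p i) x) * c i) * z i ^ n) = 0"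
    if "Suc n < N" "x \<in> D" and c: "c = (\<lambda>i. bil (p i) w1) \<or> c = (\<lambda>i. bil (p i) w2)" for n x c
  proof -
    define g where "g h = (\<Sum>i<K. q i * exp (bil (p i) x) * (z i + h * c i) ^ Suc n)" for h
    have "g h = 0" for h
      using c
    proof
      assume "c = (\<lambda>i. bil (p i) w1)"
      then have "g h = m (Suc n) (u + h) v x"
        unfolding g_def m_def z_def by (simp add: algebra_simps)
      then show ?thesis using N(2) that by simp
    next
      assume "c = (\<lambda>i. bil (p i) w2)"
      then have "g h = m (Suc n) u (v + h) x"
        unfolding g_def m_def z_def by (simp add: algebra_simps)
      then show ?thesis using N(2) that by simp
    qed
    then have "g = (\<lambda>_. 0)" by auto
    then have d0: "(g has_field_derivative 0) (at 0)" by simp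
    have "(g has_field_derivative (\<Sum>i<K. q i * exp (bil (p i) x) * (of_nat (Suc n) * z i ^ n * c i))) (at 0)"
      unfolding g_def
      by (auto intro!: derivative_eq_intros sum.cong simp: mult_ac simp del: power_Suc of_nat_Suc)
    then have "(\<Sum>i<K. q i * exp (bil (p i) x) * (of_nat (Suc n) * z i ^ n * c i)) = 0"
      using DERIV_unique d0 by blast
    then have "of_nat (Suc n) * (\<Sum>i<K. (q i * exp (bil (p i) x) * c i) * z i ^ n) = 0"
      by (simp only: sum_distrib_left mult_ac)
    then show ?thesis by (simp del: of_nat_Suc)
  qed
  define d where "d x = m N u v x / fact N" for x
  define e where "e c x = (if N = 0 then 0 else
      (\<Sum>i<K. (q i * exp (bil (p i) x) * bil (p i) c) * z i ^ (N - 1)) / fact (N - 1))" for c x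
  have zw: "bil (p i) w = z i" for i by (simp add: z_def w_def bil_add bil_smult)
  have lim0: "((\<lambda>s. f (x + s *s w) / s ^ N) \<longlongrightarrow> d x) (at 0)" if "x \<in> D" for x
  proof -
    have "((\<lambda>s. (\<Sum>i<K. (q i * exp (bil (p i) x)) * exp (s * z i)) / s ^ N)
        \<longlongrightarrow> (\<Sum>i<K. (q i * exp (bil (p i) x)) * z i ^ N) / fact N) (at 0)"
      by (rule exp_sum_taylor_limit) (use N(2)[OF _ that, of _ u v] in \<open>simp add: m_def z_def\<close>)
    then show ?thesis
      by (simp add: rf d_def m_def z_def[symmetric] bil_add bil_smult zw exp_add mult_ac)
  qed
  have lim1: "((\<lambda>s. s * dir_deriv c f (x + s *s w) / s ^ N) \<longlongrightarrow> e c x) (at 0)"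
    if "x \<in> D" and c: "c = w1 \<or> c = w2" for x c
  proof (cases N)
    case 0
    have "((\<lambda>s. s * dir_deriv c f (x + s *s w)) \<longlongrightarrow> 0 * dir_deriv c f x) (at 0)"
      by (intro tendsto_intros exp_sum_tendsto_line exp_sum_dir_deriv f)
    then show ?thesis using 0 by (simp add: e_def)
  next
    case (Suc N')
    have "((\<lambda>s. (\<Sum>i<K. (q i * exp (bil (p i) x) * bil (p i) c) * exp (s * z i)) / s ^ N')
        \<longlongrightarrow> (\<Sum>i<K. (q i * exp (bil (p i) x) * bil (p i) c) * z i ^ N') / fact N') (at 0)"
      by (rule exp_sum_taylor_limit, rule mom) (use that Suc in auto)
    then have "((\<lambda>s. dir_deriv c f (x + s *s w) / s ^ N') \<longlongrightarrow> e c x) (at 0)"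
      unfolding rf dir_deriv_repr
      by (simp add: rf e_def Suc bil_add bil_smult zw exp_add mult_ac)
    then show ?thesis
      by (rule Lim_transform_eventually) (auto simp: eventually_at_filter Suc)
  qed
  show ?thesis
  proof (rule that[of d u "e w1" v "e w2" N])
    show "\<exists>x\<in>D. d x \<noteq> 0" using uv by (simp add: d_def)
    show "exp_sum d"
    proof -
      have "exp_sum (\<lambda>x. (1 / fact N) * (\<Sum>i<K. (q i * z i ^ N) * exp (bil (p i) x)))"
        by (intro exp_sum_cmult exp_sum_sum exp_sum_exp)
      then show ?thesis by (simp add: d_def[abs_def] m_def z_def[symmetric] mult_ac)
    qed
    show "u * e w1 x + v * e w2 x = of_nat N * d x" for x
    proof (cases N)
      case (Suc N')
      have "u * e w1 x + v * e w2 x = (\<Sum>i<K. q i * exp (bil (p i) x) * z i ^ Suc N') / fact N'"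
        by (simp add: e_def Suc sum_distrib_left sum.distrib[symmetric] sum_divide_distrib z_def field_simps)
      also have "\<dots> = of_nat N * d x"
        by (simp add: d_def m_def z_def[symmetric] Suc del: of_nat_Suc)
      finally show ?thesis .
    qed (simp add: e_def)
    show "N = 0" if "x \<in> D" "f x \<noteq> 0" for x
    proof (rule ccontr)
      assume "N \<noteq> 0"
      then have "m 0 u v x = 0" using N(2) that by blast
      then show False using that by (simp add: m_def rf)
    qed
  qed (use lim0 lim1 in \<open>auto simp: w_def e_def\<close>)
qed

section \<open>Reflections and root systems\<close>

lemma root_reflection_linear: "linear (root_reflection a)"
  unfolding root_reflection_def
  by (rule linearI) (simp_all add: algebra_simps inner_add_left add_divide_distrib scaleR_add_left)

lemma root_reflection_inner:
  "root_reflection a u \<bullet> v = u \<bullet> v - 2 * (u \<bullet> a) / (a \<bullet> a) * (a \<bullet> v)"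
  by (simp add: root_reflection_def inner_diff_left)

lemma root_reflection_isometry:
  assumes "a \<noteq> 0"
  shows "root_reflection a u \<bullet> root_reflection a v = u \<bullet> v"
  using assms
  by (simp add: root_reflection_def inner_diff_left inner_diff_right inner_commute field_simps)

lemma root_reflection_self: "a \<noteq> 0 \<Longrightarrow> root_reflection a a = - a"
  unfolding root_reflection_def by (simp add: scaleR_2)

lemma root_reflection_involution: "a \<noteq> 0 \<Longrightarrow> root_reflection a (root_reflection a v) = v"
  by (simp add: root_reflection_def inner_diff_left scaleR_diff_left [symmetric])

lemma root_reflection_conjugate:
  assumes "linear w" "\<And>u v. w u \<bullet> w v = u \<bullet> v"
  shows "root_reflection (w a) (w v) = w (root_reflection a v)"
  by (simp add: root_reflection_def assms(2) linear_diff[OF assms(1)] linear_scale[OF assms(1)])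

lemma root_reflection_uminus: "root_reflection (- a) = root_reflection a"
  by (rule ext) (simp add: root_reflection_def)

text \<open>
  The argument serves only to name the dimension: both this set and the rank below depend on it through a
  type.
\<close>

abbreviation indices_of :: "(nat \<Rightarrow> real^'n) \<Rightarrow> nat set" where
  "indices_of a \<equiv> {1..CARD('n)}"

abbreviation rank_of :: "(nat \<Rightarrow> real^'n) \<Rightarrow> nat" where
  "rank_of a \<equiv> CARD('n)"

locale root_data =
  fixes R :: "(real^'n) set" and \<alpha> :: "nat \<Rightarrow> real^'n"
  assumes R: "root_system R" and simple: "simple_roots R \<alpha>"
begin

abbreviation I :: "nat set" where "I \<equiv> indices_of \<alpha>"

abbreviation lie_rank :: nat ("\<ell>") where "\<ell> \<equiv> rank_of \<alpha>"

lemma finite_R: "finite R" and span_R: "span R = UNIV"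
  and refl_R: "a \<in> R \<Longrightarrow> b \<in> R \<Longrightarrow> root_reflection a b \<in> R"
  and cartan_int: "a \<in> R \<Longrightarrow> b \<in> R \<Longrightarrow> 2 * (b \<bullet> a) / (a \<bullet> a) \<in> \<int>"
  and reduced: "a \<in> R \<Longrightarrow> q *\<^sub>R a \<in> R \<Longrightarrow> q = 1 \<or> q = - 1"
  using R unfolding root_system_def by auto

lemma nonzero_R: "a \<in> R \<Longrightarrow> a \<noteq> 0"
  using R unfolding root_system_def by auto

lemma simple_R: "i \<in> I \<Longrightarrow> \<alpha> i \<in> R"
  using simple unfolding simple_roots_def by auto

lemma inj_simple: "inj_on \<alpha> I"
  using simple unfolding simple_roots_def by auto

lemma simple_nonzero: "i \<in> I \<Longrightarrow> \<alpha> i \<noteq> 0"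
  using nonzero_R simple_R by auto

lemma simple_norm_pos: "i \<in> I \<Longrightarrow> \<alpha> i \<bullet> \<alpha> i > 0"
  using simple_nonzero by auto

lemma simple_span: "span (\<alpha> ` I) = UNIV"
proof -
  have "independent (\<alpha> ` I)" using simple unfolding simple_roots_def by auto
  then have "dim (\<alpha> ` I) = CARD('n)"
    using dim_eq_card_independent card_image[OF inj_simple] by fastforce
  then show ?thesis using dim_eq_full[of "\<alpha> ` I"] by simp
qed

lemma simple_orthogonal_zero:
  assumes "\<And>j. j \<in> I \<Longrightarrow> v \<bullet> \<alpha> j = 0" shows "v = 0"
proof -
  have "v \<bullet> v = 0"
  proof (rule linear_eq_0_on_span[where f = "\<lambda>u. v \<bullet> u" and b = "\<alpha> ` I"])
    show "linear (\<lambda>u. v \<bullet> u)" by (rule linearI) (simp_all add: inner_add_right)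
  qed (use assms simple_span in auto)
  then show ?thesis by simp
qed

text \<open>
  The simple roots form a basis, so the values prescribed on them extend to a linear form, which is
  represented by a vector.
\<close>

lemma dual_vector: "\<exists>!v. \<forall>j\<in>I. v \<bullet> \<alpha> j = f j"
proof -
  have ind: "independent (\<alpha> ` I)" using simple unfolding simple_roots_def by auto
  obtain g :: "real^'n \<Rightarrow> real" where g: "linear g" "\<And>x. x \<in> \<alpha> ` I \<Longrightarrow> g x = f (the_inv_into I \<alpha> x)"
    using linear_independent_extend[OF ind, of "\<lambda>x. f (the_inv_into I \<alpha> x)"] by blast
  define v where "v = (\<Sum>b\<in>Basis. g b *\<^sub>R b)"
  have "v \<bullet> x = g x" for x
  proof -
    have "g x = g (\<Sum>b\<in>Basis. (x \<bullet> b) *\<^sub>R b)" by (simp add: euclidean_representation)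
    also have "\<dots> = (\<Sum>b\<in>Basis. (x \<bullet> b) * g b)"
      using g(1) by (simp add: linear_sum linear_scale)
    also have "\<dots> = v \<bullet> x" by (simp add: v_def inner_sum_left inner_commute[of x] mult.commute)
    finally show ?thesis by simp
  qed
  then have "\<forall>j\<in>I. v \<bullet> \<alpha> j = f j"
    using g(2) the_inv_into_f_f[OF inj_simple] by simp
  moreover have "u = v" if "\<forall>j\<in>I. u \<bullet> \<alpha> j = f j" for u
    using simple_orthogonal_zero[of "u - v"] that \<open>\<forall>j\<in>I. v \<bullet> \<alpha> j = f j\<close> by (auto simp: inner_diff_left)
  ultimately show ?thesis by blast
qed

lemma coweight_simple: "j \<in> I \<Longrightarrow> fund_coweight \<alpha> i \<bullet> \<alpha> j = (if i = j then 1 else 0)"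
  using theI'[OF dual_vector[of "\<lambda>j. if i = j then 1 else 0"]] unfolding fund_coweight_def by auto

lemma weight_simple:
  assumes "j \<in> I" shows "fund_weight \<alpha> i \<bullet> \<alpha> j = (if i = j then \<alpha> j \<bullet> \<alpha> j / 2 else 0)"
proof -
  have eq: "(\<forall>j\<in>I. 2 * (v \<bullet> \<alpha> j) / (\<alpha> j \<bullet> \<alpha> j) = (if i = j then 1 else 0)) \<longleftrightarrow>
      (\<forall>j\<in>I. v \<bullet> \<alpha> j = (if i = j then \<alpha> j \<bullet> \<alpha> j / 2 else 0))" for v
    using simple_nonzero by (intro ball_cong refl) (auto simp: field_simps)
  show ?thesis
    unfolding fund_weight_def eq
    using theI'[OF dual_vector[of "\<lambda>j. if i = j then \<alpha> j \<bullet> \<alpha> j / 2 else 0"]] assms by blast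
qed

lemma simple_expansion: "v = (\<Sum>j\<in>I. (v \<bullet> fund_coweight \<alpha> j) *\<^sub>R \<alpha> j)"
proof (rule linear_eq_on_span[where f = "\<lambda>v. v" and B = "\<alpha> ` I"])
  show "linear (\<lambda>v. \<Sum>j\<in>I. (v \<bullet> fund_coweight \<alpha> j) *\<^sub>R \<alpha> j)"
    by (intro linearI) (simp_all add: inner_add_left scaleR_add_left sum.distrib scaleR_sum_right)
  show "x = (\<Sum>j\<in>I. (x \<bullet> fund_coweight \<alpha> j) *\<^sub>R \<alpha> j)" if x: "x \<in> \<alpha> ` I" for x
  proof -
    obtain i where i: "i \<in> I" "x = \<alpha> i" using x by auto
    have "(\<Sum>j\<in>I. (x \<bullet> fund_coweight \<alpha> j) *\<^sub>R \<alpha> j) = (\<Sum>j\<in>I. if j = i then \<alpha> j else 0)"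
      using i by (intro sum.cong) (auto simp: inner_commute[of "\<alpha> i"] coweight_simple)
    then show ?thesis using i by simp
  qed
qed (use simple_span in \<open>auto simp: linear_id[unfolded id_def]\<close>)

section \<open>Words in the simple reflections\<close>

definition positive :: "real^'n \<Rightarrow> bool" where
  "positive b \<longleftrightarrow> (\<forall>j\<in>I. b \<bullet> fund_coweight \<alpha> j \<ge> 0)"

lemma root_coefficients:
  assumes "b \<in> R"
  shows "\<exists>m :: nat \<Rightarrow> nat. (\<forall>j\<in>I. b \<bullet> fund_coweight \<alpha> j = real (m j)) \<or> (\<forall>j\<in>I. b \<bullet> fund_coweight \<alpha> j = - real (m j))"
proof -
  obtain m :: "nat \<Rightarrow> nat" where
    m: "b = (\<Sum>i\<in>I. real (m i) *\<^sub>R \<alpha> i) \<or> b = - (\<Sum>i\<in>I. real (m i) *\<^sub>R \<alpha> i)"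
    using simple assms unfolding simple_roots_def by blast
  have "(\<Sum>i\<in>I. real (m i) *\<^sub>R \<alpha> i) \<bullet> fund_coweight \<alpha> j = real (m j)" if "j \<in> I" for j
  proof -
    have "(\<Sum>i\<in>I. real (m i) *\<^sub>R \<alpha> i) \<bullet> fund_coweight \<alpha> j = (\<Sum>i\<in>I. if i = j then real (m i) else 0)"
      unfolding inner_sum_left
      by (intro sum.cong) (auto simp: inner_commute[of "\<alpha> _"] coweight_simple)
    then show ?thesis using that by simp
  qed
  then show ?thesis using m by (intro exI[of _ m]) auto
qed

lemma positive_or_negative: "b \<in> R \<Longrightarrow> positive b \<or> positive (- b)"
  using root_coefficients[of b] unfolding positive_def by auto

lemma positive_coefficients:
  assumes "b \<in> R" "positive b"
  obtains m :: "nat \<Rightarrow> nat" where "\<And>j. j \<in> I \<Longrightarrow> b \<bullet> fund_coweight \<alpha> j = real (m j)"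
proof -
  obtain m :: "nat \<Rightarrow> nat" where "(\<forall>j\<in>I. b \<bullet> fund_coweight \<alpha> j = real (m j)) \<or> (\<forall>j\<in>I. b \<bullet> fund_coweight \<alpha> j = - real (m j))"
    using root_coefficients[OF assms(1)] by blast
  then have "\<forall>j\<in>I. b \<bullet> fund_coweight \<alpha> j = real (m j)"
    using assms(2) unfolding positive_def by force
  then show ?thesis using that by blast
qed

lemma positive_simple: "i \<in> I \<Longrightarrow> positive (\<alpha> i)"
  unfolding positive_def by (auto simp: inner_commute[of "\<alpha> i"] coweight_simple)

abbreviation refl :: "nat \<Rightarrow> real^'n \<Rightarrow> real^'n" where "refl i \<equiv> root_reflection (\<alpha> i)"

lemma refl_coefficient:
  assumes "i \<in> I" "j \<in> I"
  shows "refl i b \<bullet> fund_coweight \<alpha> j =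
     b \<bullet> fund_coweight \<alpha> j - (if i = j then 2 * (b \<bullet> \<alpha> i) / (\<alpha> i \<bullet> \<alpha> i) else 0)"
  using assms by (simp add: root_reflection_inner inner_commute[of "\<alpha> i" "fund_coweight \<alpha> j"] coweight_simple)

text \<open>
  A simple reflection changes only the \<open>i\<close>-th coefficient of a root. If the reflected root were negative,
  all other coefficients of \<open>b\<close> would be zero and \<open>b\<close> would be a multiple of \<open>\<alpha> i\<close>.
\<close>

lemma positive_refl:
  assumes b: "b \<in> R" "positive b" "b \<noteq> \<alpha> i" and i: "i \<in> I"
  shows "positive (refl i b)"
proof (rule ccontr)
  assume "\<not> ?thesis"
  then have neg: "positive (- refl i b)"
    using positive_or_negative refl_R simple_R i b by blast
  have "b \<bullet> fund_coweight \<alpha> j = 0" if "j \<in> I" "j \<noteq> i" for j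
  proof -
    have "b \<bullet> fund_coweight \<alpha> j \<ge> 0" using b that unfolding positive_def by auto
    moreover have "- (refl i b \<bullet> fund_coweight \<alpha> j) \<ge> 0"
      using neg that unfolding positive_def by auto
    ultimately show ?thesis using refl_coefficient[OF i that(1), of b] that(2) by simp
  qed
  then have "b = (\<Sum>j\<in>I. if j = i then (b \<bullet> fund_coweight \<alpha> i) *\<^sub>R \<alpha> i else 0)"
    by (subst simple_expansion[of b]) (intro sum.cong, auto)
  then have eq: "b = (b \<bullet> fund_coweight \<alpha> i) *\<^sub>R \<alpha> i" using i by simp
  moreover have "b \<bullet> fund_coweight \<alpha> i \<ge> 0" using b i unfolding positive_def by auto
  ultimately have "b \<bullet> fund_coweight \<alpha> i = 1"
    using reduced[of "\<alpha> i" "b \<bullet> fund_coweight \<alpha> i"] b(1) simple_R[OF i] by auto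
  then show False using eq b(3) by simp
qed

fun word :: "nat list \<Rightarrow> real^'n \<Rightarrow> real^'n" where
  "word [] = id"
| "word (i # is) = refl i \<circ> word is"

lemma word_append: "word (is @ js) = word is \<circ> word js"
  by (induction "is") (auto simp: o_assoc)

lemma word_linear: "set is \<subseteq> I \<Longrightarrow> linear (word is)"
  by (induction "is") (auto intro: linear_compose root_reflection_linear linear_id)

lemma word_isometry: "set is \<subseteq> I \<Longrightarrow> word is u \<bullet> word is v = u \<bullet> v"
  by (induction "is") (auto simp: root_reflection_isometry simple_nonzero)

lemma word_R: "set is \<subseteq> I \<Longrightarrow> b \<in> R \<Longrightarrow> word is b \<in> R"
  by (induction "is") (use refl_R simple_R in auto)

lemma word_rev: "set is \<subseteq> I \<Longrightarrow> word is (word (rev is) v) = v"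
  by (induction "is" arbitrary: v) (auto simp: word_append root_reflection_involution simple_nonzero)

text \<open>
  If \<open>\<alpha> k\<close> is mapped to a negative root, some letter of the word turns a positive root into a negative one.
  By \<open>positive_refl\<close> that positive root is the simple root of the letter, and conjugation moves the
  appended reflection to this letter, where the two cancel.
\<close>

lemma exchange:
  assumes "set is \<subseteq> I" "k \<in> I"
  shows "positive (word is (\<alpha> k)) \<or>
    (\<exists>js. set js \<subseteq> I \<and> length js < length is \<and> word (is @ [k]) = word js)"
  using assms(1)
proof (induction "is")
  case Nil
  then show ?case using positive_simple assms by auto
next
  case (Cons i "is")
  then have i: "i \<in> I" and S: "set is \<subseteq> I" by auto
  consider "positive (word is (\<alpha> k))" |
    js where "set js \<subseteq> I" "length js < length is" "word (is @ [k]) = word js"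
    using Cons by auto
  then show ?case
  proof cases
    case 1
    show ?thesis
    proof (cases "word is (\<alpha> k) = \<alpha> i")
      case True
      have "word ((i # is) @ [k]) v = word is v" for v
      proof -
        have "word is (refl k v) = refl i (word is v)"
          using root_reflection_conjugate[OF word_linear[OF S] word_isometry[OF S], of "\<alpha> k" v] True by simp
        then show ?thesis using i by (simp add: word_append root_reflection_involution simple_nonzero)
      qed
      then show ?thesis using S by (intro disjI2 exI[of _ "is"]) auto
    next
      case False
      then show ?thesis
        using positive_refl[OF word_R[OF S simple_R[OF assms(2)]] 1 False i] by simp
    qed
  next
    case 2
    then show ?thesis using i by (intro disjI2 exI[of _ "i # js"]) auto
  qed
qed

text \<open>
  Remove the last letter \<open>k\<close> of the word. If the rest maps \<open>\<alpha> k\<close> to a positive root, then the difference grows by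
  zero or one times this root; if not, the exchange property replaces the word by a shorter one.
\<close>

lemma word_lowers_weight:
  assumes "set is \<subseteq> I" "i \<in> I"
  shows "\<exists>m :: nat \<Rightarrow> nat. \<forall>j\<in>I. (fund_weight \<alpha> i - word is (fund_weight \<alpha> i)) \<bullet> fund_coweight \<alpha> j = real (m j)"
  using assms(1)
proof (induction "length is" arbitrary: "is" rule: less_induct)
  case less
  let ?\<omega> = "fund_weight \<alpha> i"
  show ?case
  proof (cases "is" rule: rev_cases)
    case Nil
    then show ?thesis by (intro exI[of _ "\<lambda>_. 0"]) auto
  next
    case (snoc js k)
    then have S: "set js \<subseteq> I" "k \<in> I" using less(2) by auto
    from exchange[OF S] show ?thesis
    proof
      assume pos: "positive (word js (\<alpha> k))"
      obtain m where m: "\<And>j. j \<in> I \<Longrightarrow> (?\<omega> - word js ?\<omega>) \<bullet> fund_coweight \<alpha> j = real (m j)"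
        using less(1)[of js] S snoc by auto
      obtain m' where m': "\<And>j. j \<in> I \<Longrightarrow> word js (\<alpha> k) \<bullet> fund_coweight \<alpha> j = real (m' j)"
        using positive_coefficients[OF word_R[OF S(1) simple_R[OF S(2)]] pos] by blast
      define e :: nat where "e = (if i = k then 1 else 0)"
      have "refl k ?\<omega> = ?\<omega> - real e *\<^sub>R \<alpha> k"
        using S(2) simple_nonzero[of k] by (simp add: root_reflection_def weight_simple e_def)
      then have "word is ?\<omega> = word js ?\<omega> - real e *\<^sub>R word js (\<alpha> k)"
        using snoc by (simp add: word_append linear_diff[OF word_linear[OF S(1)]] linear_scale[OF word_linear[OF S(1)]])
      then have "\<forall>j\<in>I. (?\<omega> - word is ?\<omega>) \<bullet> fund_coweight \<alpha> j = real (m j + e * m' j)"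
        using m m' by (auto simp: inner_diff_left)
      then show ?thesis by (intro exI[of _ "\<lambda>j. m j + e * m' j"])
    next
      assume "\<exists>js'. set js' \<subseteq> I \<and> length js' < length js \<and> word (js @ [k]) = word js'"
      then show ?thesis using less(1) snoc by force
    qed
  qed
qed

text \<open>
  A positive root that is not simple has a positive inner product with some simple root, since its square
  length is positive; reflecting in it keeps the root positive and lowers its height.
\<close>

lemma positive_root_conjugate_simple:
  assumes "b \<in> R" "positive b"
  shows "\<exists>is k. set is \<subseteq> I \<and> k \<in> I \<and> b = word is (\<alpha> k)"
proof -
  define ht where "ht b = nat \<lfloor>\<Sum>j\<in>I. b \<bullet> fund_coweight \<alpha> j\<rfloor>" for b
  show ?thesis using assms
  proof (induction "ht b" arbitrary: b rule: less_induct)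
    case less
    show ?case
    proof (cases "\<exists>k\<in>I. b = \<alpha> k")
      case True
      then show ?thesis by (intro exI[of _ "[]"]) auto
    next
      case False
      have "\<exists>k\<in>I. b \<bullet> \<alpha> k > 0"
      proof (rule ccontr)
        assume neg: "\<not> ?thesis"
        have "b \<bullet> b = (\<Sum>j\<in>I. (b \<bullet> fund_coweight \<alpha> j) * (b \<bullet> \<alpha> j))"
          by (subst (2) simple_expansion[of b]) (simp add: inner_sum_right)
        also have "\<dots> \<le> 0"
          using neg less(3) unfolding positive_def
          by (intro sum_nonpos mult_nonneg_nonpos) (auto simp: not_less)
        finally show False using nonzero_R[OF less(2)] inner_gt_zero_iff[of b] by linarith
      qed
      then obtain k where k: "k \<in> I" "b \<bullet> \<alpha> k > 0" by blast
      let ?c = "refl k b"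
      have c: "?c \<in> R" "positive ?c"
        using refl_R[OF simple_R[OF k(1)] less(2)] positive_refl[OF less(2,3) _ k(1)] False k by auto
      obtain m m' :: "nat \<Rightarrow> nat" where
        m: "\<And>j. j \<in> I \<Longrightarrow> b \<bullet> fund_coweight \<alpha> j = real (m j)" and
        m': "\<And>j. j \<in> I \<Longrightarrow> ?c \<bullet> fund_coweight \<alpha> j = real (m' j)"
        using positive_coefficients less(2,3) c by metis
      have "m' j \<le> m j \<and> (j = k \<longrightarrow> m' j < m j)" if "j \<in> I" for j
      proof -
        have "2 * (b \<bullet> \<alpha> k) / (\<alpha> k \<bullet> \<alpha> k) > 0" using k simple_norm_pos by simp
        then show ?thesis
          using refl_coefficient[OF k(1) that, of b] m[OF that] m'[OF that] by (auto split: if_splits)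
      qed
      then have "(\<Sum>j\<in>I. m' j) < (\<Sum>j\<in>I. m j)"
        using k(1) by (intro sum_strict_mono_ex1) (auto intro!: bexI[of _ k])
      moreover have "ht b = (\<Sum>j\<in>I. m j)" "ht ?c = (\<Sum>j\<in>I. m' j)"
        unfolding ht_def using m m' by (simp_all flip: of_nat_sum)
      ultimately obtain "is" l where "set is \<subseteq> I" "l \<in> I" "?c = word is (\<alpha> l)"
        using less(1)[of ?c] c by auto
      then have "b = word (k # is) (\<alpha> l)"
        using k(1) by (metis comp_apply root_reflection_involution simple_nonzero word.simps(2))
      then show ?thesis using \<open>set is \<subseteq> I\<close> \<open>l \<in> I\<close> k(1) by (intro exI[of _ "k # is"] exI[of _ l]) auto
    qed
  qed
qed

lemma root_conjugate_simple:
  assumes "b \<in> R"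
  obtains "is" k where "set is \<subseteq> I" "k \<in> I" "b = word is (\<alpha> k)"
proof (cases "positive b")
  case True
  then show ?thesis using positive_root_conjugate_simple[OF assms] that by blast
next
  case False
  have "- b \<in> R"
    using refl_R[OF assms assms] root_reflection_self[OF nonzero_R[OF assms]] by simp
  then obtain "is" k where S: "set is \<subseteq> I" and k: "k \<in> I" "- b = word is (\<alpha> k)"
    using positive_root_conjugate_simple positive_or_negative[OF assms] False by blast
  have "word (is @ [k]) (\<alpha> k) = b"
    using k root_reflection_self[OF simple_nonzero[OF k(1)]] linear_neg[OF word_linear[OF S]]
    by (simp add: word_append) (metis minus_minus)
  then show ?thesis using that[of "is @ [k]" k] S k by simp
qed

lemma reflection_word:
  assumes "b \<in> R" shows "\<exists>is. set is \<subseteq> I \<and> root_reflection b = word is"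
proof -
  obtain "is" k where S: "set is \<subseteq> I" and k: "k \<in> I" "b = word is (\<alpha> k)"
    using root_conjugate_simple[OF assms] .
  have "root_reflection b v = word (is @ k # rev is) v" for v
    using root_reflection_conjugate[OF word_linear[OF S] word_isometry[OF S], of "\<alpha> k" "word (rev is) v"] k
    by (simp add: word_append word_rev[OF S])
  then show ?thesis using S k by (intro exI[of _ "is @ k # rev is"]) auto
qed

section \<open>Weyl orbits of fundamental weights\<close>

lemma weyl_word:
  assumes "w \<in> weyl_group R" shows "\<exists>is. set is \<subseteq> I \<and> w = word is"
  using assms
proof induction
  case 1
  show ?case by (intro exI[of _ "[]"]) auto
next
  case (2 a w)
  then obtain "is" js where "set is \<subseteq> I" "w = word is" "set js \<subseteq> I" "root_reflection a = word js"
    using reflection_word by blast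
  then show ?case by (intro exI[of _ "js @ is"]) (auto simp: word_append)
qed

lemma weyl_linear: "w \<in> weyl_group R \<Longrightarrow> linear w"
  using weyl_word word_linear by blast

lemma weyl_isometry: "w \<in> weyl_group R \<Longrightarrow> w u \<bullet> w v = u \<bullet> v"
  using weyl_word word_isometry by blast

lemma weyl_R: "w \<in> weyl_group R \<Longrightarrow> b \<in> R \<Longrightarrow> w b \<in> R"
  using weyl_word word_R by blast

text \<open>
  An element of the Weyl group is linear, hence determined by the permutation of the spanning set \<open>R\<close>.
\<close>

lemma weyl_finite: "finite (weyl_group R)"
proof (rule inj_on_finite[where f = "\<lambda>w. restrict w R" and B = "R \<rightarrow>\<^sub>E R"])
  show "inj_on (\<lambda>w. restrict w R) (weyl_group R)"
  proof (rule inj_onI)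
    fix w w' assume w: "w \<in> weyl_group R" "w' \<in> weyl_group R" and eq: "restrict w R = restrict w' R"
    have "w b = w' b" if "b \<in> R" for b using fun_cong[OF eq, of b] that by simp
    then show "w = w'"
      using linear_eq_on_span[OF weyl_linear[OF w(1)] weyl_linear[OF w(2)], of R] span_R by auto
  qed
  show "(\<lambda>w. restrict w R) ` weyl_group R \<subseteq> R \<rightarrow>\<^sub>E R" by (auto simp: weyl_R)
  show "finite (R \<rightarrow>\<^sub>E R)" by (intro finite_PiE finite_R)
qed

lemma weyl_refl_bij:
  assumes "a \<in> R" shows "bij_betw (\<lambda>w. root_reflection a \<circ> w) (weyl_group R) (weyl_group R)"
  by (rule bij_betwI[where g = "\<lambda>w. root_reflection a \<circ> w"])
     (auto simp: fun_eq_iff root_reflection_involution nonzero_R[OF assms] intro: weyl_group.intros assms)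

lemma weyl_lowers_weight:
  assumes "w \<in> weyl_group R" "i \<in> I"
  obtains m :: "nat \<Rightarrow> nat"
  where "fund_weight \<alpha> i - w (fund_weight \<alpha> i) = (\<Sum>j\<in>I. real (m j) *\<^sub>R \<alpha> j)"
proof -
  obtain m :: "nat \<Rightarrow> nat" where
    m: "\<And>j. j \<in> I \<Longrightarrow> (fund_weight \<alpha> i - w (fund_weight \<alpha> i)) \<bullet> fund_coweight \<alpha> j = real (m j)"
    using word_lowers_weight[OF _ assms(2)] weyl_word[OF assms(1)] by blast
  have "fund_weight \<alpha> i - w (fund_weight \<alpha> i) = (\<Sum>j\<in>I. real (m j) *\<^sub>R \<alpha> j)"
    by (subst simple_expansion) (intro sum.cong refl, simp add: m)
  then show ?thesis by (rule that)
qed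

text \<open>
  Up to the Weyl group \<open>b\<close> is simple, and weights of one orbit differ by integral combinations of roots.
\<close>

lemma weight_integral:
  assumes "b \<in> R" "i \<in> I" "w \<in> weyl_group R"
  shows "2 * (w (fund_weight \<alpha> i) \<bullet> b) / (b \<bullet> b) \<in> \<int>"
proof -
  let ?\<omega> = "fund_weight \<alpha> i"
  obtain "is" where S: "set is \<subseteq> I" and w: "w = word is" using weyl_word assms(3) by blast
  obtain js k where J: "set js \<subseteq> I" and k: "k \<in> I" "b = word js (\<alpha> k)"
    using root_conjugate_simple[OF assms(1)] .
  let ?u = "word (rev js @ is)"
  have "w ?\<omega> \<bullet> b = ?u ?\<omega> \<bullet> \<alpha> k"
    using word_isometry[OF J, of "word (rev js) (w ?\<omega>)" "\<alpha> k"] k word_rev[OF J] by (simp add: word_append w)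
  moreover have "b \<bullet> b = \<alpha> k \<bullet> \<alpha> k" using k word_isometry[OF J] by simp
  moreover obtain m :: "nat \<Rightarrow> nat" where
    m: "\<And>j. j \<in> I \<Longrightarrow> (?\<omega> - ?u ?\<omega>) \<bullet> fund_coweight \<alpha> j = real (m j)"
    using word_lowers_weight[of "rev js @ is" i] S J assms(2) by auto
  have "?\<omega> - ?u ?\<omega> = (\<Sum>j\<in>I. real (m j) *\<^sub>R \<alpha> j)"
    by (subst simple_expansion) (intro sum.cong refl, simp add: m)
  then have "?u ?\<omega> = ?\<omega> - (\<Sum>j\<in>I. real (m j) *\<^sub>R \<alpha> j)"
    by (simp add: algebra_simps)
  then have "?u ?\<omega> \<bullet> \<alpha> k = ?\<omega> \<bullet> \<alpha> k - (\<Sum>j\<in>I. real (m j) * (\<alpha> j \<bullet> \<alpha> k))"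
    by (simp add: inner_diff_left inner_sum_left)
  then have "2 * (?u ?\<omega> \<bullet> \<alpha> k) / (\<alpha> k \<bullet> \<alpha> k) =
     (if i = k then 1 else 0) - (\<Sum>j\<in>I. real (m j) * (2 * (\<alpha> j \<bullet> \<alpha> k) / (\<alpha> k \<bullet> \<alpha> k)))"
    using k simple_nonzero[of k]
    by (simp add: weight_simple right_diff_distrib diff_divide_distrib sum_distrib_left sum_divide_distrib mult_ac)
  moreover have "\<dots> \<in> \<int>"
    using cartan_int[OF simple_R[OF k(1)] simple_R] by (intro Ints_diff Ints_sum Ints_mult) auto
  ultimately show ?thesis by simp
qed

text \<open>
  The sum is fixed by all reflections, hence orthogonal to all roots.
\<close>

lemma orbit_sum_weight_zero: "(\<Sum>w\<in>weyl_group R. w v) = 0"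
proof -
  let ?S = "\<Sum>w\<in>weyl_group R. w v"
  have "?S \<bullet> \<alpha> i = 0" if "i \<in> I" for i
  proof -
    have "refl i ?S = (\<Sum>w\<in>weyl_group R. (refl i \<circ> w) v)"
      by (simp add: linear_sum[OF root_reflection_linear])
    also have "\<dots> = ?S"
      by (rule sum.reindex_bij_betw[OF weyl_refl_bij[OF simple_R[OF that]], of "\<lambda>w. w v"])
    finally have "(2 * (?S \<bullet> \<alpha> i) / (\<alpha> i \<bullet> \<alpha> i)) *\<^sub>R \<alpha> i = 0" by (simp add: root_reflection_def)
    then show ?thesis using simple_nonzero[OF that] by simp
  qed
  then show ?thesis by (rule simple_orthogonal_zero)
qed

text \<open>
  Summing \<open>\<omega> - w \<omega>\<close> over the Weyl group gives the order of the group times \<open>\<omega>\<close>; so \<open>\<omega>\<close> is a rational combination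
  of simple roots. Consequently the functions \<open>y\<close> are Fourier polynomials, whose exponents in \<open>x\<^bsub>l+1\<^esub>\<close> have to be
  rational.
\<close>

lemma weight_rational:
  assumes "i \<in> I" "k \<in> I" "\<alpha> k \<bullet> \<alpha> k \<in> \<rat>"
  shows "fund_weight \<alpha> i \<bullet> fund_weight \<alpha> k \<in> \<rat>"
proof -
  let ?W = "weyl_group R"
  have c: "card ?W \<noteq> 0" using weyl_finite weyl_group.intros(1)[of R] by auto
  have "(fund_weight \<alpha> i - w (fund_weight \<alpha> i)) \<bullet> fund_weight \<alpha> k \<in> \<rat>" if w: "w \<in> ?W" for w
  proof -
    obtain m :: "nat \<Rightarrow> nat" where m: "fund_weight \<alpha> i - w (fund_weight \<alpha> i) = (\<Sum>j\<in>I. real (m j) *\<^sub>R \<alpha> j)"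
      using weyl_lowers_weight[OF w assms(1)] by blast
    have "(\<Sum>j\<in>I. real (m j) *\<^sub>R \<alpha> j) \<bullet> fund_weight \<alpha> k = (\<Sum>j\<in>I. real (m j) * (fund_weight \<alpha> k \<bullet> \<alpha> j))"
      by (simp add: inner_sum_left inner_commute[of "fund_weight \<alpha> k"])
    also have "\<dots> \<in> \<rat>"
      using assms(3) by (intro Rats_sum Rats_mult) (auto simp: weight_simple)
    finally show ?thesis using m by simp
  qed
  then have "(\<Sum>w\<in>?W. (fund_weight \<alpha> i - w (fund_weight \<alpha> i)) \<bullet> fund_weight \<alpha> k) \<in> \<rat>"
    by (intro Rats_sum) auto
  moreover have "(\<Sum>w\<in>?W. (fund_weight \<alpha> i - w (fund_weight \<alpha> i)) \<bullet> fund_weight \<alpha> k) =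
      real (card ?W) * (fund_weight \<alpha> i \<bullet> fund_weight \<alpha> k)"
    by (simp add: inner_sum_left[symmetric] sum_subtractf orbit_sum_weight_zero inner_diff_left[symmetric]
        sum_constant_scaleR del: sum_constant)
  ultimately have "real (card ?W) * (fund_weight \<alpha> i \<bullet> fund_weight \<alpha> k) / real (card ?W) \<in> \<rat>"
    by (intro Rats_divide) auto
  then show ?thesis using c by simp
qed

end

section \<open>Fourier polynomials\<close>

lemma cpair_bil: "cpair b x = bil (emb b) x"
  unfolding cpair_def bil_def by (simp add: emb_def UNIV_option_conv sum.reindex)

lemma cpair_emb: "cpair b (emb a) = complex_of_real (b \<bullet> a)"
  unfolding cpair_def by (simp add: emb_def inner_vec_def)

lemma cpair_add: "cpair b (x + y) = cpair b x + cpair b y" "cpair (a + b) x = cpair a x + cpair b x"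
  by (simp_all add: cpair_def algebra_simps sum.distrib)

lemma cpair_smult: "cpair b (c *s x) = c * cpair b x"
  by (simp add: cpair_def sum_distrib_left algebra_simps)

lemma cpair_scaleR: "cpair (c *\<^sub>R b) x = complex_of_real c * cpair b x"
  by (simp add: cpair_def sum_distrib_left algebra_simps)

lemma cpair_zero [simp]: "cpair b 0 = 0" "cpair 0 x = 0"
  by (simp_all add: cpair_def)

lemma cpair_minus: "cpair (- b) x = - cpair b x" "cpair (a - b) x = cpair a x - cpair b x"
  by (simp_all add: cpair_def algebra_simps sum_negf sum_subtractf)

lemma emb_add: "emb (a + b) = emb a + emb b" and emb_scaleR: "emb (c *\<^sub>R b) = complex_of_real c *s emb b"
  and emb_zero: "emb 0 = 0"
  unfolding Finite_Cartesian_Product.vec_eq_iff by (auto simp: emb_def split: option.splits)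

lemma emb_sum: "emb (\<Sum>i\<in>S. g i) = (\<Sum>i\<in>S. emb (g i))"
  by (induction S rule: infinite_finite_induct) (simp_all add: emb_add emb_zero)

lemma emb_None [simp]: "emb b $ None = 0"
  by (simp add: emb_def)

lemma cpair_axis_None [simp]: "cpair b (axis None c) = 0"
  by (simp add: cpair_def axis_def)

lemma bil_axis [simp]: "bil (axis c d) x = d * x $ c"
  by (simp add: bil_def axis_def if_distrib[of "\<lambda>u. u * _"] cong: if_cong)

lemma exp_sum_cpair_exp: "exp_sum (\<lambda>x. exp (cpair b x / c))"
proof -
  have "(\<lambda>x. exp (cpair b x / c)) = (\<lambda>x. exp (bil ((1 / c) *s emb b) x))"
    by (simp add: bil_smult cpair_bil)
  then show ?thesis using exp_sum_exp by metis
qed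

lemma e_root_exp: "e_root b x = exp (cpair b x / 2) - exp (- cpair b x / 2)"
  by (simp add: e_root_def sinh_def scaleR_conv_of_real)

lemma exp_sum_e_root: "exp_sum (e_root b)"
proof -
  have "e_root b = (\<lambda>x. exp (cpair b x / 2) - exp (cpair b x / (- 2)))"
    by (rule ext) (simp add: e_root_exp)
  then show ?thesis by (simp only: exp_sum_diff exp_sum_cpair_exp)
qed

lemma dir_deriv_e_root: "dir_deriv v (e_root b) x = cosh (cpair b x / 2) * cpair b v"
  by (rule has_deriv_imp_dir_deriv)
     (auto simp: e_root_def cpair_add cpair_smult intro!: derivative_eq_intros)

lemma exp_sum_cosh: "exp_sum (\<lambda>x. cosh (cpair b x / 2))"
proof -
  have "(\<lambda>x. cosh (cpair b x / 2)) = (\<lambda>x. (1 / 2) * (exp (cpair b x / 2) + exp (cpair b x / (- 2))))"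
    by (rule ext) (simp add: cosh_def scaleR_conv_of_real)
  then show ?thesis by (simp only: exp_sum_cmult exp_sum_add exp_sum_cpair_exp)
qed

definition fourier_freq :: "real^'n \<Rightarrow> int \<Rightarrow> nat \<Rightarrow> complex^('n option)" where
  "fourier_freq \<mu> \<nu> m = (1 / of_nat m) *s (emb \<mu> + axis None (of_int \<nu>))"

lemma fourier_exp_bil: "fourier_exp \<mu> \<nu> m x = exp (bil (fourier_freq \<mu> \<nu> m) x)"
  by (simp add: fourier_exp_def fourier_freq_def bil_smult bil_add cpair_bil add_divide_distrib)

lemma fourier_poly_zero: "fourier_poly R (\<lambda>_. 0)"
  unfolding fourier_poly_def by (rule exI[of _ 0]) simp

lemma fourier_poly_step:
  assumes "fourier_poly R f" "\<mu> \<in> weight_lattice R" "m > 0"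
  shows "fourier_poly R (\<lambda>x. q * fourier_exp \<mu> \<nu> m x + f x)"
proof -
  obtain N :: nat and q' \<mu>' \<nu>' m' where *: "\<forall>i<N. \<mu>' i \<in> weight_lattice R \<and> m' i > 0"
    "\<forall>x. f x = (\<Sum>i<N. q' i * fourier_exp (\<mu>' i) (\<nu>' i) (m' i) x)"
    using assms(1) unfolding fourier_poly_def by blast
  let ?e = "\<lambda>a b i. case i of 0 \<Rightarrow> a | Suc j \<Rightarrow> b j"
  show ?thesis unfolding fourier_poly_def
    by (rule exI[of _ "Suc N"], rule exI[of _ "case_nat q q'"], rule exI[of _ "case_nat \<mu> \<mu>'"],
        rule exI[of _ "case_nat \<nu> \<nu>'"], rule exI[of _ "case_nat m m'"])
       (use * assms in \<open>auto simp: sum.lessThan_Suc_shift split: nat.splits simp del: sum.lessThan_Suc\<close>)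
qed

text \<open>
  With this rule the proofs of closure under the ring operations run as for exponential sums.
\<close>

lemma fourier_poly_induct [consumes 1, case_names zero step]:
  assumes "fourier_poly R f" and "P (\<lambda>_. 0)"
    and step: "\<And>f q \<mu> \<nu> m. fourier_poly R f \<Longrightarrow> P f \<Longrightarrow> \<mu> \<in> weight_lattice R \<Longrightarrow> m > 0 \<Longrightarrow>
         P (\<lambda>x. q * fourier_exp \<mu> \<nu> m x + f x)"
  shows "P f"
proof -
  obtain N :: nat and q \<mu> \<nu> m where *: "\<forall>i<N. \<mu> i \<in> weight_lattice R \<and> m i > 0"
    "\<forall>x. f x = (\<Sum>i<N. q i * fourier_exp (\<mu> i) (\<nu> i) (m i) x)"
    using assms(1) unfolding fourier_poly_def by blast
  have "fourier_poly R (\<lambda>x. \<Sum>i<M. q i * fourier_exp (\<mu> i) (\<nu> i) (m i) x) \<and>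
      P (\<lambda>x. \<Sum>i<M. q i * fourier_exp (\<mu> i) (\<nu> i) (m i) x)" if "M \<le> N" for M
    using that
  proof (induction M)
    case 0
    then show ?case by (simp add: fourier_poly_zero assms(2))
  next
    case (Suc M)
    then have IH: "fourier_poly R (\<lambda>x. \<Sum>i<M. q i * fourier_exp (\<mu> i) (\<nu> i) (m i) x)"
      "P (\<lambda>x. \<Sum>i<M. q i * fourier_exp (\<mu> i) (\<nu> i) (m i) x)"
      and l: "\<mu> M \<in> weight_lattice R" "m M > 0" using *(1) by auto
    show ?case
      using step[OF IH l, of "q M" "\<nu> M"] fourier_poly_step[OF IH(1) l, of "q M" "\<nu> M"]
      by (simp add: add.commute)
  qed
  moreover have "f = (\<lambda>x. \<Sum>i<N. q i * fourier_exp (\<mu> i) (\<nu> i) (m i) x)" using *(2) by auto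
  ultimately show ?thesis by auto
qed

lemma fourier_poly_exp_sum:
  assumes "fourier_poly R f" shows "exp_sum f"
  using assms by (induction rule: fourier_poly_induct) (simp_all add: fourier_exp_bil exp_sum.intros)

lemma fourier_poly_add:
  assumes "fourier_poly R f" "fourier_poly R g" shows "fourier_poly R (\<lambda>x. f x + g x)"
  using assms(1)
proof (induction rule: fourier_poly_induct)
  case (step f q \<mu> \<nu> m)
  then show ?case using fourier_poly_step[of R "\<lambda>x. f x + g x" \<mu> m q \<nu>] by (simp add: add.assoc)
qed (use assms(2) in simp)

lemma fourier_poly_cmult:
  assumes "fourier_poly R f" shows "fourier_poly R (\<lambda>x. c * f x)"
  using assms
proof (induction rule: fourier_poly_induct)
  case (step f q \<mu> \<nu> m)
  then show ?case using fourier_poly_step[of R "\<lambda>x. c * f x" \<mu> m "c * q" \<nu>] by (simp add: algebra_simps)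
qed (simp add: fourier_poly_zero)

lemma weight_lattice_zero: "0 \<in> weight_lattice R"
  by (simp add: weight_lattice_def)

lemma weight_lattice_add:
  "\<mu> \<in> weight_lattice R \<Longrightarrow> \<nu> \<in> weight_lattice R \<Longrightarrow> \<mu> + \<nu> \<in> weight_lattice R"
  unfolding weight_lattice_def by (auto simp: inner_add_left distrib_left add_divide_distrib)

lemma weight_lattice_uminus: "\<mu> \<in> weight_lattice R \<Longrightarrow> - \<mu> \<in> weight_lattice R"
  unfolding weight_lattice_def by (auto simp: minus_in_Ints_iff)

lemma weight_lattice_scale: "\<mu> \<in> weight_lattice R \<Longrightarrow> real m *\<^sub>R \<mu> \<in> weight_lattice R"
  unfolding weight_lattice_def
  by (auto simp: mult.left_commute[of _ "real m"] times_divide_eq_right[symmetric] simp del: times_divide_eq_right)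

lemma fourier_poly_exp:
  "\<mu> \<in> weight_lattice R \<Longrightarrow> m > 0 \<Longrightarrow> fourier_poly R (fourier_exp \<mu> \<nu> m)"
  using fourier_poly_step[OF fourier_poly_zero, of \<mu> R m 1 \<nu>] by simp

lemma fourier_poly_const: "fourier_poly R (\<lambda>_. c)"
  using fourier_poly_step[OF fourier_poly_zero weight_lattice_zero, of 1 R c 0] by (simp add: fourier_exp_def)

lemma fourier_poly_mult:
  assumes "fourier_poly R f" "fourier_poly R g" shows "fourier_poly R (\<lambda>x. f x * g x)"
  using assms(1)
proof (induction rule: fourier_poly_induct)
  case (step f q \<mu> \<nu> m)
  have "fourier_poly R (\<lambda>x. fourier_exp \<mu> \<nu> m x * g x)" using assms(2)
  proof (induction rule: fourier_poly_induct)
    case (step g q' \<mu>' \<nu>' m')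
    have "fourier_exp \<mu> \<nu> m x * fourier_exp \<mu>' \<nu>' m' x =
        fourier_exp (real m' *\<^sub>R \<mu> + real m *\<^sub>R \<mu>') (int m' * \<nu> + int m * \<nu>') (m * m') x" for x
      using \<open>m > 0\<close> \<open>m' > 0\<close>
      by (simp add: fourier_exp_def exp_add[symmetric] cpair_add cpair_scaleR field_simps)
    moreover have "fourier_poly R (\<lambda>x. q' * fourier_exp (real m' *\<^sub>R \<mu> + real m *\<^sub>R \<mu>') (int m' * \<nu> + int m * \<nu>') (m * m') x
        + fourier_exp \<mu> \<nu> m x * g x)"
      using step \<open>m > 0\<close> \<open>\<mu> \<in> _\<close> by (intro fourier_poly_step weight_lattice_add weight_lattice_scale) auto
    ultimately show ?case by (simp add: algebra_simps)
  qed (simp add: fourier_poly_zero)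
  then have "fourier_poly R (\<lambda>x. q * (fourier_exp \<mu> \<nu> m x * g x) + f x * g x)"
    by (intro fourier_poly_add fourier_poly_cmult step)
  then show ?case by (simp add: algebra_simps)
qed (simp add: fourier_poly_zero)

lemma fourier_poly_uminus: "fourier_poly R f \<Longrightarrow> fourier_poly R (\<lambda>x. - f x)"
  using fourier_poly_cmult[of R f "-1"] by simp

lemma fourier_poly_sum: "(\<And>i. i \<in> S \<Longrightarrow> fourier_poly R (f i)) \<Longrightarrow> fourier_poly R (\<lambda>x. \<Sum>i\<in>S. f i x)"
  by (induction S rule: infinite_finite_induct) (simp_all add: fourier_poly_const fourier_poly_add)

lemma fourier_poly_prod: "(\<And>i. i \<in> S \<Longrightarrow> fourier_poly R (f i)) \<Longrightarrow> fourier_poly R (\<lambda>x. \<Prod>i\<in>S. f i x)"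
  by (induction S rule: infinite_finite_induct) (simp_all add: fourier_poly_const fourier_poly_mult)

lemma fourier_poly_det:
  assumes "\<And>i j. i < m \<Longrightarrow> j < m \<Longrightarrow> fourier_poly R (\<lambda>x. A x $$ (i, j))"
    and "\<And>x. A x \<in> carrier_mat m m"
  shows "fourier_poly R (\<lambda>x. Determinant.det (A x))"
proof -
  have "(\<lambda>x. Determinant.det (A x)) =
      (\<lambda>x. \<Sum>p | p permutes {0..<m}. signof p * (\<Prod>i\<in>{0..<m}. A x $$ (i, p i)))"
    using det_def'[OF assms(2)] by auto
  moreover have "fourier_poly R (\<lambda>x. \<Sum>p | p permutes {0..<m}. signof p * (\<Prod>i\<in>{0..<m}. A x $$ (i, p i)))"
    by (intro fourier_poly_sum fourier_poly_mult fourier_poly_const fourier_poly_prod assms(1))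
       (auto dest: permutes_in_image)
  ultimately show ?thesis by simp
qed

lemma dir_deriv_exp: "dir_deriv v (\<lambda>x. exp (bil p x)) x = bil p v * exp (bil p x)"
  by (rule has_deriv_imp_dir_deriv) (auto simp: bil_add bil_smult intro!: derivative_eq_intros)

lemma dir_deriv_sum:
  assumes "\<And>i. i \<in> S \<Longrightarrow> exp_sum (f i)"
  shows "dir_deriv v (\<lambda>x. \<Sum>i\<in>S. f i x) x = (\<Sum>i\<in>S. dir_deriv v (f i) x)"
  by (rule has_deriv_imp_dir_deriv)
     (use exp_sum_has_deriv[OF assms, of _ x v 0] in \<open>auto intro!: derivative_eq_intros\<close>)

text \<open>
  If the reflection subtracts \<open>k a\<close> from \<open>\<mu>\<close> with \<open>k \<ge> 0\<close>, the difference telescopes into \<open>k\<close> terms, each the product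
  of \<open>e_root a\<close> and an exponential halfway between two consecutive weights. For negative \<open>k\<close> the two weights
  exchange their roles.
\<close>

lemma reflected_difference_divisible:
  assumes a: "a \<in> weight_lattice R" "a \<noteq> 0" and \<mu>: "\<mu> \<in> weight_lattice R" "2 * (\<mu> \<bullet> a) / (a \<bullet> a) \<in> \<int>"
  shows "\<exists>g. fourier_poly R g \<and>
    (\<forall>x. exp (cpair \<mu> x) - exp (cpair (root_reflection a \<mu>) x) = e_root a x * g x)"
proof -
  have nonneg: "\<exists>g. fourier_poly R g \<and> (\<forall>x. exp (cpair \<mu> x) - exp (cpair (\<mu> - real k *\<^sub>R a) x) = e_root a x * g x)"
    if \<mu>: "\<mu> \<in> weight_lattice R" for \<mu> and k :: nat
  proof (induction k)
    case 0
    show ?case by (intro exI[of _ "\<lambda>_. 0"]) (simp add: fourier_poly_zero)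
  next
    case (Suc k)
    then obtain g where g: "fourier_poly R g"
      "\<And>x. exp (cpair \<mu> x) - exp (cpair (\<mu> - real k *\<^sub>R a) x) = e_root a x * g x" by blast
    \<comment> \<open>twice the midpoint of two consecutive weights of the string\<close>
    define \<rho> where "\<rho> = real 2 *\<^sub>R \<mu> + (- (real (2 * k + 1) *\<^sub>R a))"
    have \<rho>: "\<rho> \<in> weight_lattice R"
      unfolding \<rho>_def by (intro weight_lattice_add weight_lattice_uminus weight_lattice_scale \<mu> a)
    have "exp (cpair (\<mu> - real k *\<^sub>R a) x) - exp (cpair (\<mu> - real (Suc k) *\<^sub>R a) x) =
        e_root a x * fourier_exp \<rho> 0 2 x" for x
    proof -
      have "cpair (\<mu> - real k *\<^sub>R a) x = cpair a x / 2 + cpair \<rho> x / 2"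
        "cpair (\<mu> - real (Suc k) *\<^sub>R a) x = - cpair a x / 2 + cpair \<rho> x / 2"
        by (simp_all add: \<rho>_def cpair_add cpair_minus cpair_scaleR field_simps)
      then show ?thesis by (simp only: exp_add e_root_exp) (simp add: fourier_exp_def algebra_simps)
    qed
    then have "exp (cpair \<mu> x) - exp (cpair (\<mu> - real (Suc k) *\<^sub>R a) x) =
        e_root a x * (g x + fourier_exp \<rho> 0 2 x)" for x
      using g(2)[of x] by (simp add: distrib_left algebra_simps)
    then show ?case
      by (intro exI[of _ "\<lambda>x. g x + fourier_exp \<rho> 0 2 x"] conjI allI fourier_poly_add g fourier_poly_exp \<rho>) auto
  qed
  obtain n :: int where n: "2 * (\<mu> \<bullet> a) / (a \<bullet> a) = of_int n" using \<mu>(2) by (auto elim: Ints_cases)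
  have refl: "root_reflection a \<mu> = \<mu> - of_int n *\<^sub>R a" by (simp add: root_reflection_def n)
  show ?thesis
  proof (cases "n \<ge> 0")
    case True
    then show ?thesis using nonneg[OF \<mu>(1), of "nat n"] refl by simp
  next
    case False
    have "- of_int n *\<^sub>R a = real (nat (- n)) *\<^sub>R a" using False by simp
    then have "root_reflection a \<mu> = \<mu> + real (nat (- n)) *\<^sub>R a" using refl by simp
    then have "root_reflection a \<mu> \<in> weight_lattice R" "\<mu> = root_reflection a \<mu> - real (nat (- n)) *\<^sub>R a"
      using weight_lattice_add[OF \<mu>(1) weight_lattice_scale[OF a(1)]] by auto
    then obtain g where "fourier_poly R g"
      "\<And>x. exp (cpair (root_reflection a \<mu>) x) - exp (cpair \<mu> x) = e_root a x * g x"
      using nonneg[of "root_reflection a \<mu>" "nat (- n)"] by auto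
    then show ?thesis
      by (intro exI[of _ "\<lambda>x. - g x"] conjI allI fourier_poly_uminus) (auto simp: algebra_simps)
  qed
qed

section \<open>Frames adapted to the mirrors\<close>

text \<open>
  The directions \<open>\<alpha>\<^sub>1, \<dots>, \<alpha>\<^sub>l, \<partial>/\<partial>x\<^bsub>l+1\<^esub>\<close>, numbered from \<open>0\<close> like the columns of a matrix.
\<close>

definition frame :: "(nat \<Rightarrow> real^'n) \<Rightarrow> nat \<Rightarrow> complex^('n option)" where
  "frame \<alpha> l = (if l < CARD('n) then emb (\<alpha> (Suc l)) else axis None 1)"

text \<open>
  No mirror belongs to the last direction; the value \<open>1\<close> lets the formulas treat all directions
  alike.
\<close>

definition mirror :: "(nat \<Rightarrow> real^'n) \<Rightarrow> nat \<Rightarrow> complex^('n option) \<Rightarrow> complex" where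
  "mirror \<alpha> l = (if l < CARD('n) then e_root (\<alpha> (Suc l)) else (\<lambda>_. 1))"

text \<open>
  \<open>B\<close> is the Jacobian matrix of \<open>f\<close> in the frame with each column divided by its mirror factor. The functions
  \<open>f\<close> are numbered from \<open>1\<close>, and the last one is meant to be the coordinate \<open>x\<^bsub>l+1\<^esub>\<close>.
\<close>

definition frame_matrix ::
    "(nat \<Rightarrow> real^'n) \<Rightarrow> (nat \<Rightarrow> complex^('n option) \<Rightarrow> complex) \<Rightarrow>
     (nat \<Rightarrow> nat \<Rightarrow> complex^('n option) \<Rightarrow> complex) \<Rightarrow> bool" where
  "frame_matrix \<alpha> f B \<longleftrightarrow>
     (\<forall>a\<le>CARD('n). \<forall>l\<le>CARD('n). exp_sum (B a l)) \<and>
     (\<forall>a\<le>CARD('n). \<forall>v x. dir_deriv v (f (Suc a)) x =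
         (\<Sum>l\<le>CARD('n). lin_coord \<alpha> (Suc l) v * (mirror \<alpha> l x * B a l x))) \<and>
     (\<forall>l\<le>CARD('n). B CARD('n) l = (\<lambda>_. if l = CARD('n) then 1 else 0))"

lemma exp_sum_mirror: "exp_sum (mirror \<alpha> l)"
  by (simp add: mirror_def exp_sum_e_root exp_sum_const)

context root_data
begin

lemma lin_coord_add: "lin_coord \<alpha> l (u + v) = lin_coord \<alpha> l u + lin_coord \<alpha> l v"
  and lin_coord_smult: "lin_coord \<alpha> l (c *s v) = c * lin_coord \<alpha> l v"
  by (simp_all add: lin_coord_def cpair_add cpair_smult)

lemma lin_coord_zero [simp]: "lin_coord \<alpha> l 0 = 0"
  by (simp add: lin_coord_def)

lemma lin_coord_sum: "lin_coord \<alpha> l (\<Sum>i\<in>S. c i *s w i) = (\<Sum>i\<in>S. c i * lin_coord \<alpha> l (w i))"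
  by (induction S rule: infinite_finite_induct) (simp_all add: lin_coord_add lin_coord_smult)

lemma lin_coord_frame:
  assumes "l \<le> \<ell>" "m \<le> \<ell>"
  shows "lin_coord \<alpha> (Suc l) (frame \<alpha> m) = (if l = m then 1 else 0)"
  using assms coweight_simple[of "Suc m" "Suc l"]
  by (auto simp: lin_coord_def frame_def cpair_emb)

lemma lin_coord_emb: "j \<in> I \<Longrightarrow> lin_coord \<alpha> j (emb b) = complex_of_real (b \<bullet> fund_coweight \<alpha> j)"
  by (simp add: lin_coord_def cpair_emb inner_commute)

lemma frame_expansion: "v = (\<Sum>l\<le>\<ell>. lin_coord \<alpha> (Suc l) v *s frame \<alpha> l)"
proof -
  have axis: "axis c 1 = (\<Sum>l\<le>\<ell>. lin_coord \<alpha> (Suc l) (axis c 1) *s frame \<alpha> l)" for c :: "'n option"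
  proof (cases c)
    case None
    then show ?thesis
      by (simp add: lessThan_Suc_atMost[symmetric] lin_coord_def frame_def)
  next
    case (Some d)
    have e: "axis (Some d) 1 = emb (axis d 1)"
      unfolding Finite_Cartesian_Product.vec_eq_iff
      by (auto simp: emb_def axis_def split: option.splits)
    have "emb (axis d 1) = emb (\<Sum>j\<in>I. (axis d 1 \<bullet> fund_coweight \<alpha> j) *\<^sub>R \<alpha> j)"
      using simple_expansion[of "axis d 1"] by simp
    also have "\<dots> = (\<Sum>j\<in>I. lin_coord \<alpha> j (emb (axis d 1)) *s emb (\<alpha> j))"
      by (simp add: emb_sum emb_scaleR lin_coord_emb)
    also have "\<dots> = (\<Sum>l<\<ell>. lin_coord \<alpha> (Suc l) (emb (axis d 1)) *s emb (\<alpha> (Suc l)))"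
      by (rule sum.reindex_bij_witness[of _ Suc "\<lambda>j. j - 1"]) auto
    also have "\<dots> = (\<Sum>l\<le>\<ell>. lin_coord \<alpha> (Suc l) (emb (axis d 1)) *s frame \<alpha> l)"
      by (simp add: lessThan_Suc_atMost[symmetric] frame_def lin_coord_def[of _ "Suc (\<ell>)"])
    finally show ?thesis using e Some by simp
  qed
  have "v = (\<Sum>c\<in>UNIV. v $ c *s axis c 1)"
    by (simp add: basis_expansion)
  also have "\<dots> = (\<Sum>c\<in>UNIV. v $ c *s (\<Sum>l\<le>\<ell>. lin_coord \<alpha> (Suc l) (axis c 1) *s frame \<alpha> l))"
    using axis by (intro sum.cong refl arg_cong2[where f = "(*s)"]) auto
  also have "\<dots> = (\<Sum>c\<in>UNIV. \<Sum>l\<le>\<ell>. (v $ c * lin_coord \<alpha> (Suc l) (axis c 1)) *s frame \<alpha> l)"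
    by (simp add: vec.scale_sum_right)
  also have "\<dots> = (\<Sum>l\<le>\<ell>. \<Sum>c\<in>UNIV. (v $ c * lin_coord \<alpha> (Suc l) (axis c 1)) *s frame \<alpha> l)"
    by (rule sum.swap)
  also have "\<dots> = (\<Sum>l\<le>\<ell>. lin_coord \<alpha> (Suc l) (\<Sum>c\<in>UNIV. v $ c *s axis c 1) *s frame \<alpha> l)"
    by (simp only: lin_coord_sum vec.scale_sum_left)
  also have "\<dots> = (\<Sum>l\<le>\<ell>. lin_coord \<alpha> (Suc l) v *s frame \<alpha> l)"
    by (simp add: basis_expansion)
  finally show ?thesis .
qed

lemma dir_deriv_frame:
  assumes "exp_sum f"
  shows "dir_deriv v f x = (\<Sum>l\<le>\<ell>. lin_coord \<alpha> (Suc l) v * dir_deriv (frame \<alpha> l) f x)"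
  by (subst frame_expansion[of v]) (rule exp_sum_dir_deriv_linear[OF assms])

lemma frame_matrix_linear:
  assumes "frame_matrix \<alpha> t B" "a \<le> \<ell>"
  shows "dir_deriv (\<Sum>i\<in>S. c i *s w i) (t (Suc a)) x = (\<Sum>i\<in>S. c i * dir_deriv (w i) (t (Suc a)) x)"
proof -
  have d: "dir_deriv v (t (Suc a)) x = (\<Sum>l\<le>\<ell>. lin_coord \<alpha> (Suc l) v * (mirror \<alpha> l x * B a l x))" for v
    using assms by (simp add: frame_matrix_def)
  have "dir_deriv (\<Sum>i\<in>S. c i *s w i) (t (Suc a)) x =
      (\<Sum>l\<le>\<ell>. \<Sum>i\<in>S. c i * (lin_coord \<alpha> (Suc l) (w i) * (mirror \<alpha> l x * B a l x)))"
    unfolding d lin_coord_sum by (simp add: sum_distrib_right sum_distrib_left mult_ac)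
  also have "\<dots> = (\<Sum>i\<in>S. \<Sum>l\<le>\<ell>. c i * (lin_coord \<alpha> (Suc l) (w i) * (mirror \<alpha> l x * B a l x)))"
    by (rule sum.swap)
  finally show ?thesis unfolding d by (simp add: sum_distrib_left)
qed

lemma dir_deriv_frame_vector:
  assumes "frame_matrix \<alpha> t B" "a \<le> \<ell>" "l \<le> \<ell>"
  shows "dir_deriv (frame \<alpha> l) (t (Suc a)) x = mirror \<alpha> l x * B a l x"
proof -
  have "dir_deriv (frame \<alpha> l) (t (Suc a)) x =
      (\<Sum>m\<le>\<ell>. if m = l then mirror \<alpha> m x * B a m x else 0)"
  proof -
    have "dir_deriv (frame \<alpha> l) (t (Suc a)) x =
        (\<Sum>m\<le>\<ell>. lin_coord \<alpha> (Suc m) (frame \<alpha> l) * (mirror \<alpha> m x * B a m x))"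
      using assms by (simp add: frame_matrix_def)
    then show ?thesis using assms(3) by (simp add: lin_coord_frame if_distrib[of "\<lambda>u. u * _"] cong: if_cong)
  qed
  then show ?thesis using assms(3) by simp
qed

lemma dir_deriv_None: "dir_deriv v (\<lambda>x. x $ None) x = v $ None"
  by (rule has_deriv_imp_dir_deriv) (auto intro!: derivative_eq_intros)

lemma frame_matrix_exists:
  assumes f: "\<And>i. i \<in> I \<Longrightarrow> fourier_poly R (f i)"
    and div: "\<And>i j. i \<in> I \<Longrightarrow> j \<in> I \<Longrightarrow>
      \<exists>g. fourier_poly R g \<and> (\<forall>x. dir_deriv (emb (\<alpha> j)) (f i) x = e_root (\<alpha> j) x * g x)"
    and last: "f (\<ell> + 1) = (\<lambda>x. x $ None)"
  obtains B where "frame_matrix \<alpha> f B"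
    "\<And>a l. a < \<ell> \<Longrightarrow> l < \<ell> \<Longrightarrow> fourier_poly R (B a l)"
proof -
  obtain g where g: "\<And>i j. i \<in> I \<Longrightarrow> j \<in> I \<Longrightarrow> fourier_poly R (g i j)"
    "\<And>i j x. i \<in> I \<Longrightarrow> j \<in> I \<Longrightarrow> dir_deriv (emb (\<alpha> j)) (f i) x = e_root (\<alpha> j) x * g i j x"
    using div by metis
  define B where "B a l = (if a < \<ell> then
      if l < \<ell> then g (Suc a) (Suc l) else dir_deriv (axis None 1) (f (Suc a))
      else (\<lambda>_. if l = \<ell> then 1 else 0))" for a l
  have exp_f: "exp_sum (f i)" if "i \<in> I" for i using f that fourier_poly_exp_sum by blast
  have "frame_matrix \<alpha> f B"
    unfolding frame_matrix_def
  proof (intro conjI allI impI)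
    fix a l assume "a \<le> \<ell>" "l \<le> \<ell>"
    then show "exp_sum (B a l)"
      using g(1)[THEN fourier_poly_exp_sum] exp_f
      by (auto simp: B_def exp_sum_const exp_sum_dir_deriv)
  next
    fix a v x assume a: "a \<le> \<ell>"
    show "dir_deriv v (f (Suc a)) x = (\<Sum>l\<le>\<ell>. lin_coord \<alpha> (Suc l) v * (mirror \<alpha> l x * B a l x))"
    proof (cases "a < \<ell>")
      case True
      have "dir_deriv (frame \<alpha> l) (f (Suc a)) x = mirror \<alpha> l x * B a l x" if "l \<le> \<ell>" for l
        using True that g(2)[of "Suc a" "Suc l"] by (auto simp: frame_def mirror_def B_def)
      then show ?thesis using dir_deriv_frame[OF exp_f[of "Suc a"], of v x] True by simp
    next
      case False
      then have "a = \<ell>" using a by simp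
      moreover have "(\<Sum>l\<le>\<ell>. lin_coord \<alpha> (Suc l) v * (mirror \<alpha> l x * B (\<ell>) l x)) = v $ None"
        by (simp add: B_def lessThan_Suc_atMost[symmetric] mirror_def lin_coord_def)
      ultimately show ?thesis using last by (simp add: dir_deriv_None)
    qed
  qed (simp add: B_def)
  then show ?thesis by (rule that) (simp add: B_def g)
qed

lemma weight_orbit_lattice: "i \<in> I \<Longrightarrow> w \<in> weyl_group R \<Longrightarrow> w (fund_weight \<alpha> i) \<in> weight_lattice R"
  unfolding weight_lattice_def using weight_integral by auto

lemma root_lattice: "a \<in> R \<Longrightarrow> a \<in> weight_lattice R"
  unfolding weight_lattice_def using cartan_int by auto

lemma orbit_derivative:
  "dir_deriv (emb a) (orbit_sum R \<alpha> i) x =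
     (\<Sum>w\<in>weyl_group R. complex_of_real (w (fund_weight \<alpha> i) \<bullet> a) * exp (cpair (w (fund_weight \<alpha> i)) x))"
proof -
  have "dir_deriv (emb a) (\<lambda>x. \<Sum>w\<in>weyl_group R. exp (bil (emb (w (fund_weight \<alpha> i))) x)) x =
      (\<Sum>w\<in>weyl_group R. bil (emb (w (fund_weight \<alpha> i))) (emb a) * exp (bil (emb (w (fund_weight \<alpha> i))) x))"
    by (subst dir_deriv_sum) (simp_all add: exp_sum_exp dir_deriv_exp)
  then show ?thesis by (simp add: orbit_sum_def[abs_def] cpair_bil[symmetric] cpair_emb)
qed

text \<open>
  The inner product with \<open>a\<close> changes sign under the reflection in \<open>a\<close>; so twice the derivative is a combination
  of differences of mirror images, and these are divisible.
\<close>

lemma orbit_derivative_divisible: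
  assumes "a \<in> R" "i \<in> I"
  shows "\<exists>g. fourier_poly R g \<and> (\<forall>x. dir_deriv (emb a) (orbit_sum R \<alpha> i) x = e_root a x * g x)"
proof -
  let ?\<omega> = "fund_weight \<alpha> i" and ?W = "weyl_group R"
  have "\<exists>g. fourier_poly R g \<and> (\<forall>x. exp (cpair (w ?\<omega>) x) - exp (cpair (root_reflection a (w ?\<omega>)) x) = e_root a x * g x)"
    if "w \<in> ?W" for w
    by (intro reflected_difference_divisible root_lattice weight_orbit_lattice assms that nonzero_R weight_integral)
  then obtain g where g: "\<And>w. w \<in> ?W \<Longrightarrow> fourier_poly R (g w)"
    "\<And>w x. w \<in> ?W \<Longrightarrow> exp (cpair (w ?\<omega>) x) - exp (cpair (root_reflection a (w ?\<omega>)) x) = e_root a x * g w x"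
    by metis
  \<comment> \<open>pair each weight with its mirror image\<close>
  have "dir_deriv (emb a) (orbit_sum R \<alpha> i) x =
      e_root a x * (\<Sum>w\<in>?W. complex_of_real (w ?\<omega> \<bullet> a) / 2 * g w x)" for x
  proof -
    let ?D = "dir_deriv (emb a) (orbit_sum R \<alpha> i) x"
    have "?D = (\<Sum>w\<in>?W. complex_of_real ((root_reflection a \<circ> w) ?\<omega> \<bullet> a) * exp (cpair ((root_reflection a \<circ> w) ?\<omega>) x))"
      unfolding orbit_derivative
      by (rule sum.reindex_bij_betw[OF weyl_refl_bij[OF assms(1)], symmetric])
    also have "\<dots> = (\<Sum>w\<in>?W. - (complex_of_real (w ?\<omega> \<bullet> a) * exp (cpair (root_reflection a (w ?\<omega>)) x)))"
      using nonzero_R[OF assms(1)] by (intro sum.cong) (auto simp: root_reflection_inner)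
    finally have "?D + ?D = (\<Sum>w\<in>?W. complex_of_real (w ?\<omega> \<bullet> a) * exp (cpair (w ?\<omega>) x)) +
        (\<Sum>w\<in>?W. - (complex_of_real (w ?\<omega> \<bullet> a) * exp (cpair (root_reflection a (w ?\<omega>)) x)))"
      by (simp add: orbit_derivative)
    also have "\<dots> = (\<Sum>w\<in>?W. complex_of_real (w ?\<omega> \<bullet> a) *
        (exp (cpair (w ?\<omega>) x) - exp (cpair (root_reflection a (w ?\<omega>)) x)))"
      unfolding sum.distrib[symmetric] by (intro sum.cong) (auto simp: algebra_simps)
    also have "\<dots> = (\<Sum>w\<in>?W. complex_of_real (w ?\<omega> \<bullet> a) * (e_root a x * g w x))"
      using g(2) by (intro sum.cong) auto
    also have "\<dots> = 2 * (e_root a x * (\<Sum>w\<in>?W. complex_of_real (w ?\<omega> \<bullet> a) / 2 * g w x))"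
      by (simp add: sum_distrib_left mult_ac)
    finally show ?thesis by simp
  qed
  moreover have "fourier_poly R (\<lambda>x. \<Sum>w\<in>?W. complex_of_real (w ?\<omega> \<bullet> a) / 2 * g w x)"
    by (intro fourier_poly_sum fourier_poly_cmult g)
  ultimately show ?thesis by blast
qed

end

section \<open>Determinants\<close>

lemma det_scale_rows_columns:
  fixes M :: "nat \<Rightarrow> nat \<Rightarrow> 'a :: comm_ring_1"
  shows "Determinant.det (mat N N (\<lambda>(i, j). a i * b j * M i j)) =
    (\<Prod>i<N. a i) * (\<Prod>j<N. b j) * Determinant.det (mat N N (\<lambda>(i, j). M i j))"
proof -
  have "Determinant.det (mat N N (\<lambda>(i, j). a i * b j * M i j)) =
      (\<Sum>p | p permutes {0..<N}. signof p * (\<Prod>i\<in>{0..<N}. a i * b (p i) * M i (p i)))"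
    by (subst det_def'[of _ N]) (auto intro!: sum.cong prod.cong dest: permutes_in_image)
  also have "\<dots> = (\<Sum>p | p permutes {0..<N}. (\<Prod>i<N. a i) * (\<Prod>j<N. b j) * (signof p * (\<Prod>i\<in>{0..<N}. M i (p i))))"
  proof (rule sum.cong)
    fix p assume "p \<in> {p. p permutes {0..<N}}"
    then have "(\<Prod>i\<in>{0..<N}. b (p i)) = (\<Prod>j\<in>{0..<N}. b j)"
      using prod.permute[of p "{0..<N}" b] by (simp add: comp_def)
    then show "signof p * (\<Prod>i\<in>{0..<N}. a i * b (p i) * M i (p i)) =
        (\<Prod>i<N. a i) * (\<Prod>j<N. b j) * (signof p * (\<Prod>i\<in>{0..<N}. M i (p i)))"
      by (simp add: prod.distrib atLeast0LessThan mult_ac)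
  qed simp
  also have "\<dots> = (\<Prod>i<N. a i) * (\<Prod>j<N. b j) * Determinant.det (mat N N (\<lambda>(i, j). M i j))"
    by (subst det_def'[of _ N]) (auto simp: sum_distrib_left intro!: sum.cong prod.cong dest: permutes_in_image)
  finally show ?thesis .
qed

lemma det_unit_column:
  fixes A :: "'a :: comm_ring_1 mat"
  assumes "A \<in> carrier_mat N N" "j < N" "\<And>i. i < N \<Longrightarrow> A $$ (i, j) = (if i = j then 1 else 0)"
  shows "Determinant.det A = Determinant.det (mat_delete A j j)"
proof -
  have "Determinant.det A = (\<Sum>i<N. if i = j then cofactor A i j else 0)"
    unfolding laplace_expansion_column[OF assms(1,2)] using assms(3) by (intro sum.cong) auto
  then show ?thesis using assms(2) by (simp add: cofactor_def)
qed

lemma det_unit_last_row: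
  fixes A :: "'a :: comm_ring_1 mat"
  assumes "A \<in> carrier_mat (Suc N) (Suc N)" "\<And>j. j \<le> N \<Longrightarrow> A $$ (N, j) = (if j = N then 1 else 0)"
  shows "Determinant.det A = Determinant.det (mat N N (\<lambda>(i, j). A $$ (i, j)))"
proof -
  have "Determinant.det A = (\<Sum>j<Suc N. if j = N then cofactor A N j else 0)"
    unfolding laplace_expansion_row[OF assms(1) lessI] using assms(2) by (intro sum.cong) auto
  also have "\<dots> = Determinant.det (mat_delete A N N)"
    by (simp add: cofactor_def flip: mult_2)
  also have "mat_delete A N N = mat N N (\<lambda>(i, j). A $$ (i, j))"
    using assms(1) by (intro eq_matI) (auto simp: mat_delete_def)
  finally show ?thesis .
qed

text \<open>
  If row \<open>k\<close> is replaced by the sum of the unit vectors \<open>r\<close> and \<open>s\<close>, the two columns still agree, so the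
  determinant vanishes; expanded along that row it is the sum of the two cofactors.
\<close>

lemma cofactor_equal_columns:
  fixes A :: "'a :: comm_ring_1 mat"
  assumes A: "A \<in> carrier_mat N N" and k: "k < N" and rs: "r < N" "s < N" "r \<noteq> s"
    and eq: "\<And>i. i < N \<Longrightarrow> A $$ (i, r) = A $$ (i, s)"
  shows "cofactor A k r = - cofactor A k s"
proof -
  define A' where "A' = mat N N (\<lambda>(i, j). if i = k then (if j = r \<or> j = s then 1 else 0) else A $$ (i, j))"
  have A': "A' \<in> carrier_mat N N" by (simp add: A'_def)
  have "Determinant.det A' = 0"
  proof (rule det_identical_columns[OF A' rs(3,1,2)])
    show "col A' r = col A' s"
      using rs eq by (intro eq_vecI) (auto simp: A'_def)
  qed
  moreover have cof: "cofactor A' k j = cofactor A k j" if "j < N" for j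
  proof -
    have "mat_delete A' k j = mat_delete A k j"
      using A k that by (intro eq_matI) (auto simp: mat_delete_def A'_def)
    then show ?thesis by (simp add: cofactor_def)
  qed
  have "Determinant.det A' = (\<Sum>j<N. (if j = r then cofactor A k r else 0) + (if j = s then cofactor A k s else 0))"
    unfolding laplace_expansion_row[OF A' k]
    using cof k rs(3) by (intro sum.cong) (auto simp: A'_def)
  ultimately have "cofactor A k r + cofactor A k s = 0" using rs by (simp add: sum.distrib)
  then show ?thesis by (simp add: eq_neg_iff_add_eq_0)
qed

text \<open>
  Only the identity and the transposition of \<open>r\<close> and \<open>s\<close> contribute to the Leibniz formula.
\<close>

lemma det_two_columns:
  fixes H :: "nat \<Rightarrow> nat \<Rightarrow> 'a :: comm_ring_1"
  assumes rs: "r < N" "s < N" "r \<noteq> s"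
  shows "Determinant.det (mat N N (\<lambda>(i, j). if j = r \<or> j = s then H i j else if i = j then 1 else 0)) =
    H r r * H s s - H r s * H s r"
proof -
  let ?Z = "\<lambda>i j. if j = r \<or> j = s then H i j else if i = j then 1 else (0 :: 'a)"
  let ?t = "Transposition.transpose r s"
  have prm: "?t permutes {0..<N}" using rs by (intro permutes_swap_id) auto
  have neq: "?t \<noteq> id" using rs(3) by (metis id_apply transpose_apply_first)
  have "Determinant.det (mat N N (\<lambda>(i, j). ?Z i j)) =
      (\<Sum>p | p permutes {0..<N}. signof p * (\<Prod>i\<in>{0..<N}. ?Z i (p i)))"
    by (subst det_def'[of _ N]) (auto intro!: sum.cong prod.cong dest: permutes_in_image)
  also have "\<dots> = (\<Sum>p\<in>{id, ?t}. signof p * (\<Prod>i\<in>{0..<N}. ?Z i (p i)))"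
  proof (rule sum.mono_neutral_right)
    show "{id, ?t} \<subseteq> {p. p permutes {0..<N}}" using prm permutes_id by auto
    show "\<forall>p\<in>{p. p permutes {0..<N}} - {id, ?t}. signof p * (\<Prod>i\<in>{0..<N}. ?Z i (p i)) = 0"
    proof
      fix p assume p: "p \<in> {p. p permutes {0..<N}} - {id, ?t}"
      have "\<exists>i<N. p i \<noteq> i \<and> p i \<noteq> r \<and> p i \<noteq> s"
      proof (rule ccontr)
        assume no: "\<not> ?thesis"
        have inj: "p i = p j \<Longrightarrow> i = j" for i j using p permutes_inj by (metis DiffE injD mem_Collect_eq)
        have fixed: "p j = j" if "j \<noteq> r" "j \<noteq> s" for j
        proof (cases "j < N")
          case True
          have "\<exists>i. p i = j" using p permutes_surj by (metis DiffE mem_Collect_eq surjD)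
          then obtain i where i: "p i = j" by blast
          then have "i < N" using p True permutes_in_image[of p "{0..<N}" i] by auto
          then show ?thesis using no i that by metis
        next
          case False
          then show ?thesis using p by (auto simp: permutes_def)
        qed
        have "p r = r \<or> p r = s" "p s = r \<or> p s = s" using fixed inj by metis+
        note pr_ps = this
        have "p = id \<or> p = ?t"
        proof (cases "p r = r")
          case True
          then have "p s = s" using pr_ps inj[of r s] rs(3) by auto
          then have "p i = i" for i using True fixed[of i] by blast
          then show ?thesis by auto
        next
          case False
          then have *: "p r = s" "p s = r" using pr_ps inj[of r s] rs(3) by auto
          have "p i = ?t i" for i
            using * fixed[of i] by (cases "i = r"; cases "i = s") (auto simp: Transposition.transpose_def)
          then show ?thesis by auto
        qed
        then show False using p by blast
      qed
      then obtain i where "i < N" "?Z i (p i) = 0" by auto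
      then have "(\<Prod>i\<in>{0..<N}. ?Z i (p i)) = 0" by (intro prod_zero bexI[of _ i]) auto
      then show "signof p * (\<Prod>i\<in>{0..<N}. ?Z i (p i)) = 0" by simp
    qed
  qed (simp add: finite_permutations)
  also have "\<dots> = signof id * (\<Prod>i\<in>{0..<N}. ?Z i i) + signof ?t * (\<Prod>i\<in>{0..<N}. ?Z i (?t i))"
    using neq by (simp cong: if_cong)
  also have "(\<Prod>i\<in>{0..<N}. ?Z i i) = (\<Prod>i\<in>{r, s}. H i i)"
    using rs by (intro prod.mono_neutral_cong_right) auto
  also have "(\<Prod>i\<in>{0..<N}. ?Z i (?t i)) = (\<Prod>i\<in>{r, s}. H i (?t i))"
    using rs by (intro prod.mono_neutral_cong_right) (auto simp: Transposition.transpose_def split: if_splits)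
  also have "signof ?t = (-1 :: 'a)"
    using rs(3) by (simp add: sign_swap_id)
  finally show ?thesis using rs(3) by simp
qed

text \<open>
  Jacobi's identity for a minor complementary to two indices. Multiply \<open>G\<close> by the identity matrix in which the
  columns \<open>r\<close> and \<open>s\<close> are replaced by those of \<open>H\<close>: the product is \<open>G\<close> with \<open>d\<close> times unit vectors in these two
  columns.
\<close>

lemma complementary_minor:
  fixes G :: "'a :: idom mat"
  assumes G: "G \<in> carrier_mat N N" and rs: "r < s" "s < N"
    and inv: "\<And>i j. i < N \<Longrightarrow> j < N \<Longrightarrow> (\<Sum>l<N. G $$ (i, l) * H l j) = (if i = j then d else 0)"
  shows "Determinant.det G * (H r r * H s s - H r s * H s r) =
    d\<^sup>2 * Determinant.det (mat_delete (mat_delete G s s) r r)"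
proof -
  define Z where "Z = mat N N (\<lambda>(i, j). if j = r \<or> j = s then H i j else if i = j then 1 else 0)"
  define G' where "G' = mat N N (\<lambda>(i, j). if j = r \<or> j = s then (if i = j then 1 else 0) else G $$ (i, j))"
  have Z: "Z \<in> carrier_mat N N" by (simp add: Z_def)
  have "G * Z = mat N N (\<lambda>(i, j). 1 * (if j = r \<or> j = s then d else 1) * (G' $$ (i, j)))"
  proof (rule eq_matI)
    fix i j assume "i < dim_row (mat N N (\<lambda>(i, j). 1 * (if j = r \<or> j = s then d else 1) * (G' $$ (i, j))))"
      "j < dim_col (mat N N (\<lambda>(i, j). 1 * (if j = r \<or> j = s then d else 1) * (G' $$ (i, j))))"
    then have ij: "i < N" "j < N" by auto
    have "(G * Z) $$ (i, j) = (\<Sum>l<N. G $$ (i, l) * Z $$ (l, j))"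
      using G Z ij by (auto simp: scalar_prod_def atLeast0LessThan)
    also have "\<dots> = (if j = r \<or> j = s then (if i = j then d else 0) else G $$ (i, j))"
    proof (cases "j = r \<or> j = s")
      case True
      then show ?thesis using inv[OF ij] ij by (simp add: Z_def)
    next
      case False
      then have "(\<Sum>l<N. G $$ (i, l) * Z $$ (l, j)) = (\<Sum>l<N. if l = j then G $$ (i, l) else 0)"
        using ij by (intro sum.cong) (auto simp: Z_def)
      then show ?thesis using False ij by simp
    qed
    finally show "(G * Z) $$ (i, j) =
        mat N N (\<lambda>(i, j). 1 * (if j = r \<or> j = s then d else 1) * (G' $$ (i, j))) $$ (i, j)"
      using ij by (simp add: G'_def)
  qed (use G Z in auto)
  then have "Determinant.det G * Determinant.det Z =
      Determinant.det (mat N N (\<lambda>(i, j). 1 * (if j = r \<or> j = s then d else 1) * (G' $$ (i, j))))"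
    using det_mult[OF G Z] by simp
  also have "\<dots> = (\<Prod>j<N. if j = r \<or> j = s then d else 1) * Determinant.det (mat N N (\<lambda>(i, j). G' $$ (i, j)))"
    by (subst det_scale_rows_columns) simp
  also have "(\<Prod>j<N. if j = r \<or> j = s then d else 1) = (\<Prod>j\<in>{r, s}. d)"
    using rs by (intro prod.mono_neutral_cong_right) auto
  also have "\<dots> = d\<^sup>2" using rs by (simp add: power2_eq_square)
  also have "mat N N (\<lambda>(i, j). G' $$ (i, j)) = G'" by (auto simp: G'_def)
  also have "Determinant.det G' = Determinant.det (mat_delete G' s s)"
    using rs by (intro det_unit_column[of _ N]) (auto simp: G'_def)
  also have "\<dots> = Determinant.det (mat_delete (mat_delete G' s s) r r)"
    using rs by (intro det_unit_column[of _ "N - 1"]) (auto simp: G'_def mat_delete_def)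
  also have "mat_delete (mat_delete G' s s) r r = mat_delete (mat_delete G s s) r r"
    using rs G by (intro eq_matI) (auto simp: G'_def mat_delete_def)
  finally show ?thesis
    unfolding Z_def using det_two_columns[of r N s H] rs by simp
qed

section \<open>The Jacobian divided by the mirrors\<close>

definition frame_mat ::
    "(nat \<Rightarrow> real^'n) \<Rightarrow> (nat \<Rightarrow> nat \<Rightarrow> complex^('n option) \<Rightarrow> complex) \<Rightarrow>
     complex^('n option) \<Rightarrow> complex mat" where
  "frame_mat \<alpha> B x = mat (Suc CARD('n)) (Suc CARD('n)) (\<lambda>(a, l). B a l x)"

definition frame_det ::
    "(nat \<Rightarrow> real^'n) \<Rightarrow> (nat \<Rightarrow> nat \<Rightarrow> complex^('n option) \<Rightarrow> complex) \<Rightarrow>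
     complex^('n option) \<Rightarrow> complex" where
  "frame_det \<alpha> B x = Determinant.det (frame_mat \<alpha> B x)"

definition frame_cofactor ::
    "(nat \<Rightarrow> real^'n) \<Rightarrow> (nat \<Rightarrow> nat \<Rightarrow> complex^('n option) \<Rightarrow> complex) \<Rightarrow> nat \<Rightarrow> nat \<Rightarrow>
     complex^('n option) \<Rightarrow> complex" where
  "frame_cofactor \<alpha> B k l x = cofactor (frame_mat \<alpha> B x) k l"

definition mirror_product :: "(nat \<Rightarrow> real^'n) \<Rightarrow> complex^('n option) \<Rightarrow> complex" where
  "mirror_product \<alpha> x = (\<Prod>l<Suc CARD('n). mirror \<alpha> l x)"

lemma exp_sum_mirror_product: "exp_sum (mirror_product \<alpha>)"
  unfolding mirror_product_def[abs_def] by (intro exp_sum_prod exp_sum_mirror)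

lemma frame_mat_carrier: "frame_mat (\<alpha> :: nat \<Rightarrow> real^'n) B x \<in> carrier_mat (Suc CARD('n)) (Suc CARD('n))"
  by (simp add: frame_mat_def)

lemma exp_sum_frame_det: "frame_matrix \<alpha> f B \<Longrightarrow> exp_sum (frame_det \<alpha> B)"
  unfolding frame_det_def[abs_def]
  by (rule exp_sum_det[OF _ frame_mat_carrier]) (simp add: frame_matrix_def frame_mat_def)

lemma exp_sum_frame_cofactor:
  fixes \<alpha> :: "nat \<Rightarrow> real^'n"
  assumes "frame_matrix \<alpha> f B" "k \<le> CARD('n)" "l \<le> CARD('n)"
  shows "exp_sum (frame_cofactor \<alpha> B k l)"
  unfolding frame_cofactor_def[abs_def] cofactor_def
  by (intro exp_sum_cmult exp_sum_det[where m = "CARD('n)"])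
     (use assms in \<open>auto simp: frame_matrix_def frame_mat_def mat_delete_def\<close>)

lemma frame_cofactor_orthogonal:
  fixes \<alpha> :: "nat \<Rightarrow> real^'n"
  assumes "a \<le> CARD('n)" "k \<le> CARD('n)"
  shows "(\<Sum>l\<le>CARD('n). B a l x * frame_cofactor \<alpha> B k l x) = (if a = k then frame_det \<alpha> B x else 0)"
proof -
  let ?A = "frame_mat \<alpha> B x"
  note A = frame_mat_carrier[of \<alpha> B x]
  have "(?A * adj_mat ?A) $$ (a, k) = (\<Sum>l<Suc CARD('n). ?A $$ (a, l) * adj_mat ?A $$ (l, k))"
    using A adj_mat(1)[OF A] assms by (auto simp: scalar_prod_def atLeast0LessThan less_Suc_eq_le)
  also have "\<dots> = (\<Sum>l\<le>CARD('n). B a l x * frame_cofactor \<alpha> B k l x)"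
    using assms by (intro sum.cong) (auto simp: frame_cofactor_def frame_mat_def adj_mat_def)
  finally show ?thesis
    unfolding adj_mat(2)[OF A] using assms A by (auto simp: frame_det_def)
qed

context root_data
begin

lemma frame_determined:
  assumes "\<And>l. l \<le> \<ell> \<Longrightarrow> lin_coord \<alpha> (Suc l) v = 0" shows "v = 0"
  by (subst frame_expansion) (simp add: assms)

lemma index_shift: "(\<forall>a\<in>{1..Suc (\<ell>)}. P a) \<longleftrightarrow> (\<forall>a\<le>\<ell>. P (Suc a))"
  by (metis Suc_le_D Suc_le_mono atLeastAtMost_iff One_nat_def le0)

lemma coords_at_iff:
  assumes f: "frame_matrix \<alpha> f B"
  shows "coords_at f x \<longleftrightarrow> mirror_product \<alpha> x * frame_det \<alpha> B x \<noteq> 0"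
proof -
  define J where "J = mat (Suc (\<ell>)) (Suc (\<ell>)) (\<lambda>(a, l). 1 * mirror \<alpha> l x * B a l x)"
  have J: "J \<in> carrier_mat (Suc (\<ell>)) (Suc (\<ell>))" by (simp add: J_def)
  have detJ: "Determinant.det J = mirror_product \<alpha> x * frame_det \<alpha> B x"
    unfolding J_def det_scale_rows_columns by (simp add: mirror_product_def frame_det_def frame_mat_def)
  have mult: "(J *\<^sub>v u) $v a = (\<Sum>l\<le>\<ell>. u $v l * (mirror \<alpha> l x * B a l x))"
    if "u \<in> carrier_vec (Suc (\<ell>))" "a \<le> \<ell>" for u a
    using that by (auto simp: J_def scalar_prod_def atLeast0LessThan lessThan_Suc_atMost mult_ac intro!: sum.cong)
  have der: "dir_deriv v (f (Suc a)) x = (\<Sum>l\<le>\<ell>. lin_coord \<alpha> (Suc l) v * (mirror \<alpha> l x * B a l x))"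
    if "a \<le> \<ell>" for a v
    using f that by (simp add: frame_matrix_def)
  have card: "CARD('n option) = Suc (\<ell>)" by simp
  have "\<not> coords_at f x \<longleftrightarrow> (\<exists>v. v \<noteq> 0 \<and> (\<forall>a\<le>\<ell>. dir_deriv v (f (Suc a)) x = 0))"
    unfolding coords_at_def card index_shift by auto
  also have "\<dots> \<longleftrightarrow> (\<exists>u. u \<in> carrier_vec (Suc (\<ell>)) \<and> u \<noteq> 0\<^sub>v (Suc (\<ell>)) \<and> J *\<^sub>v u = 0\<^sub>v (Suc (\<ell>)))"
  proof
    assume "\<exists>v. v \<noteq> 0 \<and> (\<forall>a\<le>\<ell>. dir_deriv v (f (Suc a)) x = 0)"
    then obtain v where v: "v \<noteq> 0" "\<And>a. a \<le> \<ell> \<Longrightarrow> dir_deriv v (f (Suc a)) x = 0" by blast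
    define u where "u = vec (Suc (\<ell>)) (\<lambda>l. lin_coord \<alpha> (Suc l) v)"
    have u: "u \<in> carrier_vec (Suc (\<ell>))" by (simp add: u_def)
    have "u \<noteq> 0\<^sub>v (Suc (\<ell>))"
    proof
      assume "u = 0\<^sub>v (Suc (\<ell>))"
      then have "u $v l = 0" if "l \<le> \<ell>" for l using that by simp
      then show False using v(1) frame_determined[of v] by (auto simp: u_def)
    qed
    moreover have "J *\<^sub>v u = 0\<^sub>v (Suc (\<ell>))"
    proof (rule eq_vecI)
      fix a assume "a < dim_vec (0\<^sub>v (Suc (\<ell>)) :: complex vec)"
      then have a: "a \<le> \<ell>" by simp
      show "(J *\<^sub>v u) $v a = 0\<^sub>v (Suc (\<ell>)) $v a"
        using v(2)[OF a] unfolding mult[OF u a] der[OF a] using a by (simp add: u_def)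
    qed (use J in simp)
    ultimately show "\<exists>u. u \<in> carrier_vec (Suc (\<ell>)) \<and> u \<noteq> 0\<^sub>v (Suc (\<ell>)) \<and> J *\<^sub>v u = 0\<^sub>v (Suc (\<ell>))"
      using u by blast
  next
    assume "\<exists>u. u \<in> carrier_vec (Suc (\<ell>)) \<and> u \<noteq> 0\<^sub>v (Suc (\<ell>)) \<and> J *\<^sub>v u = 0\<^sub>v (Suc (\<ell>))"
    then obtain u where u: "u \<in> carrier_vec (Suc (\<ell>))" "u \<noteq> 0\<^sub>v (Suc (\<ell>))"
      "J *\<^sub>v u = 0\<^sub>v (Suc (\<ell>))" by blast
    define v where "v = (\<Sum>l\<le>\<ell>. u $v l *s frame \<alpha> l)"
    have lin: "lin_coord \<alpha> (Suc l) v = u $v l" if "l \<le> \<ell>" for l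
    proof -
      have "lin_coord \<alpha> (Suc l) v = (\<Sum>m\<le>\<ell>. if l = m then u $v m else 0)"
        unfolding v_def lin_coord_sum using that by (intro sum.cong) (auto simp: lin_coord_frame)
      then show ?thesis using that by simp
    qed
    have "v \<noteq> 0"
    proof
      assume "v = 0"
      then have "u $v l = 0" if "l \<le> \<ell>" for l using lin[OF that] by simp
      then have "u = 0\<^sub>v (Suc (\<ell>))" using u(1) by (intro eq_vecI) auto
      then show False using u(2) by simp
    qed
    moreover have "dir_deriv v (f (Suc a)) x = 0" if a: "a \<le> \<ell>" for a
    proof -
      have "dir_deriv v (f (Suc a)) x = (J *\<^sub>v u) $v a"
        unfolding mult[OF u(1) a] der[OF a] using lin by (intro sum.cong) auto
      then show ?thesis using u(3) a by simp
    qed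
    ultimately show "\<exists>v. v \<noteq> 0 \<and> (\<forall>a\<le>\<ell>. dir_deriv v (f (Suc a)) x = 0)" by blast
  qed
  also have "\<dots> \<longleftrightarrow> mirror_product \<alpha> x * frame_det \<alpha> B x = 0"
    unfolding det_0_iff_vec_prod_zero[OF J, symmetric] detJ ..
  finally show ?thesis by blast
qed

lemma cofactor_field_dual:
  assumes f: "frame_matrix \<alpha> f B" and c: "coords_at f x" and ak: "a \<le> \<ell>" "k \<le> \<ell>"
  shows "dir_deriv (\<Sum>l\<le>\<ell>. (frame_cofactor \<alpha> B k l x / (mirror \<alpha> l x * frame_det \<alpha> B x)) *s frame \<alpha> l)
    (f (Suc a)) x = (if k = a then 1 else 0)"
proof -
  have nz: "frame_det \<alpha> B x \<noteq> 0" "\<And>l. l \<le> \<ell> \<Longrightarrow> mirror \<alpha> l x \<noteq> 0"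
    using c unfolding coords_at_iff[OF f]
    by (auto simp: mirror_product_def less_Suc_eq_le simp del: lessThan_Suc prod.lessThan_Suc)
  have "dir_deriv (\<Sum>l\<le>\<ell>. (frame_cofactor \<alpha> B k l x / (mirror \<alpha> l x * frame_det \<alpha> B x)) *s frame \<alpha> l)
      (f (Suc a)) x = (\<Sum>l\<le>\<ell>. B a l x * frame_cofactor \<alpha> B k l x / frame_det \<alpha> B x)"
    unfolding frame_matrix_linear[OF f ak(1)]
    using ak nz by (intro sum.cong) (auto simp: dir_deriv_frame_vector[OF f] field_simps)
  also have "\<dots> = (\<Sum>l\<le>\<ell>. B a l x * frame_cofactor \<alpha> B k l x) / frame_det \<alpha> B x"
    by (simp add: sum_divide_distrib)
  also have "\<dots> = (if k = a then 1 else 0)"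
    using frame_cofactor_orthogonal[OF ak, of B x] nz(1) by simp
  finally show ?thesis .
qed

lemma coords_at_injective:
  assumes f: "frame_matrix \<alpha> f B" and c: "coords_at f x"
    and eq: "\<And>a. a \<le> \<ell> \<Longrightarrow> dir_deriv u (f (Suc a)) x = dir_deriv v (f (Suc a)) x"
  shows "u = v"
proof -
  have "dir_deriv (u - v) (f (Suc a)) x = 0" if a: "a \<le> \<ell>" for a
    using frame_matrix_linear[OF f a, of "\<lambda>i. if i then 1 else - 1" "\<lambda>i. if i then u else v" "{True, False}" x] eq[OF a]
    by simp
  then have "\<forall>a\<in>{1..CARD('n option)}. dir_deriv (u - v) (f a) x = 0"
    using index_shift[of "\<lambda>a. dir_deriv (u - v) (f a) x = 0"] by simp
  then have "u - v = 0" using c unfolding coords_at_def by blast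
  then show ?thesis by simp
qed

text \<open>
  Cramer's rule.
\<close>

lemma coord_field_cofactor:
  assumes f: "frame_matrix \<alpha> f B" and c: "coords_at f x" and k: "k \<le> \<ell>"
  shows "coord_field f (Suc k) x =
    (\<Sum>l\<le>\<ell>. (frame_cofactor \<alpha> B k l x / (mirror \<alpha> l x * frame_det \<alpha> B x)) *s frame \<alpha> l)"
    (is "_ = ?v")
proof -
  have v: "dir_deriv ?v (f (Suc a)) x = (if k = a then 1 else 0)" if "a \<le> \<ell>" for a
    by (rule cofactor_field_dual[OF f c that k])
  have shift: "(\<forall>b\<in>{1..CARD('n option)}. dir_deriv u (f b) x = (if Suc k = b then 1 else 0)) \<longleftrightarrow>
      (\<forall>a\<le>\<ell>. dir_deriv u (f (Suc a)) x = (if k = a then 1 else 0))" for u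
    using index_shift[of "\<lambda>b. dir_deriv u (f b) x = (if Suc k = b then 1 else 0)"] by simp
  show ?thesis
    unfolding coord_field_def shift
  proof (rule the_equality)
    show "\<forall>a\<le>\<ell>. dir_deriv ?v (f (Suc a)) x = (if k = a then 1 else 0)"
      using v by blast
    show "u = ?v" if "\<forall>a\<le>\<ell>. dir_deriv u (f (Suc a)) x = (if k = a then 1 else 0)" for u
      by (rule coords_at_injective[OF f c]) (use that v in auto)
  qed
qed

lemma coord_field_dual:
  assumes "frame_matrix \<alpha> f B" "coords_at f x" "a \<le> \<ell>" "k \<le> \<ell>"
  shows "dir_deriv (coord_field f (Suc k) x) (f (Suc a)) x = (if k = a then 1 else 0)"
  using cofactor_field_dual[OF assms] coord_field_cofactor[OF assms(1,2,4)] by simp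

section \<open>Nonvanishing of the reduced Jacobian of the orbit sums\<close>

text \<open>
  On the mirror only the term survives in which the factor \<open>e_root\<close> is differentiated. This recovers the
  value of \<open>B\<close> at points where it cannot be obtained by division.
\<close>

lemma mirror_second_derivative:
  assumes f: "frame_matrix \<alpha> f B" and al: "a \<le> \<ell>" "l < \<ell>"
    and x: "cpair (\<alpha> (Suc l)) x = 0"
  shows "dir_deriv v (dir_deriv (emb (\<alpha> (Suc l))) (f (Suc a))) x = cpair (\<alpha> (Suc l)) v * B a l x"
proof -
  have "dir_deriv (emb (\<alpha> (Suc l))) (f (Suc a)) = (\<lambda>x. e_root (\<alpha> (Suc l)) x * B a l x)"
    using dir_deriv_frame_vector[OF f al(1), of l] al(2) by (auto simp: frame_def mirror_def)
  moreover have "exp_sum (B a l)" using f al by (simp add: frame_matrix_def)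
  ultimately show ?thesis
    using x by (simp add: dir_deriv_mult exp_sum_e_root dir_deriv_e_root) (simp add: e_root_def)
qed

text \<open>
  A family that contains the orbit sums and is closed under directional derivatives, which act on the
  coefficients \<open>c\<close> only.
\<close>

definition weighted_orbit :: "nat \<Rightarrow> nat \<Rightarrow> ((real^'n \<Rightarrow> real^'n) \<Rightarrow> real) \<Rightarrow> complex^('n option) \<Rightarrow> complex" where
  "weighted_orbit k i c x =
     exp (complex_of_real (dz_degree \<alpha> k i) * x $ None) *
     (\<Sum>w\<in>weyl_group R. complex_of_real (c w) * exp (cpair (w (fund_weight \<alpha> i)) x))"

lemma weighted_orbit_repr:
  "weighted_orbit k i c x = (\<Sum>w\<in>weyl_group R. complex_of_real (c w) *
     exp (bil (emb (w (fund_weight \<alpha> i)) + axis None (complex_of_real (dz_degree \<alpha> k i))) x))"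
  unfolding weighted_orbit_def bil_add cpair_bil exp_add sum_distrib_left
  by (intro sum.cong) (simp_all add: mult_ac)

lemma dir_deriv_weighted_orbit:
  "dir_deriv (emb b) (weighted_orbit k i c) = weighted_orbit k i (\<lambda>w. c w * (w (fund_weight \<alpha> i) \<bullet> b))"
proof
  fix x
  let ?p = "\<lambda>w. emb (w (fund_weight \<alpha> i)) + axis None (complex_of_real (dz_degree \<alpha> k i))"
  have "dir_deriv (emb b) (weighted_orbit k i c) x =
      (\<Sum>w\<in>weyl_group R. dir_deriv (emb b) (\<lambda>x. complex_of_real (c w) * exp (bil (?p w) x)) x)"
    unfolding weighted_orbit_repr[abs_def]
    by (rule dir_deriv_sum) (intro exp_sum_cmult exp_sum_exp)
  also have "\<dots> = (\<Sum>w\<in>weyl_group R. complex_of_real (c w) * (bil (?p w) (emb b) * exp (bil (?p w) x)))"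
    by (simp add: dir_deriv_mult exp_sum_const exp_sum_exp dir_deriv_const dir_deriv_exp)
  also have "\<dots> = weighted_orbit k i (\<lambda>w. c w * (w (fund_weight \<alpha> i) \<bullet> b)) x"
    unfolding weighted_orbit_repr
    by (simp add: bil_add cpair_bil[symmetric] cpair_emb mult_ac)
  finally show "dir_deriv (emb b) (weighted_orbit k i c) x =
      weighted_orbit k i (\<lambda>w. c w * (w (fund_weight \<alpha> i) \<bullet> b)) x" .
qed

lemma y_coord_weighted_orbit:
  "i \<in> I \<Longrightarrow> y_coord R \<alpha> k i = weighted_orbit k i (\<lambda>_. 1)"
  by (rule ext) (simp add: y_coord_def weighted_orbit_def orbit_sum_def)

text \<open>
  Write \<open>\<omega> - w \<omega>\<close> as a combination of simple roots with natural coefficients \<open>m\<close>. Equality of the pairings with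
  \<open>\<xi>\<close> kills the coefficients outside \<open>S\<close>. As the roots in \<open>S\<close> are orthogonal, the equality of lengths becomes a
  vanishing sum over \<open>j \<in> S\<close> of the terms \<open>(m\<^sub>j\<^sup>2 - \<delta>\<^sub>i\<^sub>j m\<^sub>j) |\<alpha>\<^sub>j|\<^sup>2\<close>, with Kronecker's \<open>\<delta>\<close>; none of them is
  negative.
\<close>

lemma extremal_weights:
  assumes S: "S \<subseteq> I" "\<And>i j. i \<in> S \<Longrightarrow> j \<in> S \<Longrightarrow> i \<noteq> j \<Longrightarrow> \<alpha> i \<bullet> \<alpha> j = 0"
    and \<xi>: "\<And>j. j \<in> I \<Longrightarrow> \<alpha> j \<bullet> \<xi> = (if j \<in> S then 0 else 1)"
    and w: "w \<in> weyl_group R" and i: "i \<in> I"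
  shows "w (fund_weight \<alpha> i) \<bullet> \<xi> \<le> fund_weight \<alpha> i \<bullet> \<xi>"
    and "w (fund_weight \<alpha> i) \<bullet> \<xi> = fund_weight \<alpha> i \<bullet> \<xi> \<Longrightarrow>
      w (fund_weight \<alpha> i) = fund_weight \<alpha> i \<or> i \<in> S \<and> w (fund_weight \<alpha> i) = fund_weight \<alpha> i - \<alpha> i"
proof -
  let ?\<omega> = "fund_weight \<alpha> i"
  obtain m :: "nat \<Rightarrow> nat" where m: "?\<omega> - w ?\<omega> = (\<Sum>j\<in>I. real (m j) *\<^sub>R \<alpha> j)"
    using weyl_lowers_weight[OF w i] by blast
  have "(?\<omega> - w ?\<omega>) \<bullet> \<xi> = (\<Sum>j\<in>I. if j \<in> S then 0 else real (m j))"
    unfolding m inner_sum_left using \<xi> by (intro sum.cong) auto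
  then have diff: "?\<omega> \<bullet> \<xi> - w ?\<omega> \<bullet> \<xi> = (\<Sum>j\<in>I. if j \<in> S then 0 else real (m j))"
    by (simp add: inner_diff_left)
  have nn: "(\<Sum>j\<in>I. if j \<in> S then 0 else real (m j)) \<ge> 0" by (intro sum_nonneg) auto
  show "w ?\<omega> \<bullet> \<xi> \<le> ?\<omega> \<bullet> \<xi>" using diff nn by linarith
  show "w ?\<omega> = ?\<omega> \<or> i \<in> S \<and> w ?\<omega> = ?\<omega> - \<alpha> i" if eq: "w ?\<omega> \<bullet> \<xi> = ?\<omega> \<bullet> \<xi>"
  proof -
    have finS: "finite S" using S(1) finite_subset by blast
    have "(\<Sum>j\<in>I. if j \<in> S then 0 else real (m j)) = 0" using eq diff by simp
    then have m0: "m j = 0" if "j \<in> I" "j \<notin> S" for j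
      using that by (subst (asm) sum_nonneg_eq_0_iff) (auto split: if_splits)
    have mS: "?\<omega> - w ?\<omega> = (\<Sum>j\<in>S. real (m j) *\<^sub>R \<alpha> j)"
      unfolding m using m0 S(1) by (intro sum.mono_neutral_right) auto
    define v where "v = (\<Sum>j\<in>S. real (m j) *\<^sub>R \<alpha> j)"
    have vj: "v \<bullet> \<alpha> j = real (m j) * (\<alpha> j \<bullet> \<alpha> j)" if "j \<in> S" for j
    proof -
      have "v \<bullet> \<alpha> j = (\<Sum>l\<in>S. if l = j then real (m j) * (\<alpha> j \<bullet> \<alpha> j) else 0)"
        unfolding v_def inner_sum_left using S(2) that by (intro sum.cong) auto
      then show ?thesis using that finS by simp
    qed
    have "v \<bullet> v = (\<Sum>j\<in>S. real (m j) * (v \<bullet> \<alpha> j))"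
      by (subst (2) v_def) (simp add: inner_sum_right)
    then have vv: "v \<bullet> v = (\<Sum>j\<in>S. (real (m j))\<^sup>2 * (\<alpha> j \<bullet> \<alpha> j))"
      by (simp add: vj power2_eq_square mult_ac)
    have wv: "?\<omega> \<bullet> v = (\<Sum>j\<in>S. if j = i then real (m i) * (\<alpha> i \<bullet> \<alpha> i) / 2 else 0)"
      unfolding v_def inner_sum_right using S(1) by (intro sum.cong) (auto simp: weight_simple)
    have "w ?\<omega> = ?\<omega> - v" using mS by (simp add: v_def algebra_simps)
    then have "?\<omega> \<bullet> ?\<omega> = (?\<omega> - v) \<bullet> (?\<omega> - v)" using weyl_isometry[OF w, of ?\<omega> ?\<omega>] by simp
    then have "v \<bullet> v = 2 * (?\<omega> \<bullet> v)" by (simp add: inner_diff_left inner_diff_right inner_commute)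
    then have "(\<Sum>j\<in>S. (real (m j))\<^sup>2 * (\<alpha> j \<bullet> \<alpha> j)) = (\<Sum>j\<in>S. if j = i then real (m i) * (\<alpha> i \<bullet> \<alpha> i) else 0)"
      unfolding vv wv by (simp add: sum_distrib_left if_distrib cong: if_cong)
    then have "(\<Sum>j\<in>S. (real (m j))\<^sup>2 * (\<alpha> j \<bullet> \<alpha> j) - (if j = i then real (m i) * (\<alpha> i \<bullet> \<alpha> i) else 0)) = 0"
      by (simp add: sum_subtractf)
    moreover have "(real (m j))\<^sup>2 * (\<alpha> j \<bullet> \<alpha> j) - (if j = i then real (m i) * (\<alpha> i \<bullet> \<alpha> i) else 0) \<ge> 0" for j
    proof -
      have "real (m j) \<le> (real (m j))\<^sup>2" by (cases "m j") (auto simp: power2_eq_square)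
      then show ?thesis by (auto intro: mult_right_mono)
    qed
    ultimately have term0: "(real (m j))\<^sup>2 * (\<alpha> j \<bullet> \<alpha> j) - (if j = i then real (m i) * (\<alpha> i \<bullet> \<alpha> i) else 0) = 0"
      if "j \<in> S" for j
      using finS that by (subst (asm) sum_nonneg_eq_0_iff) auto
    have other: "m j = 0" if "j \<in> S" "j \<noteq> i" for j
      using term0[OF that(1)] that simple_norm_pos[of j] S(1) by auto
    show ?thesis
    proof (cases "i \<in> S")
      case True
      have "((real (m i))\<^sup>2 - real (m i)) * (\<alpha> i \<bullet> \<alpha> i) = 0"
        using term0[OF True] by (simp add: algebra_simps)
      then have "real (m i) * (real (m i) - 1) = 0"
        using simple_norm_pos[OF i] by (simp add: power2_eq_square algebra_simps)
      then have mi: "m i = 0 \<or> m i = 1" by auto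
      have "v = (\<Sum>j\<in>S. if j = i then real (m i) *\<^sub>R \<alpha> i else 0)"
        unfolding v_def using other by (intro sum.cong) auto
      then have "v = real (m i) *\<^sub>R \<alpha> i" using True finS by simp
      then show ?thesis using mi True \<open>w ?\<omega> = ?\<omega> - v\<close> by auto
    next
      case False
      then have "v = 0" unfolding v_def using other by (intro sum.neutral) auto
      then show ?thesis using \<open>w ?\<omega> = ?\<omega> - v\<close> by simp
    qed
  qed
qed

lemma exp_decay_limit:
  fixes c :: real
  assumes "c \<le> 0"
  shows "((\<lambda>\<tau>::real. exp (complex_of_real (\<tau> * c))) \<longlongrightarrow> (if c = 0 then 1 else 0)) at_top"
proof (cases "c = 0")
  case False
  then have "((\<lambda>\<tau>::real. exp (\<tau> * c)) \<longlongrightarrow> 0) at_top"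
    using assms filterlim_tendsto_neg_mult_at_bot[OF tendsto_const _ filterlim_ident, of c]
    by (intro filterlim_compose[OF exp_at_bot]) (simp add: mult.commute)
  then have "((\<lambda>\<tau>. complex_of_real (exp (\<tau> * c))) \<longlongrightarrow> complex_of_real 0) at_top"
    by (rule tendsto_of_real)
  then show ?thesis using False by (simp flip: exp_of_real)
qed simp

text \<open>
  Choose \<open>\<xi>\<close> orthogonal to the roots in \<open>S\<close> and pairing to \<open>1\<close> with the other simple roots, and move to infinity
  along the ray through \<open>\<xi>\<close>. After rescaling rows and columns the entries of \<open>B\<close> converge to sums over the
  extremal weights; columns in \<open>S\<close>, whose mirrors contain the ray, are expressed by second derivatives. In
  the limit matrix the rows outside \<open>S\<close> are diagonal, the rows in \<open>S\<close> are diagonal within the columns in \<open>S\<close>, and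
  no diagonal entry vanishes; so its determinant is not zero.
\<close>

lemma frame_det_y_nonzero:
  assumes f: "frame_matrix \<alpha> (y_coord R \<alpha> k) B"
    and S: "S \<subseteq> I" "\<And>i j. i \<in> S \<Longrightarrow> j \<in> S \<Longrightarrow> i \<noteq> j \<Longrightarrow> \<alpha> i \<bullet> \<alpha> j = 0"
  shows "\<exists>x. (\<forall>j\<in>S. cpair (\<alpha> j) x = 0) \<and> frame_det \<alpha> B x \<noteq> 0"
proof -
  let ?n = "\<ell>" and ?W = "weyl_group R"
  obtain \<xi> where "\<forall>j\<in>I. \<xi> \<bullet> \<alpha> j = (if j \<in> S then 0 else 1)"
    using dual_vector[of "\<lambda>j. if j \<in> S then 0 else 1"] by blast
  then have \<xi>: "\<alpha> j \<bullet> \<xi> = (if j \<in> S then 0 else 1)" if "j \<in> I" for j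
    using that by (simp add: inner_commute)
  have ext1: "w (fund_weight \<alpha> i) \<bullet> \<xi> \<le> fund_weight \<alpha> i \<bullet> \<xi>"
    and ext2: "w (fund_weight \<alpha> i) \<bullet> \<xi> = fund_weight \<alpha> i \<bullet> \<xi> \<Longrightarrow>
      w (fund_weight \<alpha> i) = fund_weight \<alpha> i \<or> i \<in> S \<and> w (fund_weight \<alpha> i) = fund_weight \<alpha> i - \<alpha> i"
    if "w \<in> ?W" "i \<in> I" for w i
    by (rule extremal_weights[of S]; use S \<xi> that in simp)+
  define x where "x \<tau> = complex_of_real \<tau> *s emb \<xi>" for \<tau>
  have cx: "cpair b (x \<tau>) = complex_of_real (\<tau> * (b \<bullet> \<xi>))" for b \<tau>
    by (simp add: x_def cpair_smult cpair_emb)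
  have xN: "x \<tau> $ None = 0" for \<tau> by (simp add: x_def)
  define \<omega> where "\<omega> a = fund_weight \<alpha> (Suc a)" for a
  \<comment> \<open>columns in \<open>S\<close> come from second derivatives\<close>
  define p :: "nat \<Rightarrow> nat" where "p l = (if Suc l \<in> S then 2 else 1)" for l
  define b where "b \<tau> l = (if Suc l \<in> S then complex_of_real (\<alpha> (Suc l) \<bullet> \<alpha> (Suc l)) else e_root (\<alpha> (Suc l)) (x \<tau>))" for \<tau> l
  define A where "A \<tau> = mat ?n ?n (\<lambda>(a, l). exp (complex_of_real (- (\<tau> * (\<omega> a \<bullet> \<xi>)))) * b \<tau> l * B a l (x \<tau>))" for \<tau>
  define L where "L = mat ?n ?n (\<lambda>(a, l). \<Sum>w\<in>?W. complex_of_real ((w (\<omega> a) \<bullet> \<alpha> (Suc l)) ^ p l) *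
      (if w (\<omega> a) \<bullet> \<xi> = \<omega> a \<bullet> \<xi> then 1 else 0))"
  have I: "Suc a \<in> I" if "a < ?n" for a using that by auto
  have Bsum: "b \<tau> l * B a l (x \<tau>) =
      (\<Sum>w\<in>?W. complex_of_real ((w (\<omega> a) \<bullet> \<alpha> (Suc l)) ^ p l) * exp (complex_of_real (\<tau> * (w (\<omega> a) \<bullet> \<xi>))))"
    if al: "a < ?n" "l < ?n" for \<tau> a l
  proof (cases "Suc l \<in> S")
    case True
    then have "cpair (\<alpha> (Suc l)) (x \<tau>) = 0" using \<xi>[OF I[OF al(2)]] by (simp add: cx)
    then have "b \<tau> l * B a l (x \<tau>) = dir_deriv (emb (\<alpha> (Suc l))) (dir_deriv (emb (\<alpha> (Suc l))) (y_coord R \<alpha> k (Suc a))) (x \<tau>)"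
      using mirror_second_derivative[OF f _ al(2), of a "x \<tau>" "emb (\<alpha> (Suc l))"] al True by (simp add: b_def cpair_emb)
    then show ?thesis
      unfolding y_coord_weighted_orbit[OF I[OF al(1)]] dir_deriv_weighted_orbit
      using True by (simp add: weighted_orbit_def xN cx p_def \<omega>_def power2_eq_square)
  next
    case False
    have "b \<tau> l * B a l (x \<tau>) = dir_deriv (emb (\<alpha> (Suc l))) (y_coord R \<alpha> k (Suc a)) (x \<tau>)"
      using dir_deriv_frame_vector[OF f, of a l] al False by (simp add: frame_def b_def mirror_def)
    then show ?thesis
      unfolding y_coord_weighted_orbit[OF I[OF al(1)]] dir_deriv_weighted_orbit
      using False by (simp add: weighted_orbit_def xN cx p_def \<omega>_def)
  qed
  have lim: "((\<lambda>\<tau>. A \<tau> $$ (a, l)) \<longlongrightarrow> L $$ (a, l)) at_top" if al: "a < ?n" "l < ?n" for a l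
  proof -
    have "A \<tau> $$ (a, l) = (\<Sum>w\<in>?W. complex_of_real ((w (\<omega> a) \<bullet> \<alpha> (Suc l)) ^ p l) *
        exp (complex_of_real (\<tau> * (w (\<omega> a) \<bullet> \<xi> - \<omega> a \<bullet> \<xi>))))" for \<tau>
    proof -
      have "A \<tau> $$ (a, l) = exp (complex_of_real (- (\<tau> * (\<omega> a \<bullet> \<xi>)))) * (b \<tau> l * B a l (x \<tau>))"
        using al by (simp add: A_def)
      also have "\<dots> = (\<Sum>w\<in>?W. complex_of_real ((w (\<omega> a) \<bullet> \<alpha> (Suc l)) ^ p l) *
          (exp (complex_of_real (- (\<tau> * (\<omega> a \<bullet> \<xi>)))) * exp (complex_of_real (\<tau> * (w (\<omega> a) \<bullet> \<xi>)))))"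
        unfolding Bsum[OF al] sum_distrib_left by (intro sum.cong) (simp_all add: mult_ac)
      finally show ?thesis
        unfolding exp_add[symmetric] of_real_add[symmetric] by (simp add: algebra_simps)
    qed
    moreover have "((\<lambda>\<tau>. \<Sum>w\<in>?W. complex_of_real ((w (\<omega> a) \<bullet> \<alpha> (Suc l)) ^ p l) *
        exp (complex_of_real (\<tau> * (w (\<omega> a) \<bullet> \<xi> - \<omega> a \<bullet> \<xi>)))) \<longlongrightarrow>
        (\<Sum>w\<in>?W. complex_of_real ((w (\<omega> a) \<bullet> \<alpha> (Suc l)) ^ p l) *
          (if w (\<omega> a) \<bullet> \<xi> - \<omega> a \<bullet> \<xi> = 0 then 1 else 0))) at_top"
      using ext1[OF _ I[OF al(1)]]
      by (intro tendsto_sum tendsto_mult tendsto_const exp_decay_limit) (simp add: \<omega>_def)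
    ultimately show ?thesis using al by (simp add: L_def)
  qed
  have W0: "w (\<omega> a) = \<omega> a \<or> Suc a \<in> S \<and> w (\<omega> a) = \<omega> a - \<alpha> (Suc a)"
    if "w \<in> ?W" "w (\<omega> a) \<bullet> \<xi> = \<omega> a \<bullet> \<xi>" "a < ?n" for w a
    using ext2[OF that(1) I[OF that(3)]] that(2) unfolding \<omega>_def by blast
  have \<omega>\<alpha>: "\<omega> a \<bullet> \<alpha> (Suc l) = (if a = l then \<alpha> (Suc l) \<bullet> \<alpha> (Suc l) / 2 else 0)" if "l < ?n" for a l
    unfolding \<omega>_def using weight_simple[OF I[OF that], of "Suc a"] by simp
  have off: "L $$ (a, l) = 0" if al: "a < ?n" "l < ?n" "a \<noteq> l" and "Suc a \<notin> S \<or> Suc l \<in> S" for a l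
  proof -
    have "w (\<omega> a) \<bullet> \<alpha> (Suc l) = 0" if w: "w \<in> ?W" "w (\<omega> a) \<bullet> \<xi> = \<omega> a \<bullet> \<xi>" for w
      using W0[OF w al(1)] \<omega>\<alpha>[OF al(2), of a] S(2)[of "Suc a" "Suc l"] \<open>Suc a \<notin> S \<or> Suc l \<in> S\<close> al(3)
      by (auto simp: inner_diff_left)
    then show ?thesis using al by (auto simp: L_def p_def intro!: sum.neutral)
  qed
  have diag: "L $$ (a, a) \<noteq> 0" if a: "a < ?n" for a
  proof -
    define c where "c = (\<alpha> (Suc a) \<bullet> \<alpha> (Suc a) / 2) ^ p a"
    have c: "c > 0" using simple_norm_pos[OF I[OF a]] by (simp add: c_def)
    have "complex_of_real ((w (\<omega> a) \<bullet> \<alpha> (Suc a)) ^ p a) * (if w (\<omega> a) \<bullet> \<xi> = \<omega> a \<bullet> \<xi> then 1 else 0) =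
        complex_of_real (if w (\<omega> a) \<bullet> \<xi> = \<omega> a \<bullet> \<xi> then c else 0)" if w: "w \<in> ?W" for w
    proof (cases "w (\<omega> a) \<bullet> \<xi> = \<omega> a \<bullet> \<xi>")
      case True
      have "(w (\<omega> a) \<bullet> \<alpha> (Suc a)) ^ p a = c"
      proof -
        have "w (\<omega> a) \<bullet> \<alpha> (Suc a) = \<alpha> (Suc a) \<bullet> \<alpha> (Suc a) / 2 \<or>
            Suc a \<in> S \<and> w (\<omega> a) \<bullet> \<alpha> (Suc a) = - (\<alpha> (Suc a) \<bullet> \<alpha> (Suc a) / 2)"
          using W0[OF w True a] \<omega>\<alpha>[OF a, of a] by (auto simp: inner_diff_left)
        then show ?thesis
        proof (elim disjE conjE)
          assume "w (\<omega> a) \<bullet> \<alpha> (Suc a) = \<alpha> (Suc a) \<bullet> \<alpha> (Suc a) / 2"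
          then show ?thesis by (simp only: c_def)
        next
          assume S: "Suc a \<in> S" and eq: "w (\<omega> a) \<bullet> \<alpha> (Suc a) = - (\<alpha> (Suc a) \<bullet> \<alpha> (Suc a) / 2)"
          show ?thesis unfolding c_def eq using S by (simp add: p_def)
        qed
      qed
      then show ?thesis using True by simp
    qed simp
    then have "L $$ (a, a) = complex_of_real (\<Sum>w\<in>?W. if w (\<omega> a) \<bullet> \<xi> = \<omega> a \<bullet> \<xi> then c else 0)"
      using a by (simp add: L_def)
    moreover have "(\<Sum>w\<in>?W. if w (\<omega> a) \<bullet> \<xi> = \<omega> a \<bullet> \<xi> then c else 0) > 0"
      using c by (intro sum_pos2[OF weyl_finite weyl_group.intros(1)]) auto
    ultimately show ?thesis by (simp only: of_real_eq_0_iff)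
  qed
  have Lc: "L \<in> carrier_mat ?n ?n" by (simp add: L_def)
  \<comment> \<open>a kernel vector vanishes first outside \<open>S\<close> and then, by the shape of the remaining rows, in \<open>S\<close>\<close>
  have "Determinant.det L \<noteq> 0"
  proof
    assume "Determinant.det L = 0"
    then obtain v where v: "v \<in> carrier_vec ?n" "v \<noteq> 0\<^sub>v ?n" "L *\<^sub>v v = 0\<^sub>v ?n"
      unfolding det_0_iff_vec_prod_zero[OF Lc] by blast
    have row: "(\<Sum>l<?n. L $$ (a, l) * v $v l) = 0" if a: "a < ?n" for a
    proof -
      have "(L *\<^sub>v v) $v a = (\<Sum>l<?n. L $$ (a, l) * v $v l)"
        using Lc v(1) a by (auto simp: scalar_prod_def atLeast0LessThan intro!: sum.cong)
      then show ?thesis using v(3) a by simp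
    qed
    have v1: "v $v a = 0" if a: "a < ?n" "Suc a \<notin> S" for a
    proof -
      have "(\<Sum>l<?n. L $$ (a, l) * v $v l) = (\<Sum>l<?n. if l = a then L $$ (a, a) * v $v a else 0)"
        using off[OF a(1)] a(2) by (intro sum.cong) auto
      then show ?thesis using row[OF a(1)] diag[OF a(1)] a(1) by simp
    qed
    have v2: "v $v a = 0" if a: "a < ?n" "Suc a \<in> S" for a
    proof -
      have "(\<Sum>l<?n. L $$ (a, l) * v $v l) = (\<Sum>l<?n. if l = a then L $$ (a, a) * v $v a else 0)"
        using off[OF a(1)] v1 by (intro sum.cong) auto
      then show ?thesis using row[OF a(1)] diag[OF a(1)] a(1) by simp
    qed
    have "v = 0\<^sub>v ?n" using v1 v2 v(1) by (intro eq_vecI) auto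
    then show False using v(2) by simp
  qed
  moreover have "((\<lambda>\<tau>. Determinant.det (A \<tau>)) \<longlongrightarrow> Determinant.det L) at_top"
    by (rule tendsto_det[where m = "?n"]) (use lim Lc in \<open>auto simp: A_def\<close>)
  ultimately have "\<forall>\<^sub>F \<tau> in at_top. Determinant.det (A \<tau>) \<noteq> 0"
    by (rule tendsto_imp_eventually_ne[rotated])
  then obtain \<tau> where \<tau>: "Determinant.det (A \<tau>) \<noteq> 0"
    using eventually_happens trivial_limit_at_top_linorder by blast
  have "frame_det \<alpha> B (x \<tau>) = Determinant.det (mat ?n ?n (\<lambda>(a, l). B a l (x \<tau>)))"
  proof -
    have "frame_det \<alpha> B (x \<tau>) = Determinant.det (mat ?n ?n (\<lambda>(a, l). frame_mat \<alpha> B (x \<tau>) $$ (a, l)))"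
      unfolding frame_det_def
      by (rule det_unit_last_row[OF frame_mat_carrier]) (use f in \<open>simp add: frame_matrix_def frame_mat_def\<close>)
    also have "mat ?n ?n (\<lambda>(a, l). frame_mat \<alpha> B (x \<tau>) $$ (a, l)) = mat ?n ?n (\<lambda>(a, l). B a l (x \<tau>))"
      by (intro eq_matI) (auto simp: frame_mat_def)
    finally show ?thesis .
  qed
  then have "frame_det \<alpha> B (x \<tau>) \<noteq> 0"
    using \<tau> unfolding A_def det_scale_rows_columns by auto
  moreover have "\<forall>j\<in>S. cpair (\<alpha> j) (x \<tau>) = 0" using S(1) \<xi> by (auto simp: cx)
  ultimately show ?thesis by blast
qed

section \<open>Functions with derivatives divisible by the mirrors\<close>

definition divisible_derivatives :: "(complex^('n option) \<Rightarrow> complex) \<Rightarrow> bool" where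
  "divisible_derivatives f \<longleftrightarrow> fourier_poly R f \<and>
     (\<forall>j\<in>I. \<exists>g. fourier_poly R g \<and> (\<forall>x. dir_deriv (emb (\<alpha> j)) f x = e_root (\<alpha> j) x * g x))"

text \<open>
  By the Leibniz rule the property is inherited by sums and products.
\<close>

lemma divisible_derivatives_poly_in:
  assumes "f \<in> poly_in G" "\<And>g. g \<in> G \<Longrightarrow> divisible_derivatives g"
  shows "divisible_derivatives f"
  using assms(1)
proof induction
  case (1 q)
  show ?case unfolding divisible_derivatives_def
    by (auto simp: dir_deriv_const fourier_poly_const intro!: exI[of _ "\<lambda>_. 0"])
next
  case (3 f g)
  show ?case unfolding divisible_derivatives_def
  proof (intro conjI ballI)
    show "fourier_poly R (\<lambda>x. f x + g x)"
      using 3 unfolding divisible_derivatives_def by (intro fourier_poly_add) auto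
    fix j assume "j \<in> I"
    then obtain u v where uv: "fourier_poly R u" "\<And>x. dir_deriv (emb (\<alpha> j)) f x = e_root (\<alpha> j) x * u x"
      "fourier_poly R v" "\<And>x. dir_deriv (emb (\<alpha> j)) g x = e_root (\<alpha> j) x * v x"
      using 3 unfolding divisible_derivatives_def by metis
    have "dir_deriv (emb (\<alpha> j)) (\<lambda>x. f x + g x) x = e_root (\<alpha> j) x * (u x + v x)" for x
      using 3 by (subst dir_deriv_add)
        (auto simp: divisible_derivatives_def fourier_poly_exp_sum uv distrib_left)
    then show "\<exists>h. fourier_poly R h \<and> (\<forall>x. dir_deriv (emb (\<alpha> j)) (\<lambda>x. f x + g x) x = e_root (\<alpha> j) x * h x)"
      using fourier_poly_add[OF uv(1,3)] by blast
  qed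
next
  case (4 f g)
  show ?case unfolding divisible_derivatives_def
  proof (intro conjI ballI)
    have fg: "fourier_poly R f" "fourier_poly R g" using 4 unfolding divisible_derivatives_def by auto
    then show "fourier_poly R (\<lambda>x. f x * g x)" by (rule fourier_poly_mult)
    fix j assume "j \<in> I"
    then obtain u v where uv: "fourier_poly R u" "\<And>x. dir_deriv (emb (\<alpha> j)) f x = e_root (\<alpha> j) x * u x"
      "fourier_poly R v" "\<And>x. dir_deriv (emb (\<alpha> j)) g x = e_root (\<alpha> j) x * v x"
      using 4 unfolding divisible_derivatives_def by metis
    have "dir_deriv (emb (\<alpha> j)) (\<lambda>x. f x * g x) x = e_root (\<alpha> j) x * (u x * g x + f x * v x)" for x
      using fg by (subst dir_deriv_mult) (auto simp: fourier_poly_exp_sum uv algebra_simps)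
    then show "\<exists>h. fourier_poly R h \<and> (\<forall>x. dir_deriv (emb (\<alpha> j)) (\<lambda>x. f x * g x) x = e_root (\<alpha> j) x * h x)"
      using fourier_poly_add[OF fourier_poly_mult[OF uv(1) fg(2)] fourier_poly_mult[OF fg(1) uv(3)]] by blast
  qed
qed (use assms(2) in blast)

lemma fourier_poly_exp_last:
  assumes "d \<in> \<rat>" shows "fourier_poly R (\<lambda>x. exp (complex_of_real d * x $ None))"
proof -
  obtain a b where ab: "b > 0" "d = of_int a / of_int b"
    using Rats_cases'[OF assms] by metis
  have eq: "(\<lambda>x. exp (complex_of_real d * x $ None)) = fourier_exp 0 a (nat b)"
    using ab by (auto simp: fourier_exp_def fun_eq_iff)
  show ?thesis
    unfolding eq by (rule fourier_poly_exp[OF weight_lattice_zero]) (use ab in simp)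
qed

lemma dir_deriv_exp_last: "dir_deriv (emb b) (\<lambda>x. exp (c * x $ None)) x = 0"
proof -
  have "(\<lambda>x. exp (c * x $ None)) = (\<lambda>x. exp (bil (axis None c) x))" by simp
  then show ?thesis using dir_deriv_exp[of "emb b" "axis None c" x] by simp
qed

lemma divisible_derivatives_exp_last:
  "d \<in> \<rat> \<Longrightarrow> divisible_derivatives (\<lambda>x. exp (complex_of_real d * x $ None))"
  unfolding divisible_derivatives_def
  by (auto simp: dir_deriv_exp_last fourier_poly_const fourier_poly_exp_last intro!: exI[of _ "\<lambda>_. 0"])

lemma divisible_derivatives_y:
  assumes "i \<in> I" "dz_degree \<alpha> k i \<in> \<rat>"
  shows "divisible_derivatives (y_coord R \<alpha> k i)"
proof -
  let ?E = "\<lambda>x. exp (complex_of_real (dz_degree \<alpha> k i) * x $ None)"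
  have orb: "fourier_poly R (orbit_sum R \<alpha> i)"
  proof -
    have "orbit_sum R \<alpha> i = (\<lambda>x. \<Sum>w\<in>weyl_group R. fourier_exp (w (fund_weight \<alpha> i)) 0 1 x)"
      by (auto simp: orbit_sum_def fourier_exp_def)
    then show ?thesis
      using weight_orbit_lattice[OF assms(1)] by (simp add: fourier_poly_sum fourier_poly_exp)
  qed
  have "divisible_derivatives (orbit_sum R \<alpha> i)"
    unfolding divisible_derivatives_def
    using orb orbit_derivative_divisible[OF simple_R assms(1)] by blast
  moreover have "divisible_derivatives ?E" using divisible_derivatives_exp_last assms(2) .
  moreover have "(\<lambda>x. ?E x * orbit_sum R \<alpha> i x) \<in> poly_in {?E, orbit_sum R \<alpha> i}"
    by (intro poly_in.intros) auto
  ultimately have "divisible_derivatives (\<lambda>x. ?E x * orbit_sum R \<alpha> i x)"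
    by (elim divisible_derivatives_poly_in) auto
  moreover have "y_coord R \<alpha> k i = (\<lambda>x. ?E x * orbit_sum R \<alpha> i x)"
    using assms(1) by (auto simp: y_coord_def)
  ultimately show ?thesis by simp
qed

end

section \<open>Inverse matrices depending on a point\<close>

lemma matrix_inv_eqI:
  fixes A B :: "'a::field^'m^'m"
  assumes "A ** B = Finite_Cartesian_Product.mat 1"
  shows "matrix_inv A = B"
proof -
  have BA: "B ** A = Finite_Cartesian_Product.mat 1"
    using assms by (simp add: matrix_left_right_inverse)
  have "A ** matrix_inv A = Finite_Cartesian_Product.mat 1 \<and> matrix_inv A ** A = Finite_Cartesian_Product.mat 1"
    unfolding matrix_inv_def by (rule someI[of _ B]) (simp add: assms BA)
  then have "B ** (A ** matrix_inv A) = B" by simp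
  then show ?thesis by (simp add: matrix_mul_assoc BA)
qed

lemma matrix_inv_right:
  fixes A :: "'a::field^'m^'m"
  assumes "invertible A" shows "A ** matrix_inv A = Finite_Cartesian_Product.mat 1"
proof -
  obtain B where B: "A ** B = Finite_Cartesian_Product.mat 1" using assms unfolding invertible_def by blast
  then show ?thesis using matrix_inv_eqI[OF B] by simp
qed

lemma tendsto_matrix_det:
  fixes A :: "'b \<Rightarrow> complex^'m^'m"
  assumes "\<And>i j. ((\<lambda>z. A z $ i $ j) \<longlongrightarrow> L $ i $ j) F"
  shows "((\<lambda>z. Determinants.det (A z)) \<longlongrightarrow> Determinants.det L) F"
  unfolding Determinants.det_def by (intro tendsto_sum tendsto_mult tendsto_const tendsto_prod assms)

text \<open>
  By Cramer's rule the entries of the inverse are quotients of determinants.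
\<close>

lemma tendsto_matrix_inv:
  fixes A :: "'b \<Rightarrow> complex^'m^'m"
  assumes A: "(A \<longlongrightarrow> L) F" and L: "invertible L"
  shows "((\<lambda>z. matrix_inv (A z)) \<longlongrightarrow> matrix_inv L) F"
proof -
  have entry: "((\<lambda>z. A z $ i $ j) \<longlongrightarrow> L $ i $ j) F" for i j
    by (intro tendsto_vec_nth A)
  define adj :: "complex^'m^'m \<Rightarrow> 'm \<Rightarrow> 'm \<Rightarrow> complex" where
    "adj M i j = Determinants.det (\<chi> p q. if q = i then axis j 1 $ p else M $ p $ q)" for M i j
  have inv: "matrix_inv M $ i $ j = adj M i j / Determinants.det M" if "Determinants.det M \<noteq> 0" for M i j
  proof -
    have "M *v (matrix_inv M *v axis j 1) = axis j 1"
      using matrix_inv_right[of M] that by (simp add: invertible_det_nz matrix_vector_mul_assoc)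
    then have "(matrix_inv M *v axis j 1) $ i = adj M i j / Determinants.det M"
      using cramer[OF that, of "matrix_inv M *v axis j 1" "axis j 1"] by (simp add: adj_def)
    moreover have "(matrix_inv M *v axis j 1) $ i = matrix_inv M $ i $ j"
      by (simp add: matrix_vector_mult_def axis_def if_distrib[of "\<lambda>u. _ * u"] cong: if_cong)
    ultimately show ?thesis by simp
  qed
  have dL: "Determinants.det L \<noteq> 0" using L by (simp add: invertible_det_nz)
  have det: "((\<lambda>z. Determinants.det (A z)) \<longlongrightarrow> Determinants.det L) F"
    by (rule tendsto_matrix_det[OF entry])
  show ?thesis
  proof (intro vec_tendstoI)
    fix i j
    have "((\<lambda>z. adj (A z) i j / Determinants.det (A z)) \<longlongrightarrow> adj L i j / Determinants.det L) F"
      unfolding adj_def by (intro tendsto_divide tendsto_matrix_det det dL) (auto intro: entry)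
    then show "((\<lambda>z. matrix_inv (A z) $ i $ j) \<longlongrightarrow> matrix_inv L $ i $ j) F"
      unfolding inv[OF dL]
      by (rule Lim_transform_eventually)
         (use tendsto_imp_eventually_ne[OF det dL] in eventually_elim, simp add: inv)
  qed
qed

lemma tendsto_matrix_mult:
  fixes A B :: "'b \<Rightarrow> complex^'m^'m"
  assumes "(A \<longlongrightarrow> L) F" "(B \<longlongrightarrow> M) F"
  shows "((\<lambda>z. A z ** B z) \<longlongrightarrow> L ** M) F"
  unfolding matrix_matrix_mult_def
  by (intro tendsto_vec_lambda tendsto_sum tendsto_mult tendsto_vec_nth assms)

text \<open>
  The points of \<open>U\<close> at which \<open>G\<close> is invertible form a subset on which \<open>H\<close> is its inverse; by continuity this subset
  is closed in \<open>U\<close>. If it were not all of \<open>U\<close>, then \<open>G\<close> would be degenerate on an open set. There the formal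
  inverse has one fixed value, so \<open>H\<close> would be constant on that open set and hence, as its entries are
  exponential sums, everywhere. But \<open>H\<close> is invertible at some points and not at others.
\<close>

lemma inverse_by_continuity:
  fixes G H :: "complex^'m \<Rightarrow> complex^'k^'k"
  assumes U: "open U" and G: "continuous_on U G"
    and H: "continuous_on UNIV H" "\<And>i j. exp_sum (\<lambda>z. H z $ i $ j)"
    and lim: "\<And>z. z \<in> U \<Longrightarrow> Lim (at z within U) (\<lambda>z. matrix_inv (G z)) = H z"
    and inv: "\<And>z. z \<in> U \<Longrightarrow> invertible (H z)" and sing: "\<not> invertible (H x0)"
    and z: "z \<in> U"
  shows "G z ** H z = Finite_Cartesian_Product.mat 1"
proof -
  have nontriv: "at z within U \<noteq> bot" if "z \<in> U" for z
    using at_within_open[OF that U] at_neq_bot[of z] by metis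
  have Gt: "(G \<longlongrightarrow> G z) (at z within U)" if "z \<in> U" for z
    using G that unfolding continuous_on_def by blast
  have one: "G z ** H z = Finite_Cartesian_Product.mat 1" if z: "z \<in> U" "invertible (G z)" for z
  proof -
    have eq: "H z = matrix_inv (G z)"
      using lim[OF z(1)] tendsto_Lim[OF nontriv[OF z(1)] tendsto_matrix_inv[OF Gt[OF z(1)] z(2)]] by (rule trans[OF sym])
    show ?thesis unfolding eq by (rule matrix_inv_right[OF z(2)])
  qed
  have "invertible (G z)"
  proof (rule ccontr)
    assume nz: "\<not> invertible (G z)"
    have "\<exists>V. open V \<and> z \<in> V \<and> V \<subseteq> U \<and> (\<forall>y\<in>V. \<not> invertible (G y))"
    proof (rule ccontr)
      assume no: "\<not> ?thesis"
      let ?U1 = "{y \<in> U. invertible (G y)}"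
      have "z islimpt ?U1"
        unfolding islimpt_def
      proof (intro allI impI)
        fix T assume T: "z \<in> T" "open T"
        have "open (T \<inter> U)" "z \<in> T \<inter> U" "T \<inter> U \<subseteq> U" using T U z by auto
        then obtain y where "y \<in> T \<inter> U" "invertible (G y)" using no by blast
        then show "\<exists>y\<in>?U1. y \<in> T \<and> y \<noteq> z" using nz by auto
      qed
      then have nt: "at z within ?U1 \<noteq> bot" by (simp add: trivial_limit_within)
      have "((\<lambda>y. G y ** H y) \<longlongrightarrow> G z ** H z) (at z within ?U1)"
      proof (rule tendsto_matrix_mult)
        show "(G \<longlongrightarrow> G z) (at z within ?U1)" by (rule tendsto_within_subset[OF Gt[OF z]]) auto
        show "(H \<longlongrightarrow> H z) (at z within ?U1)"
          by (rule tendsto_within_subset[of _ _ _ UNIV]) (use H(1) in \<open>auto simp: continuous_on_def\<close>)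
      qed
      moreover have "((\<lambda>y. G y ** H y) \<longlongrightarrow> Finite_Cartesian_Product.mat 1) (at z within ?U1)"
        by (rule Lim_transform_eventually[OF tendsto_const]) (auto simp: eventually_at_filter one)
      ultimately have "G z ** H z = Finite_Cartesian_Product.mat 1" by (rule tendsto_unique[OF nt])
      then show False using nz by (metis invertible_def matrix_left_right_inverse)
    qed
    then obtain V where V: "open V" "z \<in> V" "V \<subseteq> U" "\<And>y. y \<in> V \<Longrightarrow> \<not> invertible (G y)" by blast
    \<comment> \<open>for a matrix without inverse the choice operator ranges over the empty predicate\<close>
    define K where "K = (SOME A' :: complex^'k^'k. False)"
    have K: "matrix_inv (G y) = K" if "y \<in> V" for y
    proof -
      have "(\<lambda>A'. G y ** A' = Finite_Cartesian_Product.mat 1 \<and> A' ** G y = Finite_Cartesian_Product.mat 1) = (\<lambda>_. False)"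
        using V(4)[OF that] unfolding invertible_def by blast
      then show ?thesis unfolding matrix_inv_def K_def by (rule arg_cong)
    qed
    have HK: "H y = K" if y: "y \<in> V" for y
    proof -
      have "\<forall>\<^sub>F y' in at y within U. matrix_inv (G y') = K"
        using K V(1) y by (auto simp: eventually_at_topological)
      then have "((\<lambda>z. matrix_inv (G z)) \<longlongrightarrow> K) (at y within U)" by (simp add: tendsto_eventually)
      then have "Lim (at y within U) (\<lambda>z. matrix_inv (G z)) = K"
        by (rule tendsto_Lim[rotated]) (use nontriv y V(3) in blast)
      then show ?thesis using lim[of y] y V(3) by (metis subsetD)
    qed
    have "H x0 $ i $ j = K $ i $ j" for i j
    proof (rule ccontr)
      assume "H x0 $ i $ j \<noteq> K $ i $ j"
      then have "\<exists>y\<in>V. H y $ i $ j - K $ i $ j \<noteq> 0 \<and> y \<noteq> z"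
        by (intro exp_sum_dense[of _ x0] exp_sum_diff exp_sum_const H V) auto
      then obtain y where "y \<in> V" "H y $ i $ j - K $ i $ j \<noteq> 0" by blast
      then show False using HK[of y] by simp
    qed
    then have "H x0 = H z" using HK[OF V(2)] by (simp add: Finite_Cartesian_Product.vec_eq_iff)
    then show False using sing inv[OF z] by metis
  qed
  then show ?thesis using one z by blast
qed

section \<open>The contravariant metric in the frame\<close>

lemma has_deriv_quotient:
  assumes "exp_sum f" "exp_sum g" "g x \<noteq> 0"
  shows "((\<lambda>s. f (x + s *s v) / g (x + s *s v)) has_field_derivative
    (dir_deriv v f x * g x - f x * dir_deriv v g x) / (g x)\<^sup>2) (at 0)"
  using exp_sum_has_deriv[OF assms(1), of x v 0] exp_sum_has_deriv[OF assms(2), of x v 0] assms(3)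
  by (auto intro!: derivative_eq_intros simp: power2_eq_square)

definition coframe :: "(nat \<Rightarrow> real^'n) \<Rightarrow> nat \<Rightarrow> complex^('n option)" where
  "coframe \<alpha> l = (if l < CARD('n) then emb (fund_coweight \<alpha> (Suc l)) else axis None 1)"

definition gamma_inv :: "(nat \<Rightarrow> real^'n) \<Rightarrow> nat \<Rightarrow> 'n option \<Rightarrow> complex" where
  "gamma_inv \<alpha> k c = (case c of None \<Rightarrow> - (1 / complex_of_real (dz_degree \<alpha> k k)) | Some _ \<Rightarrow> 1)"

text \<open>
  The direction that the constant form \<open>\<gamma>\<close> associates with the \<open>l\<close>-th linear coordinate.
\<close>

definition gamma_dual :: "(nat \<Rightarrow> real^'n) \<Rightarrow> nat \<Rightarrow> nat \<Rightarrow> complex^('n option)" where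
  "gamma_dual \<alpha> k l = (\<chi> c. gamma_inv \<alpha> k c * coframe \<alpha> l $ c)"

text \<open>
  Coefficients of the coordinate vector field of row \<open>k\<close> in the frame, by \<open>coord_field_cofactor\<close>.
\<close>

definition field_coeff where
  "field_coeff \<alpha> B k l x = frame_cofactor \<alpha> B k l x / (mirror \<alpha> l x * frame_det \<alpha> B x)"

definition field_coeff_deriv where
  "field_coeff_deriv \<alpha> B k l v x =
     (dir_deriv v (frame_cofactor \<alpha> B k l) x * (mirror \<alpha> l x * frame_det \<alpha> B x) -
      frame_cofactor \<alpha> B k l x * dir_deriv v (\<lambda>x. mirror \<alpha> l x * frame_det \<alpha> B x) x) /
     (mirror \<alpha> l x * frame_det \<alpha> B x)\<^sup>2"

lemma matrix_inv_gamma: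
  assumes "dz_degree \<alpha> k k \<noteq> 0"
  shows "matrix_inv (gamma_form \<alpha> k) = (\<chi> a b. if a = b then gamma_inv \<alpha> k a else 0)"
proof (rule matrix_inv_eqI)
  have "(\<Sum>c\<in>UNIV. gamma_form \<alpha> k $ a $ c * (if c = b then gamma_inv \<alpha> k c else 0)) = (if a = b then 1 else 0)" for a b
    using assms by (auto simp: gamma_form_def gamma_inv_def if_distrib[of "\<lambda>u. _ * u"] cong: if_cong split: option.splits)
  then show "gamma_form \<alpha> k ** (\<chi> a b. if a = b then gamma_inv \<alpha> k a else 0) = Finite_Cartesian_Product.mat 1"
    by (simp add: matrix_matrix_mult_def Finite_Cartesian_Product.mat_def Finite_Cartesian_Product.vec_eq_iff)
qed

context root_data
begin

lemma lin_coord_coframe: "l \<le> \<ell> \<Longrightarrow> lin_coord \<alpha> (Suc l) v = bil (coframe \<alpha> l) v"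
  by (auto simp: lin_coord_def coframe_def cpair_bil)

lemma coframe_frame_sum: "(\<Sum>l\<le>\<ell>. coframe \<alpha> l $ b * frame \<alpha> l $ c) = (if b = c then 1 else 0)"
proof -
  have "(axis b 1 :: complex^('n option)) $ c = (\<Sum>l\<le>\<ell>. lin_coord \<alpha> (Suc l) (axis b 1) * frame \<alpha> l $ c)"
    by (subst frame_expansion[of "axis b 1"]) (simp add: sum_component)
  also have "\<dots> = (\<Sum>l\<le>\<ell>. coframe \<alpha> l $ b * frame \<alpha> l $ c)"
  proof (rule sum.cong)
    fix l assume "l \<in> {..\<ell>}"
    then have "lin_coord \<alpha> (Suc l) (axis b 1) = coframe \<alpha> l $ b"
      by (simp add: lin_coord_coframe bil_def axis_def if_distrib[of "\<lambda>u. _ * u"] cong: if_cong)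
    then show "lin_coord \<alpha> (Suc l) (axis b 1) * frame \<alpha> l $ c = coframe \<alpha> l $ b * frame \<alpha> l $ c" by simp
  qed simp
  finally show ?thesis by (auto simp: axis_def)
qed

lemma coframe_frame:
  assumes "l \<le> \<ell>" "m \<le> \<ell>"
  shows "(\<Sum>c\<in>UNIV. coframe \<alpha> l $ c * frame \<alpha> m $ c) = (if l = m then 1 else 0)"
  using lin_coord_frame[OF assms] lin_coord_coframe[OF assms(1), of "frame \<alpha> m"] by (simp add: bil_def)

lemma field_coeff_deriv_linear:
  assumes B: "frame_matrix \<alpha> f B" and kl: "k \<le> \<ell>" "l \<le> \<ell>"
  shows "field_coeff_deriv \<alpha> B k l (\<Sum>i\<in>S. c i *s w i) x = (\<Sum>i\<in>S. c i * field_coeff_deriv \<alpha> B k l (w i) x)"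
proof -
  have e: "exp_sum (\<lambda>x. mirror \<alpha> l x * frame_det \<alpha> B x)"
    by (intro exp_sum_mult exp_sum_mirror exp_sum_frame_det[OF B])
  show ?thesis
    unfolding field_coeff_deriv_def exp_sum_dir_deriv_linear[OF e]
      exp_sum_dir_deriv_linear[OF exp_sum_frame_cofactor[OF B kl]]
    by (simp add: sum_distrib_left sum_distrib_right sum_divide_distrib sum_subtractf[symmetric] algebra_simps)
qed

lemma field_coeff_has_deriv:
  assumes B: "frame_matrix \<alpha> f B" and kl: "k \<le> \<ell>" "l \<le> \<ell>"
    and nz: "mirror \<alpha> l x \<noteq> 0" "frame_det \<alpha> B x \<noteq> 0"
  shows "((\<lambda>s. field_coeff \<alpha> B k l (x + s *s v)) has_field_derivative field_coeff_deriv \<alpha> B k l v x) (at 0)"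
  unfolding field_coeff_def field_coeff_deriv_def
  by (rule has_deriv_quotient[of "frame_cofactor \<alpha> B k l" "\<lambda>x. mirror \<alpha> l x * frame_det \<alpha> B x"])
     (use nz in \<open>auto intro: exp_sum_frame_cofactor[OF B kl] exp_sum_mult exp_sum_mirror exp_sum_frame_det[OF B]\<close>)

text \<open>
  The form \<open>\<gamma>\<close> is constant, so only the derivatives of the vector field contribute to the Lie derivative.
\<close>

lemma saito_contra_entry:
  assumes B: "frame_matrix \<alpha> f B" and k: "k' \<le> \<ell>" and d: "dz_degree \<alpha> k k \<noteq> 0"
    and U: "open U" "x \<in> U"
    and E: "\<And>z. z \<in> U \<Longrightarrow> e_field R \<alpha> k \<kappa> z = (\<Sum>l\<le>\<ell>. (\<kappa>' * field_coeff \<alpha> B k' l z) *s frame \<alpha> l)"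
    and nz: "\<And>z l. z \<in> U \<Longrightarrow> l \<le> \<ell> \<Longrightarrow> mirror \<alpha> l z \<noteq> 0" "\<And>z. z \<in> U \<Longrightarrow> frame_det \<alpha> B z \<noteq> 0"
  shows "saito_contra R \<alpha> k \<kappa> x $ a $ b =
    - (gamma_inv \<alpha> k b * (\<Sum>l\<le>\<ell>. \<kappa>' * field_coeff_deriv \<alpha> B k' l (axis b 1) x * frame \<alpha> l $ a))
    - (gamma_inv \<alpha> k a * (\<Sum>l\<le>\<ell>. \<kappa>' * field_coeff_deriv \<alpha> B k' l (axis a 1) x * frame \<alpha> l $ b))"
proof -
  have der: "dir_deriv v (\<lambda>z. e_field R \<alpha> k \<kappa> z $ c) x =
      (\<Sum>l\<le>\<ell>. \<kappa>' * field_coeff_deriv \<alpha> B k' l v x * frame \<alpha> l $ c)" for v c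
  proof (rule has_deriv_imp_dir_deriv)
    have ev: "\<forall>\<^sub>F s in nhds 0. x + s *s v \<in> U"
      using topological_tendstoD[OF smult_tendsto U, of v] U(2)
      by (auto simp: eventually_at_filter elim: eventually_mono)
    have "\<forall>\<^sub>F s in nhds 0. e_field R \<alpha> k \<kappa> (x + s *s v) $ c =
        (\<Sum>l\<le>\<ell>. \<kappa>' * field_coeff \<alpha> B k' l (x + s *s v) * frame \<alpha> l $ c)"
      using ev by eventually_elim (simp add: E sum_component)
    then have "((\<lambda>s. e_field R \<alpha> k \<kappa> (x + s *s v) $ c) has_field_derivative
        (\<Sum>l\<le>\<ell>. \<kappa>' * field_coeff_deriv \<alpha> B k' l v x * frame \<alpha> l $ c)) (at 0) \<longleftrightarrow>
      ((\<lambda>s. \<Sum>l\<le>\<ell>. \<kappa>' * field_coeff \<alpha> B k' l (x + s *s v) * frame \<alpha> l $ c) has_field_derivative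
        (\<Sum>l\<le>\<ell>. \<kappa>' * field_coeff_deriv \<alpha> B k' l v x * frame \<alpha> l $ c)) (at 0)"
      by (intro DERIV_cong_ev) auto
    moreover have "((\<lambda>s. \<Sum>l\<le>\<ell>. \<kappa>' * field_coeff \<alpha> B k' l (x + s *s v) * frame \<alpha> l $ c) has_field_derivative
        (\<Sum>l\<le>\<ell>. \<kappa>' * field_coeff_deriv \<alpha> B k' l v x * frame \<alpha> l $ c)) (at 0)"
    proof (rule DERIV_sum)
      fix l assume l: "l \<in> {..\<ell>}"
      have "((\<lambda>s. field_coeff \<alpha> B k' l (x + s *s v)) has_field_derivative field_coeff_deriv \<alpha> B k' l v x) (at 0)"
        using l by (intro field_coeff_has_deriv[OF B k] nz U) auto
      then show "((\<lambda>s. \<kappa>' * field_coeff \<alpha> B k' l (x + s *s v) * frame \<alpha> l $ c) has_field_derivative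
          \<kappa>' * field_coeff_deriv \<alpha> B k' l v x * frame \<alpha> l $ c) (at 0)"
        by (intro DERIV_cmult_right DERIV_cmult)
    qed
    ultimately show "((\<lambda>s. e_field R \<alpha> k \<kappa> (x + s *s v) $ c) has_field_derivative
        (\<Sum>l\<le>\<ell>. \<kappa>' * field_coeff_deriv \<alpha> B k' l v x * frame \<alpha> l $ c)) (at 0)" by blast
  qed
  have s1: "(\<Sum>c\<in>UNIV. (if c = b then gamma_inv \<alpha> k c else 0) * F c) = gamma_inv \<alpha> k b * F b"
    and s2: "(\<Sum>c\<in>UNIV. (if a = c then gamma_inv \<alpha> k a else 0) * F c) = gamma_inv \<alpha> k a * F a" for F :: "'n option \<Rightarrow> complex"
    by (simp_all add: if_distrib[of "\<lambda>u. u * _"] cong: if_cong)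
  show ?thesis
    unfolding saito_contra_def lie_contra_def matrix_inv_gamma[OF d]
    by (simp add: dir_deriv_const der s1 s2)
qed

text \<open>
  In linear coordinates the contravariant metric is minus the symmetrised gradient of the vector field.
  Contraction with the coframe selects single coefficients of the field, as frame and coframe are dual.
\<close>

lemma saito_contra_coframe:
  assumes B: "frame_matrix \<alpha> f B" and k: "k' \<le> \<ell>" and d: "dz_degree \<alpha> k k \<noteq> 0"
    and U: "open U" "x \<in> U"
    and E: "\<And>z. z \<in> U \<Longrightarrow> e_field R \<alpha> k \<kappa> z = (\<Sum>l\<le>\<ell>. (\<kappa>' * field_coeff \<alpha> B k' l z) *s frame \<alpha> l)"
    and nz: "\<And>z l. z \<in> U \<Longrightarrow> l \<le> \<ell> \<Longrightarrow> mirror \<alpha> l z \<noteq> 0" "\<And>z. z \<in> U \<Longrightarrow> frame_det \<alpha> B z \<noteq> 0"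
    and jl: "j \<le> \<ell>" "l \<le> \<ell>"
  shows "(\<Sum>a\<in>UNIV. \<Sum>b\<in>UNIV. coframe \<alpha> j $ a * saito_contra R \<alpha> k \<kappa> x $ a $ b * coframe \<alpha> l $ b) =
    - \<kappa>' * (field_coeff_deriv \<alpha> B k' j (gamma_dual \<alpha> k l) x + field_coeff_deriv \<alpha> B k' l (gamma_dual \<alpha> k j) x)"
proof -
  let ?D = "\<lambda>m v. field_coeff_deriv \<alpha> B k' m v x"
  have lin: "?D m (gamma_dual \<alpha> k i) = (\<Sum>b\<in>UNIV. gamma_inv \<alpha> k b * coframe \<alpha> i $ b * ?D m (axis b 1))"
    if "m \<le> \<ell>" for m i
  proof -
    have "gamma_dual \<alpha> k i = (\<Sum>b\<in>UNIV. (gamma_inv \<alpha> k b * coframe \<alpha> i $ b) *s axis b 1)"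
      using basis_expansion[of "gamma_dual \<alpha> k i"] by (simp add: gamma_dual_def)
    then show ?thesis by (simp only: field_coeff_deriv_linear[OF B k that])
  qed
  have contract: "(\<Sum>a\<in>UNIV. coframe \<alpha> j $ a * (\<Sum>m\<le>\<ell>. \<kappa>' * ?D m v * frame \<alpha> m $ a)) = \<kappa>' * ?D j v"
    if j: "j \<le> \<ell>" for v j
  proof -
    have "(\<Sum>a\<in>UNIV. coframe \<alpha> j $ a * (\<Sum>m\<le>\<ell>. \<kappa>' * ?D m v * frame \<alpha> m $ a)) =
        (\<Sum>a\<in>UNIV. \<Sum>m\<le>\<ell>. \<kappa>' * ?D m v * (coframe \<alpha> j $ a * frame \<alpha> m $ a))"
      by (simp add: sum_distrib_left mult_ac)
    also have "\<dots> = (\<Sum>m\<le>\<ell>. \<Sum>a\<in>UNIV. \<kappa>' * ?D m v * (coframe \<alpha> j $ a * frame \<alpha> m $ a))"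
      by (rule sum.swap)
    also have "\<dots> = (\<Sum>m\<le>\<ell>. \<kappa>' * ?D m v * (if j = m then 1 else 0))"
      unfolding sum_distrib_left[symmetric] using coframe_frame[OF j] by (intro sum.cong) auto
    also have "\<dots> = \<kappa>' * ?D j v"
      using j by (simp add: if_distrib[of "\<lambda>u. _ * u"] cong: if_cong)
    finally show ?thesis .
  qed
  have first: "(\<Sum>b\<in>UNIV. \<Sum>a\<in>UNIV. coframe \<alpha> j $ a * (gamma_inv \<alpha> k b * (\<Sum>m\<le>\<ell>. \<kappa>' * ?D m (axis b 1) * frame \<alpha> m $ a)) * coframe \<alpha> l $ b)
      = \<kappa>' * ?D j (gamma_dual \<alpha> k l)" if jl: "j \<le> \<ell>" "l \<le> \<ell>" for j l
  proof -
    have "(\<Sum>a\<in>UNIV. coframe \<alpha> j $ a * (gamma_inv \<alpha> k b * (\<Sum>m\<le>\<ell>. \<kappa>' * ?D m (axis b 1) * frame \<alpha> m $ a)) * coframe \<alpha> l $ b)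
        = gamma_inv \<alpha> k b * coframe \<alpha> l $ b * (\<kappa>' * ?D j (axis b 1))" for b
      unfolding contract[OF jl(1), symmetric] sum_distrib_left[of "gamma_inv \<alpha> k b * coframe \<alpha> l $ b"]
      by (intro sum.cong) (simp_all add: mult_ac)
    then show ?thesis by (simp add: lin[OF jl(1)] sum_distrib_left mult_ac)
  qed
  have alg: "p * (- X - Y) * q = - (p * X * q) - q * Y * p" for p q X Y :: complex
    by (simp add: algebra_simps)
  have ent: "saito_contra R \<alpha> k \<kappa> x $ a $ b =
    - (gamma_inv \<alpha> k b * (\<Sum>m\<le>\<ell>. \<kappa>' * ?D m (axis b 1) * frame \<alpha> m $ a))
    - (gamma_inv \<alpha> k a * (\<Sum>m\<le>\<ell>. \<kappa>' * ?D m (axis a 1) * frame \<alpha> m $ b))" for a b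
    by (rule saito_contra_entry[OF B k d U]) (fact E, fact nz(1), fact nz(2))
  have "(\<Sum>a\<in>UNIV. \<Sum>b\<in>UNIV. coframe \<alpha> j $ a * saito_contra R \<alpha> k \<kappa> x $ a $ b * coframe \<alpha> l $ b) =
     - (\<Sum>a\<in>UNIV. \<Sum>b\<in>UNIV. coframe \<alpha> j $ a * (gamma_inv \<alpha> k b * (\<Sum>m\<le>\<ell>. \<kappa>' * ?D m (axis b 1) * frame \<alpha> m $ a)) * coframe \<alpha> l $ b)
     - (\<Sum>a\<in>UNIV. \<Sum>b\<in>UNIV. coframe \<alpha> l $ b * (gamma_inv \<alpha> k a * (\<Sum>m\<le>\<ell>. \<kappa>' * ?D m (axis a 1) * frame \<alpha> m $ b)) * coframe \<alpha> j $ a)"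
    unfolding ent alg sum_subtractf sum_negf ..
  also have "\<dots> = - (\<kappa>' * ?D j (gamma_dual \<alpha> k l)) - \<kappa>' * ?D l (gamma_dual \<alpha> k j)"
    using first[OF jl] first[OF jl(2,1)]
    by (subst sum.swap) simp
  finally show ?thesis by (simp add: algebra_simps)
qed

end

section \<open>The covariant metric\<close>

text \<open>
  The constant antidiagonal form in the coordinates \<open>t\<close>.
\<close>

definition cov_metric ::
   "(nat \<Rightarrow> complex^(('n::finite) option) \<Rightarrow> complex) \<Rightarrow> complex \<Rightarrow> complex^('n option) \<Rightarrow> complex^('n option) \<Rightarrow> complex^('n option) \<Rightarrow> complex" where
  "cov_metric t c x u v = c * (\<Sum>a\<le>CARD('n). dir_deriv u (t (Suc a)) x * dir_deriv v (t (Suc (CARD('n) - a))) x)"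

definition cov_matrix ::
   "(nat \<Rightarrow> complex^(('n::finite) option) \<Rightarrow> complex) \<Rightarrow> complex \<Rightarrow> complex^('n option) \<Rightarrow> complex^('n option)^('n option)" where
  "cov_matrix t c x = (\<chi> i j. cov_metric t c x (axis i 1) (axis j 1))"

text \<open>
  The same form evaluated on the frame vectors divided by their mirror factors; it remains regular on the
  mirrors.
\<close>

definition frame_gram ::
   "(nat \<Rightarrow> nat \<Rightarrow> complex^(('n::finite) option) \<Rightarrow> complex) \<Rightarrow> complex \<Rightarrow> complex^('n option) \<Rightarrow> complex mat" where
  "frame_gram B c x = mat (Suc CARD('n)) (Suc CARD('n))
     (\<lambda>(j, l). c * (\<Sum>a\<le>CARD('n). B a j x * B (CARD('n) - a) l x))"

definition regular_points ::
   "(nat \<Rightarrow> real^'n) \<Rightarrow> (nat \<Rightarrow> nat \<Rightarrow> complex^('n option) \<Rightarrow> complex) \<Rightarrow> (complex^('n option)) set" where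
  "regular_points \<alpha> B = {z. mirror_product \<alpha> z * frame_det \<alpha> B z \<noteq> 0}"

lemma regular_points_nonzero:
  fixes \<alpha> :: "nat \<Rightarrow> real^'n"
  assumes "z \<in> regular_points \<alpha> B"
  shows "frame_det \<alpha> B z \<noteq> 0" "l \<le> CARD('n) \<Longrightarrow> mirror \<alpha> l z \<noteq> 0"
  using assms by (auto simp: regular_points_def mirror_product_def less_Suc_eq_le simp del: lessThan_Suc prod.lessThan_Suc)

lemma open_regular_points:
  assumes "frame_matrix \<alpha> f B" shows "open (regular_points \<alpha> B)"
proof -
  have "exp_sum (\<lambda>z. mirror_product \<alpha> z * frame_det \<alpha> B z)"
    by (intro exp_sum_mult exp_sum_mirror_product exp_sum_frame_det[OF assms])
  then have "open ((\<lambda>z. mirror_product \<alpha> z * frame_det \<alpha> B z) -` (- {0}))"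
    by (intro open_vimage exp_sum_continuous) auto
  moreover have "(\<lambda>z. mirror_product \<alpha> z * frame_det \<alpha> B z) -` (- {0}) = regular_points \<alpha> B"
    by (auto simp: regular_points_def)
  ultimately show ?thesis by simp
qed

context root_data
begin

lemma cov_metric_frame:
  assumes t: "frame_matrix \<alpha> t B" and "j \<le> \<ell>" "l \<le> \<ell>"
  shows "cov_metric t c x (frame \<alpha> j) (frame \<alpha> l) = mirror \<alpha> j x * mirror \<alpha> l x * frame_gram B c x $$ (j, l)"
  using assms
  by (simp add: cov_metric_def frame_gram_def dir_deriv_frame_vector[OF t] sum_distrib_left mult_ac)

lemma cov_metric_components:
  assumes t: "frame_matrix \<alpha> t B"
  shows "cov_metric t c x u v = (\<Sum>i\<in>UNIV. \<Sum>j\<in>UNIV. u $ i * cov_matrix t c x $ i $ j * v $ j)"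
proof -
  have e: "dir_deriv w (t (Suc a)) x = (\<Sum>i\<in>UNIV. w $ i * dir_deriv (axis i 1) (t (Suc a)) x)"
    if "a \<le> \<ell>" for w a
    by (subst basis_expansion[of w, symmetric]) (rule frame_matrix_linear[OF t that])
  have "cov_metric t c x u v = (\<Sum>a\<le>\<ell>. \<Sum>i\<in>UNIV. \<Sum>j\<in>UNIV.
      u $ i * (c * (dir_deriv (axis i 1) (t (Suc a)) x * dir_deriv (axis j 1) (t (Suc (\<ell> - a))) x)) * v $ j)"
    unfolding cov_metric_def sum_distrib_left
  proof (rule sum.cong)
    fix a assume "a \<in> {..\<ell>}"
    then have a: "a \<le> \<ell>" "\<ell> - a \<le> \<ell>" by auto
    show "c * (dir_deriv u (t (Suc a)) x * dir_deriv v (t (Suc (\<ell> - a))) x) = (\<Sum>i\<in>UNIV. \<Sum>j\<in>UNIV.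
      u $ i * (c * (dir_deriv (axis i 1) (t (Suc a)) x * dir_deriv (axis j 1) (t (Suc (\<ell> - a))) x)) * v $ j)"
      unfolding e[OF a(1), of u] e[OF a(2), of v] sum_product
      by (simp add: sum_distrib_left mult_ac)
  qed simp
  also have "\<dots> = (\<Sum>i\<in>UNIV. \<Sum>j\<in>UNIV. \<Sum>a\<le>\<ell>.
      u $ i * (c * (dir_deriv (axis i 1) (t (Suc a)) x * dir_deriv (axis j 1) (t (Suc (\<ell> - a))) x)) * v $ j)"
    by (subst sum.swap) (intro sum.cong refl sum.swap)
  also have "\<dots> = (\<Sum>i\<in>UNIV. \<Sum>j\<in>UNIV. u $ i * cov_matrix t c x $ i $ j * v $ j)"
    by (simp add: cov_matrix_def cov_metric_def sum_distrib_left sum_distrib_right mult_ac)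
  finally show ?thesis .
qed

lemma exp_sum_cov_matrix:
  assumes t: "frame_matrix \<alpha> t B"
  shows "exp_sum (\<lambda>x. cov_matrix t c x $ i $ j)"
proof -
  have "exp_sum (\<lambda>x. dir_deriv v (t (Suc a)) x)" if "a \<le> \<ell>" for a v
  proof -
    have "(\<lambda>x. dir_deriv v (t (Suc a)) x) = (\<lambda>x. \<Sum>l\<le>\<ell>. lin_coord \<alpha> (Suc l) v * (mirror \<alpha> l x * B a l x))"
      using t that by (simp add: frame_matrix_def)
    moreover have "exp_sum (\<lambda>x. \<Sum>l\<le>\<ell>. lin_coord \<alpha> (Suc l) v * (mirror \<alpha> l x * B a l x))"
      using t that by (intro exp_sum_sum exp_sum_cmult exp_sum_mult exp_sum_mirror) (auto simp: frame_matrix_def)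
    ultimately show ?thesis by simp
  qed
  then show ?thesis
    unfolding cov_matrix_def cov_metric_def by (simp, intro exp_sum_cmult exp_sum_sum exp_sum_mult) auto
qed

lemma exp_sum_frame_gram:
  assumes t: "frame_matrix \<alpha> t B" and "j \<le> \<ell>" "l \<le> \<ell>"
  shows "exp_sum (\<lambda>x. frame_gram B c x $$ (j, l))"
proof -
  have "(\<lambda>x. frame_gram B c x $$ (j, l)) = (\<lambda>x. c * (\<Sum>a\<le>\<ell>. B a j x * B (\<ell> - a) l x))"
    using assms by (auto simp: frame_gram_def)
  moreover have "exp_sum (\<lambda>x. c * (\<Sum>a\<le>\<ell>. B a j x * B (\<ell> - a) l x))"
    using assms by (intro exp_sum_cmult exp_sum_sum exp_sum_mult) (auto simp: frame_matrix_def)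
  ultimately show ?thesis by simp
qed

lemma coord_field_expansion:
  assumes t: "frame_matrix \<alpha> t B" and c: "coords_at t x"
  shows "v = (\<Sum>k\<le>\<ell>. dir_deriv v (t (Suc k)) x *s coord_field t (Suc k) x)" (is "_ = ?w")
proof -
  have w: "dir_deriv ?w (t (Suc a)) x = dir_deriv v (t (Suc a)) x" if a: "a \<le> \<ell>" for a
  proof -
    have "dir_deriv ?w (t (Suc a)) x = (\<Sum>k\<le>\<ell>. if k = a then dir_deriv v (t (Suc k)) x else 0)"
      unfolding frame_matrix_linear[OF t a]
      by (intro sum.cong) (auto simp: coord_field_dual[OF t c a])
    then show ?thesis using a by simp
  qed
  show ?thesis by (rule coords_at_injective[OF t c]) (simp add: w)
qed

text \<open>
  A vector in the kernel annihilates all \<open>dt\<close>. On a mirror the normal vector does so, since the derivatives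
  along it are divisible by the mirror factor.
\<close>

lemma cov_matrix_invertible_iff:
  assumes t: "frame_matrix \<alpha> t B"
  shows "coords_at t x \<Longrightarrow> c \<noteq> 0 \<Longrightarrow> invertible (cov_matrix t c x)"
    and "mirror \<alpha> 0 x = 0 \<Longrightarrow> \<not> invertible (cov_matrix t c x)"
proof -
  have ker: "(\<forall>v. cov_metric t c x v u = 0) \<longleftrightarrow> cov_matrix t c x *v u = 0" for u
  proof
    assume h: "\<forall>v. cov_metric t c x v u = 0"
    show "cov_matrix t c x *v u = 0"
    proof (subst Finite_Cartesian_Product.vec_eq_iff, rule allI)
      fix i
      have "cov_metric t c x (axis i 1) u = (\<Sum>a\<in>UNIV. if a = i then (\<Sum>j\<in>UNIV. cov_matrix t c x $ i $ j * u $ j) else 0)"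
        unfolding cov_metric_components[OF t] by (intro sum.cong) (auto simp: axis_def)
      then show "(cov_matrix t c x *v u) $ i = 0 $ i" using h by (simp add: matrix_vector_mult_def)
    qed
  next
    assume h: "cov_matrix t c x *v u = 0"
    have "cov_metric t c x v u = (\<Sum>i\<in>UNIV. v $ i * (cov_matrix t c x *v u) $ i)" for v
      unfolding cov_metric_components[OF t] by (simp add: matrix_vector_mult_def sum_distrib_left mult_ac)
    then show "\<forall>v. cov_metric t c x v u = 0" using h by simp
  qed
  show "invertible (cov_matrix t c x)" if co: "coords_at t x" and c: "c \<noteq> 0"
  proof -
    have "u = 0" if u: "cov_matrix t c x *v u = 0" for u
    proof -
      have "dir_deriv u (t (Suc a)) x = 0" if a: "a \<le> \<ell>" for a
      proof -
        have n: "\<ell> - a \<le> \<ell>" by simp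
        have "cov_metric t c x (coord_field t (Suc (\<ell> - a)) x) u =
            c * (\<Sum>b\<le>\<ell>. if \<ell> - a = b then dir_deriv u (t (Suc (\<ell> - b))) x else 0)"
          unfolding cov_metric_def
          by (intro arg_cong[where f = "\<lambda>s. c * s"] sum.cong) (auto simp: coord_field_dual[OF t co _ n])
        also have "\<dots> = c * dir_deriv u (t (Suc a)) x" using a by simp
        finally show ?thesis using ker[of u] u c by simp
      qed
      then have "\<forall>a\<in>{1..CARD('n option)}. dir_deriv u (t a) x = 0"
        using index_shift[of "\<lambda>a. dir_deriv u (t a) x = 0"] by simp
      then show ?thesis using co unfolding coords_at_def by blast
    qed
    then have "\<exists>B. B ** cov_matrix t c x = Finite_Cartesian_Product.mat 1"
      unfolding matrix_left_invertible_ker by blast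
    then show ?thesis unfolding invertible_def using matrix_left_right_inverse by blast
  qed
  show "\<not> invertible (cov_matrix t c x)" if m: "mirror \<alpha> 0 x = 0"
  proof
    assume inv: "invertible (cov_matrix t c x)"
    have "cov_metric t c x v (frame \<alpha> 0) = 0" for v
      unfolding cov_metric_def by (simp add: dir_deriv_frame_vector[OF t] m)
    then have "cov_matrix t c x *v frame \<alpha> 0 = 0" using ker by blast
    then have "frame \<alpha> 0 = 0"
      using inj_matrix_vector_mult[OF inv] by (metis injD matrix_vector_mult_0_right)
    then show False using lin_coord_frame[of 0 0] by simp
  qed
qed

lemma field_coeff_continuous:
  assumes B: "frame_matrix \<alpha> f B" and kl: "k \<le> \<ell>" "l \<le> \<ell>"
  shows "continuous_on (regular_points \<alpha> B) (field_coeff_deriv \<alpha> B k l v)"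
proof -
  have e: "exp_sum (\<lambda>x. mirror \<alpha> l x * frame_det \<alpha> B x)"
    by (intro exp_sum_mult exp_sum_mirror exp_sum_frame_det[OF B])
  have C: "exp_sum (frame_cofactor \<alpha> B k l)" by (rule exp_sum_frame_cofactor[OF B kl])
  show ?thesis unfolding field_coeff_deriv_def[abs_def]
    by (rule continuous_on_divide)
       (use regular_points_nonzero[of _ \<alpha> B] kl in
        \<open>auto intro!: exp_sum_continuous exp_sum_diff exp_sum_mult exp_sum_power exp_sum_dir_deriv C e
           exp_sum_mirror exp_sum_frame_det[OF B]\<close>)
qed

text \<open>
  At regular points the condition on flat coordinates fixes the limit that defines the metric on a basis,
  hence completely. It is therefore given there by the matrix \<open>cov_matrix\<close>, which is regular everywhere and
  degenerates at the origin, where all mirrors meet; so \<open>inverse_by_continuity\<close> applies. Since the regular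
  points are dense, the limit has the same value at every point.
\<close>

lemma saito_metric_flat:
  assumes y: "frame_matrix \<alpha> (y_coord R \<alpha> k) By" and t: "frame_matrix \<alpha> t Bt"
    and k: "k \<in> I" and d: "dz_degree \<alpha> k k \<noteq> 0"
    and flat: "saito_flat_coords R \<alpha> k \<kappa> t"
    and nz: "\<exists>x. frame_det \<alpha> By x \<noteq> 0" and mnz: "\<exists>x. mirror_product \<alpha> x \<noteq> 0"
  obtains c where "c \<noteq> 0"
    "\<And>z. z \<in> regular_points \<alpha> By \<Longrightarrow> coords_at t z \<and> e_field R \<alpha> k \<kappa> z = coord_field t 1 z"
    "\<And>z. z \<in> regular_points \<alpha> By \<Longrightarrow> saito_contra R \<alpha> k \<kappa> z ** cov_matrix t c z = Finite_Cartesian_Product.mat 1"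
    "\<And>x u v. saito_metric R \<alpha> k \<kappa> x u v = cov_metric t c x u v"
proof -
  let ?U = "regular_points \<alpha> By"
  let ?G = "saito_contra R \<alpha> k \<kappa>"
  have U: "{z. coords_at (y_coord R \<alpha> k) z} = ?U"
    unfolding coords_at_iff[OF y] regular_points_def ..
  have oU: "open ?U" by (rule open_regular_points[OF y])
  have k': "k - 1 \<le> \<ell>" "Suc (k - 1) = k" using k by auto
  obtain c where c: "c \<noteq> 0" and fl: "\<And>x. x \<in> ?U \<Longrightarrow> coords_at t x \<and> e_field R \<alpha> k \<kappa> x = coord_field t 1 x"
    "\<And>x a b. x \<in> ?U \<Longrightarrow> a \<in> {1..\<ell> + 1} \<Longrightarrow> b \<in> {1..\<ell> + 1} \<Longrightarrow>
      saito_metric R \<alpha> k \<kappa> x (coord_field t a x) (coord_field t b x) = (if a + b = \<ell> + 2 then c else 0)"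
    using flat unfolding saito_flat_coords_def U[symmetric] by auto
  define L where "L z = Lim (at z within ?U) (\<lambda>z. matrix_inv (?G z))" for z
  have sm: "saito_metric R \<alpha> k \<kappa> x u v = (\<Sum>i\<in>UNIV. \<Sum>j\<in>UNIV. u $ i * L x $ i $ j * v $ j)" for x u v
    unfolding saito_metric_def U L_def Let_def ..
  have LH: "L z = cov_matrix t c z" if z: "z \<in> ?U" for z
  proof -
    have co: "coords_at t z" using fl(1)[OF z] by blast
    define V where "V a = coord_field t (Suc a) z" for a
    have bil: "saito_metric R \<alpha> k \<kappa> z u v = cov_metric t c z u v" for u v
    proof -
      define p where "p a = dir_deriv u (t (Suc a)) z" for a
      define q where "q a = dir_deriv v (t (Suc a)) z" for a
      have uv: "u = (\<Sum>a\<le>\<ell>. p a *s V a)" "v = (\<Sum>a\<le>\<ell>. q a *s V a)"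
        unfolding p_def q_def V_def by (rule coord_field_expansion[OF t co])+
      have "saito_metric R \<alpha> k \<kappa> z u v =
          (\<Sum>i\<in>UNIV. \<Sum>j\<in>UNIV. \<Sum>a\<le>\<ell>. \<Sum>b\<le>\<ell>. p a * q b * (V a $ i * L z $ i $ j * V b $ j))"
        unfolding sm
        by (subst uv(1), subst uv(2)) (simp add: sum_component sum_distrib_left sum_distrib_right mult_ac)
      also have "\<dots> = (\<Sum>i\<in>UNIV. \<Sum>a\<le>\<ell>. \<Sum>j\<in>UNIV. \<Sum>b\<le>\<ell>. p a * q b * (V a $ i * L z $ i $ j * V b $ j))"
        by (intro sum.cong refl sum.swap)
      also have "\<dots> = (\<Sum>a\<le>\<ell>. \<Sum>i\<in>UNIV. \<Sum>j\<in>UNIV. \<Sum>b\<le>\<ell>. p a * q b * (V a $ i * L z $ i $ j * V b $ j))"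
        by (rule sum.swap)
      also have "\<dots> = (\<Sum>a\<le>\<ell>. \<Sum>i\<in>UNIV. \<Sum>b\<le>\<ell>. \<Sum>j\<in>UNIV. p a * q b * (V a $ i * L z $ i $ j * V b $ j))"
        by (intro sum.cong refl sum.swap)
      also have "\<dots> = (\<Sum>a\<le>\<ell>. \<Sum>b\<le>\<ell>. \<Sum>i\<in>UNIV. \<Sum>j\<in>UNIV. p a * q b * (V a $ i * L z $ i $ j * V b $ j))"
        by (intro sum.cong refl sum.swap)
      also have "\<dots> = (\<Sum>a\<le>\<ell>. \<Sum>b\<le>\<ell>. p a * q b * saito_metric R \<alpha> k \<kappa> z (V a) (V b))"
        unfolding sm by (simp add: sum_distrib_left)
      also have "\<dots> = (\<Sum>a\<le>\<ell>. \<Sum>b\<le>\<ell>. if b = \<ell> - a then p a * q b * c else 0)"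
      proof (intro sum.cong refl)
        fix a b assume ab: "a \<in> {..\<ell>}" "b \<in> {..\<ell>}"
        have "saito_metric R \<alpha> k \<kappa> z (V a) (V b) = (if Suc a + Suc b = \<ell> + 2 then c else 0)"
          unfolding V_def using ab by (intro fl(2)[OF z]) auto
        moreover have "Suc a + Suc b = \<ell> + 2 \<longleftrightarrow> b = \<ell> - a" using ab by auto
        ultimately show "p a * q b * saito_metric R \<alpha> k \<kappa> z (V a) (V b) = (if b = \<ell> - a then p a * q b * c else 0)"
          by simp
      qed
      also have "\<dots> = cov_metric t c z u v"
        by (simp add: cov_metric_def p_def q_def sum_distrib_left mult_ac)
      finally show ?thesis .
    qed
    have "L z $ i $ j = cov_matrix t c z $ i $ j" for i j
    proof -
      have "saito_metric R \<alpha> k \<kappa> z (axis i 1) (axis j 1) =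
          (\<Sum>a\<in>UNIV. if a = i then (\<Sum>b\<in>UNIV. if b = j then L z $ i $ j else 0) else 0)"
        unfolding sm
        by (simp add: axis_def if_distrib[of "\<lambda>u. u * _"] if_distrib[of "\<lambda>u. _ * u"] cong: if_cong)
      then have "saito_metric R \<alpha> k \<kappa> z (axis i 1) (axis j 1) = L z $ i $ j" by simp
      then show ?thesis using bil by (simp add: cov_matrix_def)
    qed
    then show ?thesis by (simp add: Finite_Cartesian_Product.vec_eq_iff)
  qed
  have contG: "continuous_on ?U ?G"
  proof -
    have ent: "?G z $ a $ b =
      - (gamma_inv \<alpha> k b * (\<Sum>l\<le>\<ell>. \<kappa> * field_coeff_deriv \<alpha> By (k - 1) l (axis b 1) z * frame \<alpha> l $ a))
      - (gamma_inv \<alpha> k a * (\<Sum>l\<le>\<ell>. \<kappa> * field_coeff_deriv \<alpha> By (k - 1) l (axis a 1) z * frame \<alpha> l $ b))"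
      if z: "z \<in> ?U" for z a b
    proof (rule saito_contra_entry[OF y k'(1) d oU z])
      fix w assume w: "w \<in> ?U"
      then have "coords_at (y_coord R \<alpha> k) w" using U by blast
      then show "e_field R \<alpha> k \<kappa> w = (\<Sum>l\<le>\<ell>. (\<kappa> * field_coeff \<alpha> By (k - 1) l w) *s frame \<alpha> l)"
        unfolding e_field_def using coord_field_cofactor[OF y _ k'(1), of w] k'(2)
        by (simp add: field_coeff_def vec.scale_sum_right)
    qed (use regular_points_nonzero[of _ \<alpha> By] in auto)
    have "continuous_on ?U (\<lambda>z. \<chi> a b.
      - (gamma_inv \<alpha> k b * (\<Sum>l\<le>\<ell>. \<kappa> * field_coeff_deriv \<alpha> By (k - 1) l (axis b 1) z * frame \<alpha> l $ a))
      - (gamma_inv \<alpha> k a * (\<Sum>l\<le>\<ell>. \<kappa> * field_coeff_deriv \<alpha> By (k - 1) l (axis a 1) z * frame \<alpha> l $ b)))"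
      by (intro continuous_intros field_coeff_continuous[OF y k'(1)]) auto
    then show ?thesis
      by (rule continuous_on_eq) (simp add: ent Finite_Cartesian_Product.vec_eq_iff)
  qed
  have contH: "continuous_on UNIV (cov_matrix t c)"
  proof -
    have "continuous_on UNIV (\<lambda>x. \<chi> i j. cov_matrix t c x $ i $ j)"
      by (intro continuous_on_vec_lambda exp_sum_continuous exp_sum_cov_matrix[OF t])
    then show ?thesis by simp
  qed
  have inv: "?G z ** cov_matrix t c z = Finite_Cartesian_Product.mat 1" if "z \<in> ?U" for z
  proof (rule inverse_by_continuity[OF oU contG contH exp_sum_cov_matrix[OF t] _ _ _ that])
    show "Lim (at w within ?U) (\<lambda>z. matrix_inv (?G z)) = cov_matrix t c w" if "w \<in> ?U" for w
      using LH[OF that] unfolding L_def .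
    show "invertible (cov_matrix t c w)" if "w \<in> ?U" for w
      using cov_matrix_invertible_iff(1)[OF t] fl(1)[OF that] c by blast
    show "\<not> invertible (cov_matrix t c 0)"
      by (rule cov_matrix_invertible_iff(2)[OF t]) (simp add: mirror_def e_root_def)
  qed
  have all: "saito_metric R \<alpha> k \<kappa> x u v = cov_metric t c x u v" for x u v
  proof -
    obtain x1 where x1: "mirror_product \<alpha> x1 * frame_det \<alpha> By x1 \<noteq> 0"
      using exp_sum_mult_nonzero[OF exp_sum_mirror_product exp_sum_frame_det[OF y]] nz mnz by blast
    have "x islimpt ?U"
      unfolding islimpt_def
    proof (intro allI impI)
      fix T assume T: "x \<in> T" "open T"
      have "\<exists>z\<in>T. mirror_product \<alpha> z * frame_det \<alpha> By z \<noteq> 0 \<and> z \<noteq> x"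
        by (rule exp_sum_dense[OF exp_sum_mult[OF exp_sum_mirror_product exp_sum_frame_det[OF y]] x1 T(2,1)])
      then show "\<exists>y\<in>?U. y \<in> T \<and> y \<noteq> x" by (auto simp: regular_points_def)
    qed
    then have nt: "at x within ?U \<noteq> bot" by (simp add: trivial_limit_within)
    have "(cov_matrix t c \<longlongrightarrow> cov_matrix t c x) (at x within ?U)"
      by (rule tendsto_within_subset[of _ _ _ UNIV]) (use contH in \<open>auto simp: continuous_on_def\<close>)
    then have "((\<lambda>z. matrix_inv (?G z)) \<longlongrightarrow> cov_matrix t c x) (at x within ?U)"
      by (rule Lim_transform_eventually) (auto simp: eventually_at_filter matrix_inv_eqI[OF inv])
    then have "L x = cov_matrix t c x" unfolding L_def by (rule tendsto_Lim[OF nt])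
    then show ?thesis unfolding sm cov_metric_components[OF t] by simp
  qed
  show ?thesis by (rule that[OF c fl(1) inv all])
qed

end

section \<open>The inverse Gram matrix\<close>

text \<open>
  The symmetrised gradient of the field with coefficients \<open>field_coeff\<close>, in the frame divided by the mirror
  factors and multiplied by the square of \<open>frame_det\<close>: this clears all denominators
  (\<open>frame_inverse_field_coeff\<close>).
\<close>

definition frame_inverse where
  "frame_inverse \<alpha> k B k' j l x =
     - (mirror \<alpha> l x * (frame_det \<alpha> B x * dir_deriv (gamma_dual \<alpha> k l) (frame_cofactor \<alpha> B k' j) x -
                          frame_cofactor \<alpha> B k' j x * dir_deriv (gamma_dual \<alpha> k l) (frame_det \<alpha> B) x) +
        mirror \<alpha> j x * (frame_det \<alpha> B x * dir_deriv (gamma_dual \<alpha> k j) (frame_cofactor \<alpha> B k' l) x -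
                          frame_cofactor \<alpha> B k' l x * dir_deriv (gamma_dual \<alpha> k j) (frame_det \<alpha> B) x)) +
     (if j = l \<and> j < rank_of \<alpha>
      then 2 * frame_cofactor \<alpha> B k' j x * frame_det \<alpha> B x * cosh (cpair (\<alpha> (Suc j)) x / 2) else 0)"

lemma frame_inverse_sym: "frame_inverse \<alpha> k B k' j l x = frame_inverse \<alpha> k B k' l j x"
  unfolding frame_inverse_def by (cases "j = l") (auto simp: algebra_simps)

lemma exp_sum_frame_inverse:
  fixes \<alpha> :: "nat \<Rightarrow> real^'n"
  assumes B: "frame_matrix \<alpha> f B" and "k' \<le> CARD('n)" "j \<le> CARD('n)" "l \<le> CARD('n)"
  shows "exp_sum (frame_inverse \<alpha> k B k' j l)"
proof -
  have C: "exp_sum (frame_cofactor \<alpha> B k' i)" if "i \<le> CARD('n)" for i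
    by (rule exp_sum_frame_cofactor[OF B assms(2) that])
  have "exp_sum (\<lambda>x. if j = l \<and> j < CARD('n)
      then 2 * frame_cofactor \<alpha> B k' j x * frame_det \<alpha> B x * cosh (cpair (\<alpha> (Suc j)) x / 2) else 0)"
  proof (cases "j = l \<and> j < CARD('n)")
    case True
    show ?thesis
      unfolding if_P[OF True] by (intro exp_sum_mult exp_sum_const C assms exp_sum_frame_det[OF B] exp_sum_cosh)
  next
    case False
    then show ?thesis by (simp only: if_False exp_sum_const)
  qed
  then show ?thesis
    unfolding frame_inverse_def[abs_def]
    by (intro exp_sum_add exp_sum_uminus exp_sum_mult exp_sum_diff exp_sum_mirror exp_sum_dir_deriv
        C assms exp_sum_frame_det[OF B])
qed

lemma frame_gram_sym:
  fixes B :: "nat \<Rightarrow> nat \<Rightarrow> complex^('n::finite option) \<Rightarrow> complex"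
  assumes "j \<le> CARD('n)" "l \<le> CARD('n)"
  shows "frame_gram B c x $$ (j, l) = frame_gram B c x $$ (l, j)"
proof -
  have "(\<Sum>a\<le>CARD('n). B a j x * B (CARD('n) - a) l x) = (\<Sum>a\<le>CARD('n). B a l x * B (CARD('n) - a) j x)"
    by (rule sum.reindex_bij_witness[of _ "\<lambda>a. CARD('n) - a" "\<lambda>a. CARD('n) - a"]) (auto simp: mult.commute)
  then show ?thesis using assms by (simp add: frame_gram_def)
qed

lemma frame_gram_carrier: "frame_gram (B :: nat \<Rightarrow> nat \<Rightarrow> complex^('n::finite option) \<Rightarrow> complex) c x \<in> carrier_mat (Suc CARD('n)) (Suc CARD('n))"
  by (simp add: frame_gram_def)

text \<open>
  The Gram matrix is the transpose of \<open>B\<close> times \<open>B\<close> with its rows in reverse order, up to the factor \<open>c\<close>.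
\<close>

lemma det_frame_gram:
  fixes \<alpha> :: "nat \<Rightarrow> real^'n"
  shows "\<exists>\<epsilon>::complex. \<epsilon> \<noteq> 0 \<and> (\<forall>c B x. Determinant.det (frame_gram B c x) = \<epsilon> * c ^ Suc CARD('n) * (frame_det \<alpha> B x)\<^sup>2)"
proof -
  let ?N = "Suc CARD('n)"
  define p where "p a = (if a < ?N then CARD('n) - a else a)" for a
  have p: "p permutes {0..<?N}"
  proof (rule bij_imp_permutes)
    show "bij_betw p {0..<?N} {0..<?N}"
      by (rule bij_betwI[where g = p]) (auto simp: p_def)
  qed (auto simp: p_def)
  have "Determinant.det (frame_gram B c x) = signof p * c ^ ?N * (frame_det \<alpha> B x)\<^sup>2" for c B x
  proof -
    define A where "A = frame_mat \<alpha> B x"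
    have A: "A \<in> carrier_mat ?N ?N" unfolding A_def by (rule frame_mat_carrier)
    define A' where "A' = mat ?N ?N (\<lambda>(i, j). A $$ (p i, j))"
    define M where "M = mat ?N ?N (\<lambda>(i, j). c * 1 * (A' $$ (i, j)))"
    have M: "M \<in> carrier_mat ?N ?N" and A': "A' \<in> carrier_mat ?N ?N" by (simp_all add: M_def A'_def)
    have "Determinant.det M = c ^ ?N * Determinant.det (mat ?N ?N (\<lambda>(i, j). A' $$ (i, j)))"
      unfolding M_def det_scale_rows_columns by simp
    also have "mat ?N ?N (\<lambda>(i, j). A' $$ (i, j)) = A'" by (auto simp: A'_def)
    also have "Determinant.det A' = signof p * Determinant.det A"
      unfolding A'_def by (rule det_permute_rows[OF A p])
    finally have dM: "Determinant.det M = signof p * c ^ ?N * Determinant.det A" by simp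
    have "frame_gram B c x = transpose_mat A * M"
    proof (rule eq_matI)
      fix i j assume "i < dim_row (transpose_mat A * M)" "j < dim_col (transpose_mat A * M)"
      then have ij: "i < ?N" "j < ?N" using A M by auto
      have "(transpose_mat A * M) $$ (i, j) = (\<Sum>a<?N. A $$ (a, i) * M $$ (a, j))"
        using A M ij by (auto simp: scalar_prod_def atLeast0LessThan)
      also have "\<dots> = (\<Sum>a<?N. c * (B a i x * B (CARD('n) - a) j x))"
        using ij by (intro sum.cong) (auto simp: M_def A'_def A_def frame_mat_def p_def mult_ac)
      finally show "frame_gram B c x $$ (i, j) = (transpose_mat A * M) $$ (i, j)"
        using ij by (simp only: frame_gram_def index_mat split_conv sum_distrib_left lessThan_Suc_atMost)
    qed (use A M in \<open>auto simp: frame_gram_def\<close>)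
    then have "Determinant.det (frame_gram B c x) = Determinant.det A * Determinant.det M"
      using det_mult[of "transpose_mat A" ?N M] det_transpose[OF A] A M by simp
    then show ?thesis unfolding dM by (simp add: A_def frame_det_def power2_eq_square)
  qed
  moreover have "signof p \<noteq> (0 :: complex)" by (simp add: sign_def)
  ultimately show ?thesis by blast
qed

context root_data
begin

lemma gamma_dual_finite: "l < \<ell> \<Longrightarrow> gamma_dual \<alpha> k l = emb (fund_coweight \<alpha> (Suc l))"
  unfolding Finite_Cartesian_Product.vec_eq_iff
  by (auto simp: gamma_dual_def coframe_def gamma_inv_def split: option.splits)

lemma cpair_simple_gamma_dual:
  assumes "j < \<ell>" "l \<le> \<ell>"
  shows "cpair (\<alpha> (Suc j)) (gamma_dual \<alpha> k l) = (if j = l then 1 else 0)"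
proof (cases "l < \<ell>")
  case True
  then show ?thesis
    using assms coweight_simple[of "Suc j" "Suc l"]
    by (auto simp: gamma_dual_finite cpair_emb inner_commute)
next
  case False
  then have "gamma_dual \<alpha> k l $ Some i = 0" for i
    by (simp add: gamma_dual_def coframe_def axis_def)
  then show ?thesis using assms False by (simp add: cpair_def)
qed

lemma dir_deriv_mirror_gamma_dual:
  assumes "j \<le> \<ell>" "l \<le> \<ell>"
  shows "dir_deriv (gamma_dual \<alpha> k l) (mirror \<alpha> j) x =
    (if j = l \<and> j < \<ell> then cosh (cpair (\<alpha> (Suc j)) x / 2) else 0)"
proof (cases "j < \<ell>")
  case True
  then show ?thesis
    using cpair_simple_gamma_dual[OF True assms(2)] by (simp add: mirror_def dir_deriv_e_root)
next
  case False
  then show ?thesis by (simp add: mirror_def dir_deriv_const)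
qed

lemma frame_inverse_field_coeff:
  assumes B: "frame_matrix \<alpha> f B" and k: "k' \<le> \<ell>" and jl: "j \<le> \<ell>" "l \<le> \<ell>"
    and nz: "\<And>l. l \<le> \<ell> \<Longrightarrow> mirror \<alpha> l x \<noteq> 0" "frame_det \<alpha> B x \<noteq> 0"
  shows "frame_inverse \<alpha> k B k' j l x = - (mirror \<alpha> j x * mirror \<alpha> l x * (frame_det \<alpha> B x)\<^sup>2 *
     (field_coeff_deriv \<alpha> B k' j (gamma_dual \<alpha> k l) x + field_coeff_deriv \<alpha> B k' l (gamma_dual \<alpha> k j) x))"
proof -
  define \<delta> where "\<delta> = frame_det \<alpha> B x"
  have half: "mirror \<alpha> j x * mirror \<alpha> l x * (frame_det \<alpha> B x)\<^sup>2 * field_coeff_deriv \<alpha> B k' j (gamma_dual \<alpha> k l) x =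
      mirror \<alpha> l x * (frame_det \<alpha> B x * dir_deriv (gamma_dual \<alpha> k l) (frame_cofactor \<alpha> B k' j) x -
        frame_cofactor \<alpha> B k' j x * dir_deriv (gamma_dual \<alpha> k l) (frame_det \<alpha> B) x) -
      (if j = l \<and> j < \<ell> then frame_cofactor \<alpha> B k' j x * frame_det \<alpha> B x * cosh (cpair (\<alpha> (Suc j)) x / 2) else 0)"
    if jl: "j \<le> \<ell>" "l \<le> \<ell>" for j l
  proof -
    let ?m = "mirror \<alpha> j x" and ?m' = "mirror \<alpha> l x" and ?C = "frame_cofactor \<alpha> B k' j x"
    let ?DC = "dir_deriv (gamma_dual \<alpha> k l) (frame_cofactor \<alpha> B k' j) x"
    let ?Dd = "dir_deriv (gamma_dual \<alpha> k l) (frame_det \<alpha> B) x"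
    let ?Dm = "dir_deriv (gamma_dual \<alpha> k l) (mirror \<alpha> j) x"
    have "?m * ?m' * \<delta>\<^sup>2 * ((?DC * (?m * \<delta>) - ?C * (?Dm * \<delta> + ?m * ?Dd)) / (?m * \<delta>)\<^sup>2) =
        ?m' * (\<delta> * ?DC - ?C * ?Dd) - ?m' / ?m * (?C * \<delta> * ?Dm)"
      using nz(1)[OF jl(1)] nz(2) by (simp add: \<delta>_def power2_eq_square field_simps)
    moreover have "?m' / ?m * (?C * \<delta> * ?Dm) =
        (if j = l \<and> j < \<ell> then ?C * \<delta> * cosh (cpair (\<alpha> (Suc j)) x / 2) else 0)"
      unfolding dir_deriv_mirror_gamma_dual[OF jl] using nz(1)[OF jl(1)] by auto
    ultimately show ?thesis
      unfolding field_coeff_deriv_def dir_deriv_mult[OF exp_sum_mirror exp_sum_frame_det[OF B]]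
      by (simp add: \<delta>_def)
  qed
  have eq: "mirror \<alpha> j x * mirror \<alpha> l x * (frame_det \<alpha> B x)\<^sup>2 *
     (field_coeff_deriv \<alpha> B k' j (gamma_dual \<alpha> k l) x + field_coeff_deriv \<alpha> B k' l (gamma_dual \<alpha> k j) x) =
     mirror \<alpha> j x * mirror \<alpha> l x * (frame_det \<alpha> B x)\<^sup>2 * field_coeff_deriv \<alpha> B k' j (gamma_dual \<alpha> k l) x +
     mirror \<alpha> l x * mirror \<alpha> j x * (frame_det \<alpha> B x)\<^sup>2 * field_coeff_deriv \<alpha> B k' l (gamma_dual \<alpha> k j) x"
    by (simp add: algebra_simps)
  show ?thesis
    unfolding eq half[OF jl] half[OF jl(2,1)]
    by (cases "j = l") (auto simp: frame_inverse_def algebra_simps)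
qed

text \<open>
  At regular points this says that the contravariant metric is inverse to the covariant one, in the frame
  divided by the mirror factors. Both sides are exponential sums, so it holds everywhere. The field \<open>e\<close> may be
  described by any system \<open>f\<close> of which it is a coordinate field; \<open>f = t\<close> and \<open>f = y\<close> are used.
\<close>

lemma frame_inverse_gram:
  assumes y: "frame_matrix \<alpha> (y_coord R \<alpha> k) By" and t: "frame_matrix \<alpha> t Bt"
    and f: "frame_matrix \<alpha> f B" and k: "k' \<le> \<ell>" and d: "dz_degree \<alpha> k k \<noteq> 0"
    and nz: "\<exists>x. frame_det \<alpha> By x \<noteq> 0" and mnz: "\<exists>x. mirror_product \<alpha> x \<noteq> 0"
    and inv: "\<And>z. z \<in> regular_points \<alpha> By \<Longrightarrow>
        saito_contra R \<alpha> k \<kappa> z ** cov_matrix t c z = Finite_Cartesian_Product.mat 1"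
    and E: "\<And>z. z \<in> regular_points \<alpha> By \<Longrightarrow>
        coords_at f z \<and> e_field R \<alpha> k \<kappa> z = \<kappa>' *s coord_field f (Suc k') z"
    and jm: "j \<le> \<ell>" "m \<le> \<ell>"
  shows "(\<Sum>l\<le>\<ell>. \<kappa>' * frame_inverse \<alpha> k B k' j l x * frame_gram Bt c x $$ (l, m)) =
    (if j = m then (frame_det \<alpha> B x)\<^sup>2 else 0)"
proof -
  let ?U = "regular_points \<alpha> By"
  have oU: "open ?U" by (rule open_regular_points[OF y])
  have B_nz: "frame_det \<alpha> B z \<noteq> 0" if "z \<in> ?U" for z
    using E[OF that] unfolding coords_at_iff[OF f] by auto
  note m_nz = regular_points_nonzero(2)[of _ \<alpha> By]
  have E': "e_field R \<alpha> k \<kappa> z = (\<Sum>l\<le>\<ell>. (\<kappa>' * field_coeff \<alpha> B k' l z) *s frame \<alpha> l)" if "z \<in> ?U" for z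
    using E[OF that] coord_field_cofactor[OF f _ k, of z] by (simp add: field_coeff_def vec.scale_sum_right)
  have reg: "(\<Sum>l\<le>\<ell>. \<kappa>' * frame_inverse \<alpha> k B k' j l x * frame_gram Bt c x $$ (l, m)) =
    (if j = m then (frame_det \<alpha> B x)\<^sup>2 else 0)" if x: "x \<in> ?U" for x
  proof -
    define G where "G = saito_contra R \<alpha> k \<kappa> x"
    define H where "H = cov_matrix t c x"
    define w where "w = H *v frame \<alpha> m"
    have GH: "G ** H = Finite_Cartesian_Product.mat 1" unfolding G_def H_def by (rule inv[OF x])
    define g where "g j l = (\<Sum>a\<in>UNIV. \<Sum>b\<in>UNIV. coframe \<alpha> j $ a * G $ a $ b * coframe \<alpha> l $ b)" for j l
    have g: "g j l = - \<kappa>' * (field_coeff_deriv \<alpha> B k' j (gamma_dual \<alpha> k l) x + field_coeff_deriv \<alpha> B k' l (gamma_dual \<alpha> k j) x)"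
      if "j \<le> \<ell>" "l \<le> \<ell>" for j l
      unfolding g_def G_def
      by (rule saito_contra_coframe[OF f k d oU x]) (fact E', fact m_nz, fact B_nz, fact that(1), fact that(2))
    have cw: "cov_metric t c x (frame \<alpha> l) (frame \<alpha> m) = (\<Sum>b\<in>UNIV. frame \<alpha> l $ b * w $ b)" for l
      unfolding cov_metric_components[OF t] w_def H_def
      by (simp add: matrix_vector_mult_def sum_distrib_left mult_ac)
    have "(\<Sum>l\<le>\<ell>. g j l * cov_metric t c x (frame \<alpha> l) (frame \<alpha> m)) =
        (\<Sum>l\<le>\<ell>. \<Sum>a\<in>UNIV. \<Sum>b\<in>UNIV. \<Sum>b'\<in>UNIV. coframe \<alpha> j $ a * G $ a $ b * w $ b' * (coframe \<alpha> l $ b * frame \<alpha> l $ b'))"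
      unfolding g_def sum_distrib_right unfolding cw sum_distrib_left by (simp add: mult_ac)
    also have "\<dots> = (\<Sum>a\<in>UNIV. \<Sum>l\<le>\<ell>. \<Sum>b\<in>UNIV. \<Sum>b'\<in>UNIV. coframe \<alpha> j $ a * G $ a $ b * w $ b' * (coframe \<alpha> l $ b * frame \<alpha> l $ b'))"
      by (rule sum.swap)
    also have "\<dots> = (\<Sum>a\<in>UNIV. \<Sum>b\<in>UNIV. \<Sum>l\<le>\<ell>. \<Sum>b'\<in>UNIV. coframe \<alpha> j $ a * G $ a $ b * w $ b' * (coframe \<alpha> l $ b * frame \<alpha> l $ b'))"
      by (intro sum.cong refl sum.swap)
    also have "\<dots> = (\<Sum>a\<in>UNIV. \<Sum>b\<in>UNIV. \<Sum>b'\<in>UNIV. \<Sum>l\<le>\<ell>. coframe \<alpha> j $ a * G $ a $ b * w $ b' * (coframe \<alpha> l $ b * frame \<alpha> l $ b'))"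
      by (intro sum.cong refl sum.swap)
    also have "\<dots> = (\<Sum>a\<in>UNIV. \<Sum>b\<in>UNIV. \<Sum>b'\<in>UNIV. coframe \<alpha> j $ a * G $ a $ b * w $ b' * (if b = b' then 1 else 0))"
      by (simp only: sum_distrib_left[symmetric] coframe_frame_sum)
    also have "\<dots> = (\<Sum>a\<in>UNIV. coframe \<alpha> j $ a * (G *v w) $ a)"
      by (simp add: if_distrib[of "\<lambda>u. _ * u"] matrix_vector_mult_def sum_distrib_left mult_ac cong: if_cong)
    also have "G *v w = frame \<alpha> m" unfolding w_def matrix_vector_mul_assoc GH by simp
    also have "(\<Sum>a\<in>UNIV. coframe \<alpha> j $ a * frame \<alpha> m $ a) = (if j = m then 1 else 0)"
      by (rule coframe_frame[OF jm])
    finally have one: "(\<Sum>l\<le>\<ell>. g j l * cov_metric t c x (frame \<alpha> l) (frame \<alpha> m)) = (if j = m then 1 else 0)" .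
    let ?f = "mirror \<alpha> j x * (frame_det \<alpha> B x)\<^sup>2 / mirror \<alpha> m x"
    have "(\<Sum>l\<le>\<ell>. \<kappa>' * frame_inverse \<alpha> k B k' j l x * frame_gram Bt c x $$ (l, m)) =
        (\<Sum>l\<le>\<ell>. ?f * (g j l * cov_metric t c x (frame \<alpha> l) (frame \<alpha> m)))"
    proof (rule sum.cong)
      fix l assume "l \<in> {..\<ell>}"
      then have l: "l \<le> \<ell>" by simp
      have fi: "\<kappa>' * frame_inverse \<alpha> k B k' j l x = mirror \<alpha> j x * mirror \<alpha> l x * (frame_det \<alpha> B x)\<^sup>2 * g j l"
        unfolding g[OF jm(1) l]
        by (subst frame_inverse_field_coeff[OF f k jm(1) l]) (use m_nz[OF x] B_nz[OF x] in \<open>simp_all add: mult_ac\<close>)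
      show "\<kappa>' * frame_inverse \<alpha> k B k' j l x * frame_gram Bt c x $$ (l, m) =
          ?f * (g j l * cov_metric t c x (frame \<alpha> l) (frame \<alpha> m))"
        unfolding fi cov_metric_frame[OF t l jm(2)] using m_nz[OF x jm(2)] by (simp add: field_simps)
    qed simp
    also have "\<dots> = ?f * (if j = m then 1 else 0)" unfolding sum_distrib_left[symmetric] one ..
    also have "\<dots> = (if j = m then (frame_det \<alpha> B x)\<^sup>2 else 0)" using m_nz[OF x jm(1)] by auto
    finally show ?thesis .
  qed
  let ?g = "\<lambda>x. (\<Sum>l\<le>\<ell>. \<kappa>' * frame_inverse \<alpha> k B k' j l x * frame_gram Bt c x $$ (l, m)) -
    (if j = m then 1 else 0) * (frame_det \<alpha> B x)\<^sup>2"
  obtain x1 where x1: "mirror_product \<alpha> x1 * frame_det \<alpha> By x1 \<noteq> 0"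
    using exp_sum_mult_nonzero[OF exp_sum_mirror_product exp_sum_frame_det[OF y]] nz mnz by blast
  have "?g x = 0"
  proof (rule exp_sum_zero_on[of "\<lambda>x. mirror_product \<alpha> x * frame_det \<alpha> By x" ?g UNIV x1])
    show "exp_sum ?g"
      by (intro exp_sum_diff exp_sum_sum exp_sum_mult exp_sum_const exp_sum_power exp_sum_frame_det[OF f]
          exp_sum_frame_inverse[OF f k jm(1)] exp_sum_frame_gram[OF t _ jm(2)]) auto
    show "?g z = 0" if "mirror_product \<alpha> z * frame_det \<alpha> By z \<noteq> 0" for z
      using reg[of z] that by (simp add: regular_points_def)
  qed (use x1 in \<open>auto intro: exp_sum_mult exp_sum_mirror_product exp_sum_frame_det[OF y] line_closed_UNIV\<close>)
  then show ?thesis by simp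
qed

text \<open>
  Where the determinant of \<open>y\<close> is non-zero, the identity exhibits an inverse of the Gram matrix, whose
  determinant is a multiple of the square of the determinant of \<open>t\<close>.
\<close>

lemma frame_det_transfer:
  assumes id: "\<And>j m. j \<le> \<ell> \<Longrightarrow> m \<le> \<ell> \<Longrightarrow>
      (\<Sum>l\<le>\<ell>. \<kappa> * frame_inverse \<alpha> k By k' j l x * frame_gram Bt c x $$ (l, m)) =
      (if j = m then (frame_det \<alpha> By x)\<^sup>2 else 0)"
    and nz: "frame_det \<alpha> By x \<noteq> 0"
  shows "frame_det \<alpha> Bt x \<noteq> 0"
proof
  assume 0: "frame_det \<alpha> Bt x = 0"
  let ?N = "Suc (\<ell>)"
  define H where "H = mat ?N ?N (\<lambda>(j, l). \<kappa> * frame_inverse \<alpha> k By k' j l x)"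
  have H: "H \<in> carrier_mat ?N ?N" by (simp add: H_def)
  note G = frame_gram_carrier[of Bt c x]
  have "H * frame_gram Bt c x = (frame_det \<alpha> By x)\<^sup>2 \<cdot>\<^sub>m 1\<^sub>m ?N"
  proof (rule eq_matI)
    fix j m assume "j < dim_row ((frame_det \<alpha> By x)\<^sup>2 \<cdot>\<^sub>m 1\<^sub>m ?N)" "m < dim_col ((frame_det \<alpha> By x)\<^sup>2 \<cdot>\<^sub>m 1\<^sub>m ?N)"
    then have jm: "j < ?N" "m < ?N" by auto
    have "(H * frame_gram Bt c x) $$ (j, m) = (\<Sum>l<?N. H $$ (j, l) * frame_gram Bt c x $$ (l, m))"
      using H G jm by (auto simp: scalar_prod_def atLeast0LessThan simp del: lessThan_Suc sum.lessThan_Suc)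
    also have "\<dots> = (\<Sum>l\<le>\<ell>. \<kappa> * frame_inverse \<alpha> k By k' j l x * frame_gram Bt c x $$ (l, m))"
      unfolding lessThan_Suc_atMost using jm by (intro sum.cong) (auto simp: H_def)
    finally show "(H * frame_gram Bt c x) $$ (j, m) = ((frame_det \<alpha> By x)\<^sup>2 \<cdot>\<^sub>m 1\<^sub>m ?N) $$ (j, m)"
      using id[of j m] jm by auto
  qed (use H G in auto)
  then have "Determinant.det H * Determinant.det (frame_gram Bt c x) = (frame_det \<alpha> By x)\<^sup>2 ^ ?N"
    using det_mult[OF H G] by simp
  moreover obtain \<epsilon> where "Determinant.det (frame_gram Bt c x) = \<epsilon> * c ^ ?N * (frame_det \<alpha> Bt x)\<^sup>2"
    using det_frame_gram[of \<alpha>] by blast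
  ultimately show False using 0 nz by simp
qed

text \<open>
  Where both mirrors vanish, the mixed second derivative along the two roots is their inner product times
  either of the two columns, according to the order of differentiation.
\<close>

lemma columns_agree:
  assumes t: "frame_matrix \<alpha> t B" and et: "\<And>i. i \<in> I \<Longrightarrow> exp_sum (t i)"
    and rs: "r < \<ell>" "s < \<ell>" and a: "a \<le> \<ell>"
    and x: "cpair (\<alpha> (Suc r)) x = 0" "cpair (\<alpha> (Suc s)) x = 0"
    and no: "\<alpha> (Suc r) \<bullet> \<alpha> (Suc s) \<noteq> 0"
  shows "B a r x = B a s x"
proof (cases "a = \<ell>")
  case True
  then show ?thesis using t rs by (simp add: frame_matrix_def)
next
  case False
  then have e: "exp_sum (t (Suc a))" using a by (intro et) auto
  have "cpair (\<alpha> (Suc r)) (emb (\<alpha> (Suc s))) * B a r x = cpair (\<alpha> (Suc s)) (emb (\<alpha> (Suc r))) * B a s x"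
    using mirror_second_derivative[OF t a rs(1) x(1), of "emb (\<alpha> (Suc s))"]
      mirror_second_derivative[OF t a rs(2) x(2), of "emb (\<alpha> (Suc r))"] dir_deriv_commute[OF e] by metis
  then show ?thesis using no by (simp add: cpair_emb inner_commute)
qed

end

section \<open>The Gram minor on the stratum\<close>

lemma line_closed_stratum: "line_closed (stratum \<alpha> r s)"
proof -
  have "cpair b (x + c *s (y - x)) = cpair b x + c * (cpair b y - cpair b x)" for b c and x y :: "complex^('a option)"
    unfolding cpair_add cpair_smult by (simp add: cpair_def algebra_simps sum_subtractf)
  then show ?thesis unfolding line_closed_def stratum_def by simp
qed

lemma e_root_line_limit:
  assumes "cpair b x = 0"
  shows "((\<lambda>s. e_root b (x + s *s v) / s) \<longlongrightarrow> cpair b v) (at 0)"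
  using exp_sum_has_deriv[OF exp_sum_e_root, of b x v 0] assms
  by (simp add: DERIV_def dir_deriv_e_root) (simp add: e_root_def)

text \<open>
  The algebra behind the limit: \<open>d\<close> is the leading part of the determinant, \<open>U\<close> and \<open>V\<close> are its logarithmic
  derivatives times \<open>d\<close> in the two normal directions. For \<open>B = -A\<close> the left side is minus a perfect square.
\<close>

lemma leading_term_identity:
  fixes A B U V d :: complex
  assumes "U + V = of_nat N * d" "A + B = 0 \<or> N = 0 \<and> U = 0 \<and> V = 0"
  shows "(2 * A * (d + U)) * (2 * B * (d + V)) - (A * V + B * U)\<^sup>2 = (of_nat N + 2)\<^sup>2 * A * B * d\<^sup>2"
  using assms(2)
proof
  assume "A + B = 0"
  then have B: "B = - A" by (simp add: eq_neg_iff_add_eq_0 add.commute)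
  have "(2 * A * (d + U)) * (2 * B * (d + V)) - (A * V + B * U)\<^sup>2 = - (A\<^sup>2 * (2 * d + (U + V))\<^sup>2)"
    unfolding B by (simp add: power2_eq_square algebra_simps)
  then show ?thesis unfolding assms(1) B by (simp add: power2_eq_square algebra_simps)
qed (auto simp: power2_eq_square)

context root_data
begin

text \<open>
  Jacobi's identity expresses the minor through \<open>frame_inverse\<close> where the determinant is non-zero. The mirrors
  \<open>a\<close> and \<open>b\<close> vanish to first order on a line transversal to the stratum; dividing by the leading power of the
  determinant, every entry of \<open>frame_inverse\<close> has a limit, given by the leading terms. The factor obtained for
  points with \<open>d x \<noteq> 0\<close> does not depend on the point, so the identity extends to the whole stratum.
\<close>

lemma gram_minor_stratum:
  assumes t: "frame_matrix \<alpha> t B" and ab: "a < b" "b < \<ell>" and c: "c \<noteq> 0"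
    and id: "\<And>x j m. j \<le> \<ell> \<Longrightarrow> m \<le> \<ell> \<Longrightarrow>
      (\<Sum>l\<le>\<ell>. frame_inverse \<alpha> k B 0 j l x * frame_gram B c x $$ (l, m)) =
      (if j = m then (frame_det \<alpha> B x)\<^sup>2 else 0)"
    and nz: "frame_det \<alpha> B y \<noteq> 0"
    and alt: "(\<forall>x\<in>stratum \<alpha> (Suc a) (Suc b). frame_cofactor \<alpha> B 0 a x + frame_cofactor \<alpha> B 0 b x = 0) \<or>
      (\<exists>x\<in>stratum \<alpha> (Suc a) (Suc b). frame_det \<alpha> B x \<noteq> 0)"
  shows "\<exists>K. K \<noteq> 0 \<and> (\<forall>x\<in>stratum \<alpha> (Suc a) (Suc b).
    Determinant.det (mat_delete (mat_delete (frame_gram B c x) b b) a a) =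
      K * (frame_cofactor \<alpha> B 0 a x * frame_cofactor \<alpha> B 0 b x))"
proof -
  let ?n = "\<ell>" and ?D = "stratum \<alpha> (Suc a) (Suc b)"
  let ?\<delta> = "frame_det \<alpha> B" and ?C = "frame_cofactor \<alpha> B 0"
  let ?H = "\<lambda>j l x. frame_inverse \<alpha> k B 0 j l x"
  define M where "M x = Determinant.det (mat_delete (mat_delete (frame_gram B c x) b b) a a)" for x
  define wa where "wa = gamma_dual \<alpha> k a"
  define wb where "wb = gamma_dual \<alpha> k b"
  have a: "a < ?n" "a \<le> ?n" "b \<le> ?n" using ab by auto
  have wab: "cpair (\<alpha> (Suc a)) wa = 1" "cpair (\<alpha> (Suc a)) wb = 0" "cpair (\<alpha> (Suc b)) wa = 0" "cpair (\<alpha> (Suc b)) wb = 1"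
    using ab a cpair_simple_gamma_dual by (simp_all add: wa_def wb_def)
  note e\<delta> = exp_sum_frame_det[OF t]
  have eC: "exp_sum (?C l)" if "l \<le> ?n" for l by (rule exp_sum_frame_cofactor[OF t _ that]) simp
  have eM: "exp_sum M"
    unfolding M_def[abs_def]
  proof (rule exp_sum_det[where m = "?n - 1"])
    show "mat_delete (mat_delete (frame_gram B c x) b b) a a \<in> carrier_mat (?n - 1) (?n - 1)" for x
      using frame_gram_carrier[of B c x] by (auto simp: mat_delete_def)
    fix i j assume "i < ?n - 1" "j < ?n - 1"
    then show "exp_sum (\<lambda>x. mat_delete (mat_delete (frame_gram B c x) b b) a a $$ (i, j))"
      using ab by (auto simp: mat_delete_def frame_gram_carrier[THEN carrier_matD(1)] frame_gram_carrier[THEN carrier_matD(2)]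
          intro!: exp_sum_frame_gram[OF t])
  qed
  obtain \<epsilon> :: complex where \<epsilon>: "\<epsilon> \<noteq> 0" "\<And>c B x. Determinant.det (frame_gram B c x) = \<epsilon> * c ^ Suc ?n * (frame_det \<alpha> B x)\<^sup>2"
    using det_frame_gram[of \<alpha>] by blast
  define K where "K = \<epsilon> * c ^ Suc ?n"
  have K: "K \<noteq> 0" using \<epsilon>(1) c by (simp add: K_def)
  have jac: "(?\<delta> x)\<^sup>2 * M x = K * (?H a a x * ?H b b x - (?H a b x)\<^sup>2)" if "?\<delta> x \<noteq> 0" for x
  proof -
    have "Determinant.det (frame_gram B c x) * (?H a a x * ?H b b x - ?H a b x * ?H b a x) = ((?\<delta> x)\<^sup>2)\<^sup>2 * M x"
      unfolding M_def
    proof (rule complementary_minor[OF frame_gram_carrier ab(1)])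
      fix i j assume ij: "i < Suc ?n" "j < Suc ?n"
      then have ij': "i \<le> ?n" "j \<le> ?n" by auto
      have "(\<Sum>l<Suc ?n. frame_gram B c x $$ (i, l) * ?H l j x) = (\<Sum>l\<le>?n. ?H j l x * frame_gram B c x $$ (l, i))"
        unfolding lessThan_Suc_atMost
        using ij' by (intro sum.cong) (auto simp: frame_gram_sym[of i] frame_inverse_sym[of \<alpha> k B 0 j])
      then show "(\<Sum>l<Suc ?n. frame_gram B c x $$ (i, l) * ?H l j x) = (if i = j then (?\<delta> x)\<^sup>2 else 0)"
        using id[OF ij'(2,1)] by auto
    qed (use ab in simp)
    then have eq: "(?\<delta> x)\<^sup>2 * (K * (?H a a x * ?H b b x - (?H a b x)\<^sup>2)) = (?\<delta> x)\<^sup>2 * ((?\<delta> x)\<^sup>2 * M x)"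
      unfolding \<epsilon>(2) K_def frame_inverse_sym[of \<alpha> k B 0 b a] by (simp add: power2_eq_square mult_ac)
    have "(?\<delta> x)\<^sup>2 \<noteq> 0" using that by simp
    from mult_left_cancel[OF this, THEN iffD1, OF eq] show ?thesis by (rule sym)
  qed
  \<comment> \<open>every point is reached from the stratum in a normal direction\<close>
  define y1 where "y1 = y - (cpair (\<alpha> (Suc a)) y *s wa + cpair (\<alpha> (Suc b)) y *s wb)"
  have y1: "y1 \<in> ?D"
    using cpair_add(1)[of "\<alpha> (Suc a)" y1 "cpair (\<alpha> (Suc a)) y *s wa + cpair (\<alpha> (Suc b)) y *s wb"]
      cpair_add(1)[of "\<alpha> (Suc b)" y1 "cpair (\<alpha> (Suc a)) y *s wa + cpair (\<alpha> (Suc b)) y *s wb"]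
    by (simp add: y1_def stratum_def cpair_add(1) cpair_smult wab)
  have dec: "y = y1 + cpair (\<alpha> (Suc a)) y *s wa + cpair (\<alpha> (Suc b)) y *s wb"
    by (simp add: y1_def)
  obtain N :: nat and u v d d1 d2 where lead: "\<exists>x\<in>?D. d x \<noteq> 0" "exp_sum d"
    "\<And>x. u * d1 x + v * d2 x = of_nat N * d x"
    "\<And>x. x \<in> ?D \<Longrightarrow> ((\<lambda>s. ?\<delta> (x + s *s (u *s wa + v *s wb)) / s ^ N) \<longlongrightarrow> d x) (at 0)"
    "\<And>x. x \<in> ?D \<Longrightarrow> ((\<lambda>s. s * dir_deriv wa ?\<delta> (x + s *s (u *s wa + v *s wb)) / s ^ N) \<longlongrightarrow> d1 x) (at 0)"
    "\<And>x. x \<in> ?D \<Longrightarrow> ((\<lambda>s. s * dir_deriv wb ?\<delta> (x + s *s (u *s wa + v *s wb)) / s ^ N) \<longlongrightarrow> d2 x) (at 0)"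
    "\<And>x. x \<in> ?D \<Longrightarrow> ?\<delta> x \<noteq> 0 \<Longrightarrow> N = 0" "N = 0 \<Longrightarrow> d1 = (\<lambda>_. 0) \<and> d2 = (\<lambda>_. 0)"
    by (rule exp_sum_leading_term[OF e\<delta> nz dec y1]) (rule that)
  have main: "M x = K * (of_nat N + 2)\<^sup>2 * (?C a x * ?C b x)" if x: "x \<in> ?D" and dx: "d x \<noteq> 0" for x
  proof -
    define w where "w = u *s wa + v *s wb"
    define z where "z s = x + s *s w" for s
    have cw: "cpair (\<alpha> (Suc a)) w = u" "cpair (\<alpha> (Suc b)) w = v"
      by (simp_all add: w_def cpair_add cpair_smult wab)
    have x0: "cpair (\<alpha> (Suc a)) x = 0" "cpair (\<alpha> (Suc b)) x = 0" using x by (auto simp: stratum_def)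
    have line: "((\<lambda>s. g (z s)) \<longlongrightarrow> g x) (at 0)" if "exp_sum g" for g
      unfolding z_def by (rule exp_sum_tendsto_line[OF that])
    have \<delta>lim: "((\<lambda>s. ?\<delta> (z s) / s ^ N) \<longlongrightarrow> d x) (at 0)"
      and \<delta>a: "((\<lambda>s. s * dir_deriv wa ?\<delta> (z s) / s ^ N) \<longlongrightarrow> d1 x) (at 0)"
      and \<delta>b: "((\<lambda>s. s * dir_deriv wb ?\<delta> (z s) / s ^ N) \<longlongrightarrow> d2 x) (at 0)"
      using lead(4-6)[OF x] by (simp_all add: z_def w_def)
    have ma: "((\<lambda>s. mirror \<alpha> a (z s) / s) \<longlongrightarrow> u) (at 0)"
      using e_root_line_limit[OF x0(1), of w] a by (simp add: z_def mirror_def cw)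
    have mb: "((\<lambda>s. mirror \<alpha> b (z s) / s) \<longlongrightarrow> v) (at 0)"
      using e_root_line_limit[OF x0(2), of w] ab by (simp add: z_def mirror_def cw)
    have cosh1: "((\<lambda>s. cosh (cpair (\<alpha> (Suc i)) (z s) / 2)) \<longlongrightarrow> 1) (at 0)" if "cpair (\<alpha> (Suc i)) x = 0" for i
      using line[OF exp_sum_cosh[of "\<alpha> (Suc i)"]] that by simp
    \<comment> \<open>one summand of the inverse Gram matrix, rescaled\<close>
    have part: "((\<lambda>s. mirror \<alpha> i (z s) * (?\<delta> (z s) * dir_deriv w' (?C j) (z s) - ?C j (z s) * dir_deriv w' ?\<delta> (z s)) / s ^ N)
        \<longlongrightarrow> - (p * ?C j x * e)) (at 0)"
      if "j \<le> ?n" "((\<lambda>s. mirror \<alpha> i (z s) / s) \<longlongrightarrow> p) (at 0)"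
        "((\<lambda>s. s * dir_deriv w' ?\<delta> (z s) / s ^ N) \<longlongrightarrow> e) (at 0)" for i j p w' e
    proof -
      have "((\<lambda>s. (mirror \<alpha> i (z s) / s) * (s * (?\<delta> (z s) / s ^ N) * dir_deriv w' (?C j) (z s) -
          ?C j (z s) * (s * dir_deriv w' ?\<delta> (z s) / s ^ N)))
          \<longlongrightarrow> p * (0 * d x * dir_deriv w' (?C j) x - ?C j x * e)) (at 0)"
        by (intro tendsto_mult tendsto_diff that tendsto_ident_at \<delta>lim line eC exp_sum_dir_deriv)
      then have "((\<lambda>s. (mirror \<alpha> i (z s) / s) * (s * (?\<delta> (z s) / s ^ N) * dir_deriv w' (?C j) (z s) -
          ?C j (z s) * (s * dir_deriv w' ?\<delta> (z s) / s ^ N))) \<longlongrightarrow> - (p * ?C j x * e)) (at 0)"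
        by (simp add: mult_ac)
      then show ?thesis
        by (rule Lim_transform_eventually) (auto simp: eventually_at_filter field_simps)
    qed
    have diag: "((\<lambda>s. ?H i i (z s) / s ^ N) \<longlongrightarrow> 2 * ?C i x * (d x + p * e)) (at 0)"
      if i: "i < ?n" "cpair (\<alpha> (Suc i)) x = 0" and m: "((\<lambda>s. mirror \<alpha> i (z s) / s) \<longlongrightarrow> p) (at 0)"
        and D: "((\<lambda>s. s * dir_deriv (gamma_dual \<alpha> k i) ?\<delta> (z s) / s ^ N) \<longlongrightarrow> e) (at 0)" for i p e
    proof -
      have i': "i \<le> ?n" using i by simp
      let ?P = "\<lambda>s. mirror \<alpha> i (z s) * (?\<delta> (z s) * dir_deriv (gamma_dual \<alpha> k i) (?C i) (z s) -
          ?C i (z s) * dir_deriv (gamma_dual \<alpha> k i) ?\<delta> (z s)) / s ^ N"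
      have "((\<lambda>s. - (?P s + ?P s) + 2 * ?C i (z s) * (?\<delta> (z s) / s ^ N) * cosh (cpair (\<alpha> (Suc i)) (z s) / 2))
          \<longlongrightarrow> - (- (p * ?C i x * e) + - (p * ?C i x * e)) + 2 * ?C i x * d x * 1) (at 0)"
        by (intro tendsto_add tendsto_minus tendsto_mult tendsto_const part[OF i' m D] line eC[OF i'] \<delta>lim cosh1 i)
      moreover have "?H i i (z s) / s ^ N =
          - (?P s + ?P s) + 2 * ?C i (z s) * (?\<delta> (z s) / s ^ N) * cosh (cpair (\<alpha> (Suc i)) (z s) / 2)" for s
        using i by (simp add: frame_inverse_def add_divide_distrib diff_divide_distrib)
      ultimately have "((\<lambda>s. ?H i i (z s) / s ^ N)
          \<longlongrightarrow> - (- (p * ?C i x * e) + - (p * ?C i x * e)) + 2 * ?C i x * d x * 1) (at 0)"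
        by (simp only:)
      moreover have "- (- (p * ?C i x * e) + - (p * ?C i x * e)) + 2 * ?C i x * d x * 1 = 2 * ?C i x * (d x + p * e)"
        by (simp add: algebra_simps)
      ultimately show ?thesis by (simp only:)
    qed
    have Haa: "((\<lambda>s. ?H a a (z s) / s ^ N) \<longlongrightarrow> 2 * ?C a x * (d x + u * d1 x)) (at 0)"
      using diag[OF a(1) x0(1) ma] \<delta>a unfolding wa_def by blast
    have Hbb: "((\<lambda>s. ?H b b (z s) / s ^ N) \<longlongrightarrow> 2 * ?C b x * (d x + v * d2 x)) (at 0)"
      using diag[OF ab(2) x0(2) mb] \<delta>b unfolding wb_def by blast
    have Hab: "((\<lambda>s. ?H a b (z s) / s ^ N) \<longlongrightarrow> ?C a x * (v * d2 x) + ?C b x * (u * d1 x)) (at 0)"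
    proof -
      have "((\<lambda>s. - (mirror \<alpha> b (z s) * (?\<delta> (z s) * dir_deriv wb (?C a) (z s) - ?C a (z s) * dir_deriv wb ?\<delta> (z s)) / s ^ N +
          mirror \<alpha> a (z s) * (?\<delta> (z s) * dir_deriv wa (?C b) (z s) - ?C b (z s) * dir_deriv wa ?\<delta> (z s)) / s ^ N))
          \<longlongrightarrow> - (- (v * ?C a x * d2 x) + - (u * ?C b x * d1 x))) (at 0)"
        by (intro tendsto_minus tendsto_add part a ma mb \<delta>a \<delta>b)
      moreover have "?H a b (z s) / s ^ N =
          - (mirror \<alpha> b (z s) * (?\<delta> (z s) * dir_deriv wb (?C a) (z s) - ?C a (z s) * dir_deriv wb ?\<delta> (z s)) / s ^ N +
          mirror \<alpha> a (z s) * (?\<delta> (z s) * dir_deriv wa (?C b) (z s) - ?C b (z s) * dir_deriv wa ?\<delta> (z s)) / s ^ N)" for s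
        using ab(1) by (simp add: frame_inverse_def wa_def wb_def add_divide_distrib diff_divide_distrib)
      ultimately have "((\<lambda>s. ?H a b (z s) / s ^ N) \<longlongrightarrow> - (- (v * ?C a x * d2 x) + - (u * ?C b x * d1 x))) (at 0)"
        by (simp only:)
      moreover have "- (- (v * ?C a x * d2 x) + - (u * ?C b x * d1 x)) = ?C a x * (v * d2 x) + ?C b x * (u * d1 x)"
        by (simp add: algebra_simps)
      ultimately show ?thesis by (simp only:)
    qed
    have L1: "((\<lambda>s. K * ((?H a a (z s) / s ^ N) * (?H b b (z s) / s ^ N) - (?H a b (z s) / s ^ N)\<^sup>2)) \<longlongrightarrow>
        K * ((2 * ?C a x * (d x + u * d1 x)) * (2 * ?C b x * (d x + v * d2 x)) -
          (?C a x * (v * d2 x) + ?C b x * (u * d1 x))\<^sup>2)) (at 0)"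
      by (intro tendsto_mult tendsto_diff tendsto_power tendsto_const Haa Hbb Hab)
    have L2: "((\<lambda>s. (?\<delta> (z s) / s ^ N)\<^sup>2 * M (z s)) \<longlongrightarrow> (d x)\<^sup>2 * M x) (at 0)"
      by (intro tendsto_mult tendsto_power \<delta>lim line eM)
    have "\<forall>\<^sub>F s in at 0. ?\<delta> (z s) / s ^ N \<noteq> 0"
      by (rule tendsto_imp_eventually_ne[OF \<delta>lim dx])
    then have "\<forall>\<^sub>F s in at 0. (?\<delta> (z s) / s ^ N)\<^sup>2 * M (z s) =
        K * ((?H a a (z s) / s ^ N) * (?H b b (z s) / s ^ N) - (?H a b (z s) / s ^ N)\<^sup>2)"
    proof eventually_elim
      case (elim s)
      then have "?\<delta> (z s) \<noteq> 0" by auto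
      note eq = jac[OF this]
      have "(?\<delta> (z s) / s ^ N)\<^sup>2 * M (z s) = ((?\<delta> (z s))\<^sup>2 * M (z s)) / (s ^ N)\<^sup>2"
        by (simp add: power_divide)
      also have "\<dots> = K * (?H a a (z s) * ?H b b (z s) - (?H a b (z s))\<^sup>2) / (s ^ N)\<^sup>2"
        unfolding eq ..
      also have "\<dots> = K * ((?H a a (z s) / s ^ N) * (?H b b (z s) / s ^ N) - (?H a b (z s) / s ^ N)\<^sup>2)"
        by (simp add: power2_eq_square diff_divide_distrib right_diff_distrib)
      finally show ?case .
    qed
    then have "((\<lambda>s. (?\<delta> (z s) / s ^ N)\<^sup>2 * M (z s)) \<longlongrightarrow>
        K * ((2 * ?C a x * (d x + u * d1 x)) * (2 * ?C b x * (d x + v * d2 x)) -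
          (?C a x * (v * d2 x) + ?C b x * (u * d1 x))\<^sup>2)) (at 0)"
      by (intro Lim_transform_eventually[OF L1]) (simp add: eq_commute)
    then have "(d x)\<^sup>2 * M x = K * ((2 * ?C a x * (d x + u * d1 x)) * (2 * ?C b x * (d x + v * d2 x)) -
          (?C a x * (v * d2 x) + ?C b x * (u * d1 x))\<^sup>2)"
      by (rule LIM_unique[OF L2])
    also have "\<dots> = K * ((of_nat N + 2)\<^sup>2 * ?C a x * ?C b x * (d x)\<^sup>2)"
    proof (rule arg_cong[where f = "\<lambda>q. K * q"], rule leading_term_identity)
      show "u * d1 x + v * d2 x = of_nat N * d x" by (rule lead(3))
      show "?C a x + ?C b x = 0 \<or> N = 0 \<and> u * d1 x = 0 \<and> v * d2 x = 0"
        using alt lead(7,8) x by auto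
    qed
    finally have "(d x)\<^sup>2 * M x = (d x)\<^sup>2 * (K * (of_nat N + 2)\<^sup>2 * (?C a x * ?C b x))" by (simp add: mult_ac)
    then show ?thesis using dx by simp
  qed
  have "M x = K * (of_nat N + 2)\<^sup>2 * (?C a x * ?C b x)" if x: "x \<in> ?D" for x
  proof -
    obtain x1 where x1: "x1 \<in> ?D" "d x1 \<noteq> 0" using lead(1) by blast
    have "M x - K * (of_nat N + 2)\<^sup>2 * (?C a x * ?C b x) = 0"
      by (rule exp_sum_zero_on[OF lead(2) _ line_closed_stratum x1(1) x1(2) _ x,
            of "\<lambda>x. M x - K * (of_nat N + 2)\<^sup>2 * (?C a x * ?C b x)"])
         (use main a in \<open>auto intro!: exp_sum_diff exp_sum_mult exp_sum_const eM eC\<close>)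
    then show ?thesis by simp
  qed
  moreover have "K * (of_nat N + 2)\<^sup>2 \<noteq> 0"
  proof -
    have "of_nat N + 2 = (of_nat (N + 2) :: complex)" by simp
    then have "(of_nat N + 2 :: complex) \<noteq> 0" by (metis of_nat_eq_0_iff add_is_0 numeral_eq_Suc Zero_not_Suc)
    then show ?thesis using K by simp
  qed
  ultimately show ?thesis unfolding M_def by blast
qed

end

section \<open>The restricted Gram matrix and the reduced minors\<close>

text \<open>
  The increasing enumeration of the indices different from \<open>a\<close> and \<open>b\<close>, for \<open>a < b\<close>.
\<close>

definition skip_two :: "nat \<Rightarrow> nat \<Rightarrow> nat \<Rightarrow> nat" where
  "skip_two a b i = insert_index b (insert_index a i)"

lemma skip_two_strict_mono: "i < j \<Longrightarrow> skip_two a b i < skip_two a b j"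
  by (auto simp: skip_two_def insert_index_def)

lemma skip_two_image:
  assumes "a < b" "b \<le> m" shows "skip_two a b ` {..<m - 1} = {..m} - {a, b}"
proof
  show "skip_two a b ` {..<m - 1} \<subseteq> {..m} - {a, b}"
    using assms by (auto simp: skip_two_def insert_index_def)
  show "{..m} - {a, b} \<subseteq> skip_two a b ` {..<m - 1}"
  proof
    fix j assume j: "j \<in> {..m} - {a, b}"
    define i where "i = (if j < a then j else if j < b then j - 1 else j - 2)"
    have "i < m - 1" "skip_two a b i = j"
      using j assms by (auto simp: i_def skip_two_def insert_index_def)
    then show "j \<in> skip_two a b ` {..<m - 1}" by auto
  qed
qed

lemma mat_delete_twice:
  assumes "G \<in> carrier_mat (Suc m) (Suc m)" "a < b" "b \<le> m"
  shows "mat_delete (mat_delete G b b) a a = mat (m - 1) (m - 1) (\<lambda>(i, j). G $$ (skip_two a b i, skip_two a b j))"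
  using assms by (intro eq_matI) (auto simp: mat_delete_def skip_two_def insert_index_def)

lemma filter_skip_two:
  assumes "a < b" "b \<le> m"
  shows "filter (\<lambda>i. i \<noteq> Suc a \<and> i \<noteq> Suc b) [1..<m + 2] = map (\<lambda>i. Suc (skip_two a b i)) [0..<m - 1]"
proof (rule strict_sorted_equal)
  show "sorted_wrt (<) (filter (\<lambda>i. i \<noteq> Suc a \<and> i \<noteq> Suc b) [1..<m + 2])"
    by (intro sorted_wrt_filter sorted_wrt_upt)
  show "sorted_wrt (<) (map (\<lambda>i. Suc (skip_two a b i)) [0..<m - 1])"
    by (auto simp: sorted_wrt_iff_nth_less skip_two_strict_mono)
  have "set (map (\<lambda>i. Suc (skip_two a b i)) [0..<m - 1]) = Suc ` (skip_two a b ` {..<m - 1})"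
    unfolding set_map set_upt atLeast0LessThan image_image ..
  also have "\<dots> = Suc ` {..m} - {Suc a, Suc b}"
    unfolding skip_two_image[OF assms] by blast
  also have "Suc ` {..m} = {1..<m + 2}"
    unfolding image_Suc_atMost by fastforce
  also have "{1..<m + 2} - {Suc a, Suc b} = set (filter (\<lambda>i. i \<noteq> Suc a \<and> i \<noteq> Suc b) [1..<m + 2])"
    unfolding set_filter set_upt by blast
  finally show "set (filter (\<lambda>i. i \<noteq> Suc a \<and> i \<noteq> Suc b) [1..<m + 2]) =
      set (map (\<lambda>i. Suc (skip_two a b i)) [0..<m - 1])" by (rule sym)
qed

context root_data
begin

lemma gram_simple_pos:
  assumes "r \<in> I" "s \<in> I" "r \<noteq> s"
  shows "(\<alpha> r \<bullet> \<alpha> r) * (\<alpha> s \<bullet> \<alpha> s) - (\<alpha> r \<bullet> \<alpha> s)\<^sup>2 > 0"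
proof -
  let ?u = "(\<alpha> s \<bullet> \<alpha> s) *\<^sub>R \<alpha> r - (\<alpha> r \<bullet> \<alpha> s) *\<^sub>R \<alpha> s"
  have "?u \<bullet> fund_coweight \<alpha> r = \<alpha> s \<bullet> \<alpha> s"
    using assms by (simp add: inner_diff_left inner_commute[of "\<alpha> _" "fund_coweight \<alpha> _"] coweight_simple)
  then have "?u \<noteq> 0" using simple_norm_pos[OF assms(2)] by auto
  then have "?u \<bullet> ?u > 0" by simp
  also have "?u \<bullet> ?u = (\<alpha> s \<bullet> \<alpha> s) * ((\<alpha> r \<bullet> \<alpha> r) * (\<alpha> s \<bullet> \<alpha> s) - (\<alpha> r \<bullet> \<alpha> s)\<^sup>2)"
    by (simp add: inner_diff_left inner_diff_right inner_commute[of "\<alpha> s" "\<alpha> r"] power2_eq_square algebra_simps)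
  finally show ?thesis using simple_norm_pos[OF assms(2)] by (simp add: zero_less_mult_iff)
qed

text \<open>
  The Gram determinant of two distinct simple roots is positive.
\<close>

lemma stratum_normal_solution:
  assumes rs: "r \<in> I" "s \<in> I" "r \<noteq> s"
  shows "\<exists>p0 q0. \<forall>p q. (p * complex_of_real (\<alpha> r \<bullet> \<alpha> r) + q * complex_of_real (\<alpha> r \<bullet> \<alpha> s) = A \<and>
    p * complex_of_real (\<alpha> r \<bullet> \<alpha> s) + q * complex_of_real (\<alpha> s \<bullet> \<alpha> s) = B) \<longleftrightarrow> (p = p0 \<and> q = q0)"
proof -
  define m n c where "m = complex_of_real (\<alpha> r \<bullet> \<alpha> r)" and "n = complex_of_real (\<alpha> s \<bullet> \<alpha> s)"
    and "c = complex_of_real (\<alpha> r \<bullet> \<alpha> s)"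
  define \<Delta> where "\<Delta> = m * n - c * c"
  have "\<Delta> = complex_of_real ((\<alpha> r \<bullet> \<alpha> r) * (\<alpha> s \<bullet> \<alpha> s) - (\<alpha> r \<bullet> \<alpha> s)\<^sup>2)"
    by (simp add: \<Delta>_def m_def n_def c_def power2_eq_square)
  then have nz: "\<Delta> \<noteq> 0" using gram_simple_pos[OF rs] by (simp only: of_real_eq_0_iff)
  have iff: "(p * m + q * c = A \<and> p * c + q * n = B) \<longleftrightarrow> (p = (A * n - B * c) / \<Delta> \<and> q = (B * m - A * c) / \<Delta>)" for p q
  proof
    assume "p * m + q * c = A \<and> p * c + q * n = B"
    moreover have "p * \<Delta> = (p * m + q * c) * n - (p * c + q * n) * c" "q * \<Delta> = (p * c + q * n) * m - (p * m + q * c) * c"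
      by (simp_all add: \<Delta>_def algebra_simps)
    ultimately have "p * \<Delta> = A * n - B * c" "q * \<Delta> = B * m - A * c" by simp_all
    then show "p = (A * n - B * c) / \<Delta> \<and> q = (B * m - A * c) / \<Delta>" using nz by (simp add: eq_divide_eq)
  next
    assume h: "p = (A * n - B * c) / \<Delta> \<and> q = (B * m - A * c) / \<Delta>"
    have "p * m + q * c = ((A * n - B * c) * m + (B * m - A * c) * c) / \<Delta>"
      "p * c + q * n = ((A * n - B * c) * c + (B * m - A * c) * n) / \<Delta>"
      using h by (simp_all add: add_divide_distrib)
    moreover have "((A * n - B * c) * m + (B * m - A * c) * c) = A * \<Delta>" "((A * n - B * c) * c + (B * m - A * c) * n) = B * \<Delta>"
      by (simp_all add: \<Delta>_def algebra_simps)
    ultimately show "p * m + q * c = A \<and> p * c + q * n = B" using nz by simp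
  qed
  show ?thesis
    unfolding m_def[symmetric] n_def[symmetric] c_def[symmetric] iff by blast
qed

text \<open>
  The coordinate vector exists and is unique: it differs from a frame vector by the combination of \<open>\<alpha> r\<close> and
  \<open>\<alpha> s\<close> that makes it tangent to the stratum.
\<close>

lemma stratum_vec_properties:
  assumes rs: "r \<in> I" "s \<in> I" "r \<noteq> s" and i: "i \<in> {1..\<ell> + 1} - {r, s}"
  shows "\<forall>j\<in>{1..\<ell> + 1} - {r, s}. lin_coord \<alpha> j (stratum_vec \<alpha> r s i) = (if i = j then 1 else 0)"
proof -
  let ?P = "\<lambda>v. v \<in> stratum \<alpha> r s \<and> (\<forall>j\<in>{1..\<ell> + 1} - {r, s}. lin_coord \<alpha> j v = (if i = j then 1 else 0))"
  have unit: "lin_coord \<alpha> j (emb (\<alpha> l)) = (if j = l then 1 else 0)" if "j \<in> {1..\<ell> + 1}" "l \<in> I" for j l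
  proof -
    have "Suc (j - 1) = j" "Suc (l - 1) = l" "l - 1 < \<ell>" "j - 1 \<le> \<ell>" "j - 1 = l - 1 \<longleftrightarrow> j = l"
      using that by auto
    then show ?thesis using lin_coord_frame[of "j - 1" "l - 1"] by (simp add: frame_def)
  qed
  define i0 where "i0 = i - 1"
  have frame_unit: "lin_coord \<alpha> j (frame \<alpha> i0) = (if i = j then 1 else 0)" if "j \<in> {1..\<ell> + 1}" for j
  proof -
    have "Suc (j - 1) = j" "j - 1 \<le> \<ell>" "i0 \<le> \<ell>" "j - 1 = i0 \<longleftrightarrow> i = j"
      using that i by (auto simp: i0_def)
    then show ?thesis using lin_coord_frame[of "j - 1" i0] by simp
  qed
  have "\<exists>!v. ?P v"
  proof (rule ex_ex1I)
    define A where "A = cpair (\<alpha> r) (frame \<alpha> i0)"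
    define B where "B = cpair (\<alpha> s) (frame \<alpha> i0)"
    obtain p q where pq: "p * complex_of_real (\<alpha> r \<bullet> \<alpha> r) + q * complex_of_real (\<alpha> r \<bullet> \<alpha> s) = A"
      "p * complex_of_real (\<alpha> r \<bullet> \<alpha> s) + q * complex_of_real (\<alpha> s \<bullet> \<alpha> s) = B"
      using stratum_normal_solution[OF rs, of A B] by blast
    define v where "v = frame \<alpha> i0 + ((- p) *s emb (\<alpha> r) + (- q) *s emb (\<alpha> s))"
    have "cpair (\<alpha> r) v = 0" "cpair (\<alpha> s) v = 0"
      unfolding v_def cpair_add cpair_smult cpair_emb A_def[symmetric] B_def[symmetric] pq[symmetric]
      by (simp_all add: inner_commute[of "\<alpha> s" "\<alpha> r"])
    moreover have "lin_coord \<alpha> j v = (if i = j then 1 else 0)" if "j \<in> {1..\<ell> + 1} - {r, s}" for j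
      unfolding v_def lin_coord_add lin_coord_smult using that rs by (simp add: unit frame_unit)
    ultimately have "?P v" by (simp add: stratum_def)
    then show "\<exists>v. ?P v" by blast
  next
    fix v w assume v: "?P v" and w: "?P w"
    define z where "z = v - w"
    have lz: "lin_coord \<alpha> j z = lin_coord \<alpha> j v - lin_coord \<alpha> j w" for j
      using lin_coord_add[of j z w] by (simp add: z_def)
    have cz: "cpair b z = cpair b v - cpair b w" for b
      using cpair_add(1)[of b z w] by (simp add: z_def)
    have z0: "lin_coord \<alpha> j z = 0" if "j \<in> {1..\<ell> + 1} - {r, s}" for j
      using v w that by (simp add: lz)
    have "z = (\<Sum>l\<le>\<ell>. lin_coord \<alpha> (Suc l) z *s frame \<alpha> l)" by (rule frame_expansion)
    also have "\<dots> = (\<Sum>l\<in>{r - 1, s - 1}. lin_coord \<alpha> (Suc l) z *s frame \<alpha> l)"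
    proof (rule sum.mono_neutral_right)
      show "\<forall>l\<in>{..\<ell>} - {r - 1, s - 1}. lin_coord \<alpha> (Suc l) z *s frame \<alpha> l = 0"
      proof
        fix l assume "l \<in> {..\<ell>} - {r - 1, s - 1}"
        then have "Suc l \<in> {1..\<ell> + 1} - {r, s}" by auto
        then show "lin_coord \<alpha> (Suc l) z *s frame \<alpha> l = 0" by (simp only: z0) simp
      qed
    qed (use rs in auto)
    also have "\<dots> = lin_coord \<alpha> r z *s emb (\<alpha> r) + lin_coord \<alpha> s z *s emb (\<alpha> s)"
      using rs by (auto simp: frame_def)
    finally have z: "z = lin_coord \<alpha> r z *s emb (\<alpha> r) + lin_coord \<alpha> s z *s emb (\<alpha> s)" .
    define p where "p = lin_coord \<alpha> r z"
    define q where "q = lin_coord \<alpha> s z"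
    have z: "z = p *s emb (\<alpha> r) + q *s emb (\<alpha> s)" unfolding p_def q_def by (rule z)
    have "cpair b z = p * complex_of_real (b \<bullet> \<alpha> r) + q * complex_of_real (b \<bullet> \<alpha> s)" for b
      unfolding z cpair_add cpair_smult cpair_emb ..
    moreover have "cpair (\<alpha> r) z = 0" "cpair (\<alpha> s) z = 0" using v w by (auto simp: stratum_def cz)
    ultimately have "p * complex_of_real (\<alpha> r \<bullet> \<alpha> r) + q * complex_of_real (\<alpha> r \<bullet> \<alpha> s) = 0 \<and>
      p * complex_of_real (\<alpha> r \<bullet> \<alpha> s) + q * complex_of_real (\<alpha> s \<bullet> \<alpha> s) = 0"
      by (simp add: inner_commute[of "\<alpha> s" "\<alpha> r"])
    moreover have "0 * complex_of_real (\<alpha> r \<bullet> \<alpha> r) + 0 * complex_of_real (\<alpha> r \<bullet> \<alpha> s) = 0 \<and>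
      0 * complex_of_real (\<alpha> r \<bullet> \<alpha> s) + 0 * complex_of_real (\<alpha> s \<bullet> \<alpha> s) = 0" by simp
    ultimately have "p = 0 \<and> q = 0"
      using stratum_normal_solution[OF rs, of 0 0] by metis
    then have "z = 0" using z by simp
    then show "v = w" by (simp add: z_def)
  qed
  from theI'[OF this] show ?thesis unfolding stratum_vec_def by blast
qed

text \<open>
  On the stratum all \<open>dt\<close> annihilate \<open>\<alpha> r\<close> and \<open>\<alpha> s\<close>, so the tangent vectors may be replaced by frame vectors.
\<close>

lemma det_restricted_gram:
  assumes t: "frame_matrix \<alpha> t B" and ab: "a < b" "b < \<ell>"
    and rs: "r \<noteq> s" "{r, s} = {Suc a, Suc b}"
    and sm: "\<And>u v. saito_metric R \<alpha> k \<kappa> x u v = cov_metric t c x u v"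
    and x: "x \<in> stratum \<alpha> r s"
  shows "Determinant.det (restricted_gram R \<alpha> k \<kappa> r s x) =
    (\<Prod>i\<in>I - {r, s}. (e_root (\<alpha> i) x)\<^sup>2) * Determinant.det (mat_delete (mat_delete (frame_gram B c x) b b) a a)"
proof -
  let ?n = "\<ell>"
  let ?N = "?n - 1"
  let ?f = "skip_two a b"
  have rsI: "r \<in> I" "s \<in> I" using rs ab by (auto simp: doubleton_eq_iff)
  have filt: "filter (\<lambda>i. i \<noteq> r \<and> i \<noteq> s) [1..<?n + 2] = map (\<lambda>i. Suc (?f i)) [0..<?N]"
  proof -
    have "(i \<noteq> r \<and> i \<noteq> s) \<longleftrightarrow> (i \<noteq> Suc a \<and> i \<noteq> Suc b)" for i using rs(2) by (metis insert_iff singletonD)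
    then show ?thesis using filter_skip_two[of a b ?n] ab by simp
  qed
  have f_range: "?f i \<le> ?n" "?f i \<noteq> a" "?f i \<noteq> b" if "i < ?N" for i
  proof -
    have "?f i \<in> ?f ` {..<?N}" using that by blast
    then have "?f i \<in> {..?n} - {a, b}" using skip_two_image[of a b ?n] ab by simp
    then show "?f i \<le> ?n" "?f i \<noteq> a" "?f i \<noteq> b" by auto
  qed
  have m0: "mirror \<alpha> a x = 0" "mirror \<alpha> b x = 0"
  proof -
    have "cpair (\<alpha> (Suc a)) x = 0" "cpair (\<alpha> (Suc b)) x = 0"
      using x rs(2) by (auto simp: stratum_def doubleton_eq_iff)
    then show "mirror \<alpha> a x = 0" "mirror \<alpha> b x = 0" using ab by (simp_all add: mirror_def e_root_def)
  qed
  have der: "dir_deriv (stratum_vec \<alpha> r s (Suc (?f i))) (t (Suc p)) x = mirror \<alpha> (?f i) x * B p (?f i) x"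
    if i: "i < ?N" and p: "p \<le> ?n" for i p
  proof -
    have S: "Suc (?f i) \<in> {1..?n + 1} - {r, s}" using f_range[OF i] rs(2) by auto
    have "dir_deriv (stratum_vec \<alpha> r s (Suc (?f i))) (t (Suc p)) x =
        (\<Sum>l\<le>?n. lin_coord \<alpha> (Suc l) (stratum_vec \<alpha> r s (Suc (?f i))) * (mirror \<alpha> l x * B p l x))"
      using t p by (simp add: frame_matrix_def)
    also have "\<dots> = (\<Sum>l\<le>?n. if l = ?f i then mirror \<alpha> l x * B p l x else 0)"
    proof (rule sum.cong)
      fix l assume l: "l \<in> {..?n}"
      show "lin_coord \<alpha> (Suc l) (stratum_vec \<alpha> r s (Suc (?f i))) * (mirror \<alpha> l x * B p l x) =
          (if l = ?f i then mirror \<alpha> l x * B p l x else 0)"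
      proof (cases "l = a \<or> l = b")
        case True
        then show ?thesis using m0 by auto
      next
        case False
        then have "Suc l \<in> {1..?n + 1} - {r, s}" using l rs(2) by auto
        then show ?thesis using stratum_vec_properties[OF rsI rs(1) S] by auto
      qed
    qed simp
    also have "\<dots> = mirror \<alpha> (?f i) x * B p (?f i) x" using f_range(1)[OF i] by simp
    finally show ?thesis .
  qed
  have dims: "dim_row (restricted_gram R \<alpha> k \<kappa> r s x) = ?N" "dim_col (restricted_gram R \<alpha> k \<kappa> r s x) = ?N"
    unfolding restricted_gram_def filt Let_def by simp_all
  have "restricted_gram R \<alpha> k \<kappa> r s x =
      mat ?N ?N (\<lambda>(i, j). mirror \<alpha> (?f i) x * mirror \<alpha> (?f j) x * frame_gram B c x $$ (?f i, ?f j))"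
  proof (rule eq_matI)
    fix i j
    assume "i < dim_row (mat ?N ?N (\<lambda>(i, j). mirror \<alpha> (?f i) x * mirror \<alpha> (?f j) x * frame_gram B c x $$ (?f i, ?f j)))"
      "j < dim_col (mat ?N ?N (\<lambda>(i, j). mirror \<alpha> (?f i) x * mirror \<alpha> (?f j) x * frame_gram B c x $$ (?f i, ?f j)))"
    then have ij: "i < ?N" "j < ?N" by auto
    have "restricted_gram R \<alpha> k \<kappa> r s x $$ (i, j) =
        cov_metric t c x (stratum_vec \<alpha> r s (Suc (?f i))) (stratum_vec \<alpha> r s (Suc (?f j)))"
      unfolding restricted_gram_def filt Let_def using ij by (simp add: sm)
    also have "\<dots> = mirror \<alpha> (?f i) x * mirror \<alpha> (?f j) x * frame_gram B c x $$ (?f i, ?f j)"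
      using ij f_range(1)[OF ij(1)] f_range(1)[OF ij(2)]
      by (simp add: cov_metric_def der frame_gram_def less_Suc_eq_le sum_distrib_left mult_ac)
    finally show "restricted_gram R \<alpha> k \<kappa> r s x $$ (i, j) =
        mat ?N ?N (\<lambda>(i, j). mirror \<alpha> (?f i) x * mirror \<alpha> (?f j) x * frame_gram B c x $$ (?f i, ?f j)) $$ (i, j)"
      using ij by simp
  qed (simp_all add: dims)
  then have "Determinant.det (restricted_gram R \<alpha> k \<kappa> r s x) =
      (\<Prod>i<?N. mirror \<alpha> (?f i) x) * (\<Prod>i<?N. mirror \<alpha> (?f i) x) *
      Determinant.det (mat ?N ?N (\<lambda>(i, j). frame_gram B c x $$ (?f i, ?f j)))"
    by (simp only: det_scale_rows_columns)
  also have "mat ?N ?N (\<lambda>(i, j). frame_gram B c x $$ (?f i, ?f j)) = mat_delete (mat_delete (frame_gram B c x) b b) a a"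
    using mat_delete_twice[OF frame_gram_carrier[of B c x] ab(1)] ab by simp
  also have "(\<Prod>i<?N. mirror \<alpha> (?f i) x) = (\<Prod>i\<in>I - {r, s}. e_root (\<alpha> i) x)"
  proof -
    have inj: "inj_on ?f {..<?N}"
      by (rule inj_onI) (metis skip_two_strict_mono less_irrefl linorder_neqE_nat)
    have "(\<Prod>i<?N. mirror \<alpha> (?f i) x) = (\<Prod>l\<in>{..?n} - {a, b}. mirror \<alpha> l x)"
      using prod.reindex[OF inj, of "\<lambda>l. mirror \<alpha> l x"] skip_two_image[of a b ?n] ab by simp
    also have "\<dots> = (\<Prod>l\<in>{..<?n} - {a, b}. mirror \<alpha> l x)"
      by (rule prod.mono_neutral_right) (auto simp: mirror_def)
    also have "\<dots> = (\<Prod>i\<in>I - {Suc a, Suc b}. e_root (\<alpha> i) x)"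
      by (rule prod.reindex_bij_witness[of _ "\<lambda>i. i - 1" Suc]) (auto simp: mirror_def)
    finally show ?thesis using rs(2) by simp
  qed
  finally show ?thesis by (simp add: power2_eq_square prod.distrib)
qed

text \<open>
  In \<open>J\<^sub>m\<close> the column \<open>j\<close> is divisible by the \<open>j\<close>-th mirror factor, and the quotient is a minor of \<open>B\<close>. It is the only
  Fourier polynomial with this property, since the product of the mirror factors is not identically zero.
  The sign is that of the cofactor.
\<close>

lemma reduced_minor_cofactor:
  assumes t: "frame_matrix \<alpha> t B" and fB: "\<And>a l. a < \<ell> \<Longrightarrow> l < \<ell> \<Longrightarrow> fourier_poly R (B a l)"
    and m: "m \<in> I" and mnz: "\<exists>x. mirror_product \<alpha> x \<noteq> 0"
  shows "frame_cofactor \<alpha> B 0 (m - 1) x = (- 1) ^ (m - 1) * reduced_minor_I R \<alpha> t m x"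
proof -
  let ?n = "\<ell>"
  let ?N = "?n - 1"
  let ?f = "insert_index (m - 1)"
  have n: "Suc ?N = ?n" using m by auto
  define g where "g x = Determinant.det (mat ?N ?N (\<lambda>(i, j). B (Suc i) (?f j) x))" for x
  have f_lt: "?f j < ?n" if "j < ?N" for j using that by (auto simp: insert_index_def)
  have f_img: "?f ` {..<?N} = {..<?n} - {m - 1}"
  proof
    show "?f ` {..<?N} \<subseteq> {..<?n} - {m - 1}" using f_lt by (auto simp: insert_index_def)
    show "{..<?n} - {m - 1} \<subseteq> ?f ` {..<?N}"
    proof
      fix j assume j: "j \<in> {..<?n} - {m - 1}"
      define i where "i = (if j < m - 1 then j else j - 1)"
      have "i < ?N" "?f i = j" using j m by (auto simp: i_def insert_index_def)
      then show "j \<in> ?f ` {..<?N}" by auto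
    qed
  qed
  have f_inj: "inj_on ?f {..<?N}" by (auto simp: inj_on_def insert_index_def split: if_splits)
  have mp: "(\<Prod>j<?N. mirror \<alpha> (?f j) x) = (\<Prod>i\<in>I - {m}. e_root (\<alpha> i) x)" for x
  proof -
    have "(\<Prod>j<?N. mirror \<alpha> (?f j) x) = (\<Prod>l\<in>{..<?n} - {m - 1}. mirror \<alpha> l x)"
      using prod.reindex[OF f_inj, of "\<lambda>l. mirror \<alpha> l x"] f_img by simp
    also have "\<dots> = (\<Prod>i\<in>I - {m}. e_root (\<alpha> i) x)"
      by (rule prod.reindex_bij_witness[of _ "\<lambda>i. i - 1" Suc]) (use m in \<open>auto simp: mirror_def\<close>)
    finally show ?thesis .
  qed
  have fg: "fourier_poly R g"
    unfolding g_def[abs_def] by (rule fourier_poly_det[where m = ?N]) (use f_lt n in \<open>auto intro!: fB\<close>)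
  have gJ: "g x * (\<Prod>i\<in>I - {m}. e_root (\<alpha> i) x) = minor_J \<alpha> t m x" for x
  proof -
    have "mat_delete (mat ?n ?n (\<lambda>(i, j). dir_deriv (emb (\<alpha> (j + 1))) (t (i + 1)) x)) 0 (m - 1) =
        mat ?N ?N (\<lambda>(i, j). 1 * mirror \<alpha> (?f j) x * B (Suc i) (?f j) x)"
    proof (rule eq_matI)
      fix i j assume "i < dim_row (mat ?N ?N (\<lambda>(i, j). 1 * mirror \<alpha> (?f j) x * B (Suc i) (?f j) x))"
        "j < dim_col (mat ?N ?N (\<lambda>(i, j). 1 * mirror \<alpha> (?f j) x * B (Suc i) (?f j) x))"
      then have ij: "i < ?N" "j < ?N" by auto
      have "mat_delete (mat ?n ?n (\<lambda>(i, j). dir_deriv (emb (\<alpha> (j + 1))) (t (i + 1)) x)) 0 (m - 1) $$ (i, j) =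
          dir_deriv (emb (\<alpha> (Suc (?f j)))) (t (Suc (Suc i))) x"
        using ij f_lt[OF ij(2)] by (auto simp: mat_delete_def insert_index_def)
      also have "\<dots> = mirror \<alpha> (?f j) x * B (Suc i) (?f j) x"
        using dir_deriv_frame_vector[OF t, of "Suc i" "?f j" x] f_lt[OF ij(2)] ij by (simp add: frame_def)
      finally show "mat_delete (mat ?n ?n (\<lambda>(i, j). dir_deriv (emb (\<alpha> (j + 1))) (t (i + 1)) x)) 0 (m - 1) $$ (i, j) =
          mat ?N ?N (\<lambda>(i, j). 1 * mirror \<alpha> (?f j) x * B (Suc i) (?f j) x) $$ (i, j)"
        using ij by simp
    qed auto
    then have "minor_J \<alpha> t m x = Determinant.det (mat ?N ?N (\<lambda>(i, j). 1 * mirror \<alpha> (?f j) x * B (Suc i) (?f j) x))"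
      unfolding minor_J_def by (simp only:)
    then show ?thesis unfolding det_scale_rows_columns g_def mp[symmetric] by simp
  qed
  have uniq: "h = g" if h: "fourier_poly R h" "\<And>x. h x * (\<Prod>i\<in>I - {m}. e_root (\<alpha> i) x) = minor_J \<alpha> t m x" for h
  proof
    fix x
    have e: "exp_sum (\<lambda>x. \<Prod>i\<in>I - {m}. e_root (\<alpha> i) x)" by (intro exp_sum_prod exp_sum_e_root)
    obtain x1 where x1: "mirror_product \<alpha> x1 \<noteq> 0" using mnz by blast
    have ne: "(\<Prod>i\<in>I - {m}. e_root (\<alpha> i) x1) \<noteq> 0"
    proof -
      have "mirror \<alpha> l x1 \<noteq> 0" if "l < ?n" for l
        using x1 that by (auto simp: mirror_product_def)
      then show ?thesis unfolding mp[symmetric] using f_lt by auto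
    qed
    have "h z - g z = 0" if "(\<Prod>i\<in>I - {m}. e_root (\<alpha> i) z) \<noteq> 0" for z
      using mult_right_cancel[OF that, THEN iffD1, OF trans[OF h(2) gJ[symmetric]]] by simp
    then have "h x - g x = 0"
      by (rule exp_sum_zero_on[OF e exp_sum_diff[OF fourier_poly_exp_sum[OF h(1)] fourier_poly_exp_sum[OF fg]]
            line_closed_UNIV UNIV_I ne _ UNIV_I])
    then show "h x = g x" by simp
  qed
  have "reduced_minor_I R \<alpha> t m = g"
    unfolding reduced_minor_I_def
  proof (rule the_equality)
    show "fourier_poly R g \<and> (\<forall>x. g x * (\<Prod>i\<in>I - {m}. e_root (\<alpha> i) x) = minor_J \<alpha> t m x)"
      using fg gJ by blast
  qed (use uniq in blast)
  moreover have "Determinant.det (mat_delete (frame_mat \<alpha> B x) 0 (m - 1)) = g x"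
  proof -
    let ?A = "mat_delete (frame_mat \<alpha> B x) 0 (m - 1)"
    have A: "?A \<in> carrier_mat (Suc ?N) (Suc ?N)"
      using frame_mat_carrier[of \<alpha> B x] n by (auto simp: mat_delete_def)
    have "Determinant.det ?A = Determinant.det (mat ?N ?N (\<lambda>(i, j). ?A $$ (i, j)))"
      by (rule det_unit_last_row[OF A]) (use t m n in \<open>auto simp: mat_delete_def frame_mat_def frame_matrix_def\<close>)
    also have "mat ?N ?N (\<lambda>(i, j). ?A $$ (i, j)) = mat ?N ?N (\<lambda>(i, j). B (Suc i) (?f j) x)"
      by (intro eq_matI) (auto simp: mat_delete_def frame_mat_def insert_index_def)
    finally show ?thesis by (simp add: g_def)
  qed
  ultimately show ?thesis by (simp add: frame_cofactor_def cofactor_def)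
qed

end

section \<open>The determinant of the restricted metric\<close>

lemma marked_index_range:
  "type_rank X l \<Longrightarrow> marked_index X l k \<Longrightarrow> k \<in> {1..l}"
  by (cases X) auto

lemma root_norm2_rational: "root_norm2 X l i \<in> \<rat>"
  by (cases X) auto

context root_data
begin

lemma mirror_product_nonzero: "\<exists>x. mirror_product \<alpha> x \<noteq> 0"
proof -
  obtain \<xi> where \<xi>: "\<forall>j\<in>I. \<xi> \<bullet> \<alpha> j = 1" using dual_vector[of "\<lambda>_. 1"] by blast
  have "mirror \<alpha> l (emb \<xi>) \<noteq> 0" if l: "l < Suc (\<ell>)" for l
  proof (cases "l < \<ell>")
    case True
    then have "cpair (\<alpha> (Suc l)) (emb \<xi>) = 1" using \<xi> by (simp add: cpair_emb inner_commute)
    then have "mirror \<alpha> l (emb \<xi>) = exp (complex_of_real (1 / 2)) - exp (complex_of_real (- 1 / 2))"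
      using True by (simp add: mirror_def e_root_exp)
    also have "\<dots> = complex_of_real (exp (1 / 2) - exp (- 1 / 2))"
      unfolding exp_of_real of_real_diff ..
    finally show ?thesis by (simp only: of_real_eq_0_iff) simp
  qed (simp add: mirror_def)
  then have "mirror_product \<alpha> (emb \<xi>) \<noteq> 0"
    unfolding mirror_product_def by (simp del: lessThan_Suc prod.lessThan_Suc)
  then show ?thesis by blast
qed

lemma weight_norm_nonzero: "k \<in> I \<Longrightarrow> dz_degree \<alpha> k k \<noteq> 0"
  using weight_simple[of k k] simple_norm_pos[of k] by (auto simp: dz_degree_def)

lemma cofactors_on_stratum:
  assumes t: "frame_matrix \<alpha> t B" and et: "\<And>i. i \<in> I \<Longrightarrow> exp_sum (t i)"
    and ab: "a < \<ell>" "b < \<ell>" "a \<noteq> b"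
    and x: "x \<in> stratum \<alpha> (Suc a) (Suc b)" and no: "\<alpha> (Suc a) \<bullet> \<alpha> (Suc b) \<noteq> 0"
  shows "frame_cofactor \<alpha> B 0 a x + frame_cofactor \<alpha> B 0 b x = 0"
proof -
  have x0: "cpair (\<alpha> (Suc a)) x = 0" "cpair (\<alpha> (Suc b)) x = 0" using x by (auto simp: stratum_def)
  have "frame_mat \<alpha> B x $$ (i, a) = frame_mat \<alpha> B x $$ (i, b)" if "i < Suc (\<ell>)" for i
    using columns_agree[OF t et ab(1,2) _ x0 no, of i] that ab by (simp add: frame_mat_def less_Suc_eq_le)
  then show ?thesis
    using cofactor_equal_columns[OF frame_mat_carrier[of \<alpha> B x], of 0 a b] ab
    by (simp add: frame_cofactor_def)
qed

text \<open>
  The theorem in terms of the simple roots alone. The labelling of the roots enters through the square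
  length of the marked root, which is rational and makes the exponents of \<open>y\<close> rational.
\<close>

theorem det_restricted_saito:
  assumes k: "k \<in> I" and rat: "\<alpha> k \<bullet> \<alpha> k \<in> \<rat>" and flat: "saito_flat_coords R \<alpha> k \<kappa> t"
    and ab: "a < b" "b < \<ell>" and rs: "r \<noteq> s" "{r, s} = {Suc a, Suc b}"
  shows "\<exists>q. q \<noteq> 0 \<and> (\<forall>x\<in>stratum \<alpha> r s.
    Determinant.det (restricted_gram R \<alpha> k \<kappa> r s x) =
       q * (reduced_minor_I R \<alpha> t s x * reduced_minor_I R \<alpha> t r x *
            (\<Prod>i\<in>I - {r, s}. (e_root (\<alpha> i) x)\<^sup>2)))"
proof -
  have d: "dz_degree \<alpha> k k \<noteq> 0" by (rule weight_norm_nonzero[OF k])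
  have k': "k - 1 \<le> \<ell>" "Suc (k - 1) = k" using k by auto
  have div_y: "divisible_derivatives (y_coord R \<alpha> k i)" if "i \<in> I" for i
    using divisible_derivatives_y[OF that] weight_rational[OF that k rat] by (simp add: dz_degree_def)
  have div_t: "divisible_derivatives (t i)" if i: "i \<in> I" for i
  proof (rule divisible_derivatives_poly_in)
    show "t i \<in> poly_in (y_coord R \<alpha> k ` I \<union> {\<lambda>x. exp (x $ None)})"
      using flat i unfolding saito_flat_coords_def by blast
    show "divisible_derivatives g" if "g \<in> y_coord R \<alpha> k ` I \<union> {\<lambda>x. exp (x $ None)}" for g
      using that div_y divisible_derivatives_exp_last[of 1] by auto
  qed
  obtain By where y: "frame_matrix \<alpha> (y_coord R \<alpha> k) By"
  proof (rule frame_matrix_exists[of "y_coord R \<alpha> k"])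
    show "y_coord R \<alpha> k (\<ell> + 1) = (\<lambda>x. x $ None)" by (rule ext) (simp add: y_coord_def)
  qed (use div_y in \<open>auto simp: divisible_derivatives_def\<close>)
  obtain B where t: "frame_matrix \<alpha> t B"
    and fB: "\<And>a l. a < \<ell> \<Longrightarrow> l < \<ell> \<Longrightarrow> fourier_poly R (B a l)"
  proof (rule frame_matrix_exists[of t])
    show "t (\<ell> + 1) = (\<lambda>x. x $ None)" using flat unfolding saito_flat_coords_def by blast
  qed (use div_t in \<open>auto simp: divisible_derivatives_def\<close>)
  have et: "exp_sum (t i)" if "i \<in> I" for i
    using div_t[OF that] fourier_poly_exp_sum unfolding divisible_derivatives_def by blast
  note mnz = mirror_product_nonzero
  have nz: "\<exists>x. frame_det \<alpha> By x \<noteq> 0"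
    using frame_det_y_nonzero[OF y, of "{}"] by auto
  obtain c where c: "c \<noteq> 0"
    and e: "\<And>z. z \<in> regular_points \<alpha> By \<Longrightarrow> coords_at t z \<and> e_field R \<alpha> k \<kappa> z = coord_field t 1 z"
    and inv: "\<And>z. z \<in> regular_points \<alpha> By \<Longrightarrow>
      saito_contra R \<alpha> k \<kappa> z ** cov_matrix t c z = Finite_Cartesian_Product.mat 1"
    and sm: "\<And>x u v. saito_metric R \<alpha> k \<kappa> x u v = cov_metric t c x u v"
    by (rule saito_metric_flat[OF y t k d flat nz mnz]) (rule that)
  have id_t: "(\<Sum>l\<le>\<ell>. frame_inverse \<alpha> k B 0 j l x * frame_gram B c x $$ (l, m)) =
      (if j = m then (frame_det \<alpha> B x)\<^sup>2 else 0)" if "j \<le> \<ell>" "m \<le> \<ell>" for x j m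
    using frame_inverse_gram[OF y t t le0 d nz mnz inv _ that, where \<kappa>' = 1] e by simp
  have id_y: "(\<Sum>l\<le>\<ell>. \<kappa> * frame_inverse \<alpha> k By (k - 1) j l x * frame_gram B c x $$ (l, m)) =
      (if j = m then (frame_det \<alpha> By x)\<^sup>2 else 0)" if "j \<le> \<ell>" "m \<le> \<ell>" for x j m
  proof (rule frame_inverse_gram[OF y t y k'(1) d nz mnz inv _ that])
    fix z assume "z \<in> regular_points \<alpha> By"
    then show "coords_at (y_coord R \<alpha> k) z \<and> e_field R \<alpha> k \<kappa> z = \<kappa> *s coord_field (y_coord R \<alpha> k) (Suc (k - 1)) z"
      unfolding coords_at_iff[OF y] k'(2) e_field_def by (simp add: regular_points_def)
  qed
  have transfer: "frame_det \<alpha> B x \<noteq> 0" if "frame_det \<alpha> By x \<noteq> 0" for x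
    by (rule frame_det_transfer[OF id_y that])
  have strat: "stratum \<alpha> r s = stratum \<alpha> (Suc a) (Suc b)"
    using rs(2) by (auto simp: stratum_def doubleton_eq_iff)
  obtain y0 where y0: "frame_det \<alpha> B y0 \<noteq> 0" using nz transfer by blast
  have alt: "(\<forall>x\<in>stratum \<alpha> (Suc a) (Suc b). frame_cofactor \<alpha> B 0 a x + frame_cofactor \<alpha> B 0 b x = 0) \<or>
      (\<exists>x\<in>stratum \<alpha> (Suc a) (Suc b). frame_det \<alpha> B x \<noteq> 0)"
  proof (cases "\<alpha> (Suc a) \<bullet> \<alpha> (Suc b) = 0")
    case True
    have "\<exists>x. (\<forall>j\<in>{Suc a, Suc b}. cpair (\<alpha> j) x = 0) \<and> frame_det \<alpha> By x \<noteq> 0"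
      by (rule frame_det_y_nonzero[OF y]) (use ab True in \<open>auto simp: inner_commute\<close>)
    then show ?thesis using transfer by (auto simp: stratum_def)
  next
    case False
    then show ?thesis using cofactors_on_stratum[OF t et _ ab(2) _ _ False] ab by auto
  qed
  obtain K where K: "K \<noteq> 0" "\<And>x. x \<in> stratum \<alpha> (Suc a) (Suc b) \<Longrightarrow>
      Determinant.det (mat_delete (mat_delete (frame_gram B c x) b b) a a) =
      K * (frame_cofactor \<alpha> B 0 a x * frame_cofactor \<alpha> B 0 b x)"
    using gram_minor_stratum[OF t ab c id_t y0 alt] by blast
  have cof: "frame_cofactor \<alpha> B 0 l x = (- 1) ^ l * reduced_minor_I R \<alpha> t (Suc l) x" if "l < \<ell>" for l x
    using reduced_minor_cofactor[OF t fB _ mnz, of "Suc l" x] that by simp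
  have "Determinant.det (restricted_gram R \<alpha> k \<kappa> r s x) = (K * (- 1) ^ (a + b)) *
      (reduced_minor_I R \<alpha> t s x * reduced_minor_I R \<alpha> t r x * (\<Prod>i\<in>I - {r, s}. (e_root (\<alpha> i) x)\<^sup>2))"
    if x: "x \<in> stratum \<alpha> r s" for x
  proof -
    have "reduced_minor_I R \<alpha> t (Suc a) x * reduced_minor_I R \<alpha> t (Suc b) x =
        reduced_minor_I R \<alpha> t s x * reduced_minor_I R \<alpha> t r x"
      using rs by (auto simp: doubleton_eq_iff)
    moreover have "Determinant.det (restricted_gram R \<alpha> k \<kappa> r s x) = (\<Prod>i\<in>I - {r, s}. (e_root (\<alpha> i) x)\<^sup>2) *
        (K * ((- 1) ^ a * reduced_minor_I R \<alpha> t (Suc a) x * ((- 1) ^ b * reduced_minor_I R \<alpha> t (Suc b) x)))"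
      unfolding det_restricted_gram[OF t ab rs sm x] using K(2)[of x] x strat cof ab by simp
    ultimately show ?thesis by (simp add: power_add mult_ac)
  qed
  moreover have "K * (- 1) ^ (a + b) \<noteq> 0" using K(1) by simp
  ultimately show ?thesis by blast
qed

end

theorem theorem3p21:
  fixes R :: "(real^'n) set"
    and \<alpha> :: "nat \<Rightarrow> real^'n"
    and X :: dynkin_type
    and k r s :: nat
    and \<kappa> :: complex
    and t :: "nat \<Rightarrow> complex^('n option) \<Rightarrow> complex"
  assumes "root_system R" and "irreducible_roots R" and "simple_roots R \<alpha>"
    and "bourbaki_labelled X \<alpha>" and "marked_index X CARD('n) k"
    and "\<kappa> \<noteq> 0" and "saito_flat_coords R \<alpha> k \<kappa> t"
    and "r \<in> {1..CARD('n)}" and "s \<in> {1..CARD('n)}" and "r \<noteq> s"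
  shows "\<exists>u. fourier_unit R u \<and>
    (\<forall>x\<in>stratum \<alpha> r s.
       Determinant.det (restricted_gram R \<alpha> k \<kappa> r s x) =
       u x * (reduced_minor_I R \<alpha> t s x * reduced_minor_I R \<alpha> t r x *
              (\<Prod>i\<in>{1..CARD('n)} - {r, s}. (e_root (\<alpha> i) x)\<^sup>2)))"
proof -
  interpret root_data R \<alpha> by unfold_locales (fact assms)+
  have k: "k \<in> {1..CARD('n)}"
    using marked_index_range assms(4,5) unfolding bourbaki_labelled_def by blast
  have "\<alpha> k \<bullet> \<alpha> k = root_norm2 X CARD('n) k"
    using assms(4) k unfolding bourbaki_labelled_def by auto
  then have rat: "\<alpha> k \<bullet> \<alpha> k \<in> \<rat>" by (simp add: root_norm2_rational)
  define a where "a = min r s - 1"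
  define b where "b = max r s - 1"
  have ab: "a < b" "b < CARD('n)" "{r, s} = {Suc a, Suc b}"
    using assms(8-10) by (auto simp: a_def b_def min_def max_def)
  obtain q where q: "q \<noteq> 0" "\<forall>x\<in>stratum \<alpha> r s.
      Determinant.det (restricted_gram R \<alpha> k \<kappa> r s x) =
       q * (reduced_minor_I R \<alpha> t s x * reduced_minor_I R \<alpha> t r x *
            (\<Prod>i\<in>{1..CARD('n)} - {r, s}. (e_root (\<alpha> i) x)\<^sup>2))"
    using det_restricted_saito[OF k rat assms(7) ab(1,2) assms(10) ab(3)] by blast
  have "fourier_unit R (\<lambda>_. q)"
    unfolding fourier_unit_def
    by (rule exI[of _ q], rule exI[of _ 0], rule exI[of _ 0], rule exI[of _ 1])
       (simp add: q weight_lattice_zero fourier_exp_def)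
  then show ?thesis using q(2) by blast
qed

end
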